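(* Let $X$ be a quasimetric space and $G$ be a digraph. Then the following holds (for all natural numbers $n$). (1) For every real $\ell$, $\mathrm{MH}_{n,\ell}(X)\cong\mathrm{SH}^0_{n,\{\ell\}}(X)$. In particular, for any $r\ge0$ the module $\mathrm{SH}^r_{n,\{\ell\}}(X)$ is an $r$-homotopy invariant subquotient of $\mathrm{MH}_{n,\ell}(X)$. (2) There is an isomorphism of persistent modules $\mathrm{BMH}_n(X)\cong\mathrm{PSH}^0_n(X)$. In particular, for any $r\ge0$ the persistent module $\mathrm{PSH}^r_n(X)$ is an $r$-homotopy invariant subquotient persistent module of $\mathrm{BMH}_n(X)$. (3) $\mathrm{RH}_n(X)\cong\mathrm{SH}^r_{n,\mathbb R}(X)$ for any real $r\ge0$. (4) For any integer $r\ge1$ and any integer $\ell$, the $r$-th page of the magnitude-path spectral sequence of $G$ satisfies $E^r_{\ell,n-\ell}(G)\cong\mathrm{SH}^{r-1}_{n,\{\ell\}}(G)$. (5) In particular, path homology can be described as $\mathrm{PH}_n(G)\cong\mathrm{SH}^1_{n,\{n\}}(G)$.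
   Context: Quasimetric spaces. A quasimetric space is a set $X$ with $d:X\times X\to[0,+\infty]$ satisfying the triangle inequality and $d(x,y)=0\iff x=y$ (not necessarily symmetric). A map $\varphi:X\to Y$ is short if $d(\varphi(x),\varphi(x'))\le d(x,x')$. Short maps $X\to Y$ form a quasimetric space with $d(\varphi,\psi)=\sup_x d(\varphi(x),\psi(x))$. Two short maps are $r$-homotopic if they are related by the smallest equivalence relation $\sim_r$ on short maps $X\to Y$ such that $d(\varphi,\psi)\le r$ implies $\varphi\sim_r\psi$. A functor on quasimetric spaces is $r$-homotopy invariant if $r$-homotopic short maps induce equal morphisms. Intervals. An interval is a convex subset of $\mathbb R$. Every non-empty interval is uniquely $I=R_I\setminus L_I$ with $R_I=\{s\in\mathbb R\mid\exists i\in I,\ s\le i\}$ and $L_I=\{s\in\mathbb R\mid\forall i\in I,\ s<i\}$. For real $r\ge0$ put $I_{-r}=R_I\setminus(L_I-r)$ and $I^{+r}=(R_I+r)\setminus L_I$. Write $I\preccurlyeq J$ if $R_I\subseteq R_J$ and $L_I\subseteq L_J$. Spectral homology. Let $\mathbb K$ be a commutative ring. An $\mathbb R$-filtered chain complex $C$ over $\mathbb K$ has subcomplexes $F_sC$, $s\in\mathbb R$, with $F_sC\subseteq F_{s'}C$ for $s<s'$. For a downward closed $L\subseteq\mathbb R$ put $F_LC=\bigcup_{s\in L}F_sC$ (zero if $L=\emptyset$), and put $C_I=F_{R_I}C/F_{L_I}C$. For $I\preccurlyeq J$ inclusions induce $C_I\to C_J$. Set $\mathrm{SZ}^r_{n,I}(C)=\mathrm{Im}(H_n(C_{I_{-r}})\to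 H_n(C_I))$, $\mathrm{SB}^r_{n,I}(C)=\mathrm{Ker}(H_n(C_I)\to H_n(C_{I^{+r}}))\subseteq\mathrm{SZ}^r_{n,I}(C)$ and $\mathrm{SH}^r_{n,I}(C)=\mathrm{SZ}^r_{n,I}(C)/\mathrm{SB}^r_{n,I}(C)\cong\mathrm{Im}(H_n(C_{I_{-r}})\to H_n(C_{I^{+r}}))$. In particular $\mathrm{SH}^0_{n,I}(C)=H_n(C_I)$. For $I\preccurlyeq J$ the maps $C_{I_{-r}}\to C_{J_{-r}}$ and $C_{I^{+r}}\to C_{J^{+r}}$ induce a morphism $\mathrm{SH}^r_{n,I}(C)\to\mathrm{SH}^r_{n,J}(C)$. Reachability complex. For a quasimetric space $X$, $\mathrm{RC}(X)$ is the chain complex with $\mathrm{RC}_n(X)$ the free $\mathbb K$-module on tuples $(x_0,\dots,x_n)$ with $x_i\ne x_{i+1}$ and $d(x_i,x_{i+1})<+\infty$, differential $\partial(x_0,\dots,x_n)=\sum_{i=0}^n(-1)^i(x_0,\dots,\hat x_i,\dots,x_n)$, where tuples with a consecutive repetition are set equal to $0$. $F_s\mathrm{RC}(X)$ is spanned by tuples with $\sum_i d(x_i,x_{i+1})\le s$. Put $\mathrm{SH}^r_{n,I}(X)=\mathrm{SH}^r_{n,I}(\mathrm{RC}(X))$. Homology theories. A persistent module is a functor from the poset $([0,+\infty),\le)$ to $\mathbb K$-modules. - Persistent spectral homology: $\mathrm{PSH}^r_n(X)(\ell)=\mathrm{SH}^r_{n,[0,\ell]}(X)$, with the structure morphisms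 coming from $[0,\ell]\preccurlyeq[0,\ell']$ for $\ell\le\ell'$. - Magnitude homology: $\mathrm{MH}_{n,\ell}(X)=H_n\big(F_\ell\mathrm{RC}(X)/F_{(-\infty,\ell)}\mathrm{RC}(X)\big)$. - Blurred magnitude homology: the persistent module $\mathrm{BMH}_n(X)(\ell)=H_n(F_\ell\mathrm{RC}(X))$, with structure morphisms induced by inclusions. - Reachability homology: $\mathrm{RH}_n(X)=H_n(\mathrm{RC}(X))$. Digraphs. A digraph is $G=(G_0,G_1)$ with $G_1\subseteq G_0\times G_0$ containing all $(g,g)$. It is identified with the quasimetric space on $G_0$ where $d(g,g')$ is the infimum of lengths of directed paths from $g$ to $g'$; $\mathrm{RC}(G)$ and $\mathrm{SH}^r_{n,I}(G)$ are defined via this quasimetric space. The magnitude-path spectral sequence $E(G)$ is the spectral sequence of the chain complex $\mathrm{RC}(G)$ with the $\mathbb Z$-filtration $F_\ell\mathrm{RC}(G)$, $\ell\in\mathbb Z$, indexed so that $E^1_{\ell,n-\ell}(G)=H_n(F_\ell\mathrm{RC}(G)/F_{\ell-1}\mathrm{RC}(G))$. Path homology (GLMY homology): let $A_n(G)\subseteq\mathrm{RC}_n(G)$ be spanned by tuples $(g_0,\dots,g_n)$ with $(g_i,g_{i+1})\in G_1$ and $g_i\neq g_{i+1}$ for all $i$, and $\Omega_n(G)=\{v\in A_n(G)\mid\partial v\in A_{n-1}(G)\}$; then $\mathrm{PH}_n(G)=H_n(\Omega_\bullet(G))$. It is known that $E^2_{n,0}(G)=\mathrm{PH}_n(G)$.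 *)

theory Defs
  imports "HOL-Library.Extended_Nonnegative_Real" "HOL-Algebra.Module" "HOL-Algebra.AbelCoset"
begin

section \<open>Modules\<close>

definition module_homs ::
    "('k, 'z) ring_scheme \<Rightarrow> ('k, 'a) module \<Rightarrow> ('k, 'b) module \<Rightarrow> ('a \<Rightarrow> 'b) set" where
  "module_homs K M N =
     {h \<in> carrier M \<rightarrow> carrier N.
        (\<forall>x\<in>carrier M. \<forall>y\<in>carrier M. h (x \<oplus>\<^bsub>M\<^esub> y) = h x \<oplus>\<^bsub>N\<^esub> h y) \<and>
        (\<forall>k\<in>carrier K. \<forall>x\<in>carrier M. h (k \<odot>\<^bsub>M\<^esub> x) = k \<odot>\<^bsub>N\<^esub> h x)}"

definition module_iso :: "('k, 'z) ring_scheme \<Rightarrow> ('k, 'a) module \<Rightarrow> ('k, 'b) module \<Rightarrow> ('a \<Rightarrow> 'b) set" where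
  "module_iso K M N = {h \<in> module_homs K M N. bij_betw h (carrier M) (carrier N)}"

definition modules_isomorphic :: "('k, 'z) ring_scheme \<Rightarrow> ('k, 'a) module \<Rightarrow> ('k, 'b) module \<Rightarrow> bool" where
  "modules_isomorphic K M N \<longleftrightarrow>
     module K M \<and> module K N \<and> module_iso K M N \<noteq> {}"

abbreviation restrict_module :: "('k, 'a) module \<Rightarrow> 'a set \<Rightarrow> ('k, 'a) module" where
  "restrict_module M H \<equiv> M\<lparr>carrier := H\<rparr>"

text \<open>
  The map into \<open>M/N\<close> or between quotients induced by \<open>h\<close>: a coset is sent to the coset of
  \<open>N\<close> in \<open>M\<close> containing the image of any representative (written as a union over all
  representatives, whose cosets coincide).
\<close>
definition quot_map :: "('k, 'b) module \<Rightarrow> 'b set \<Rightarrow> ('a \<Rightarrow> 'b) \<Rightarrow> 'a set \<Rightarrow> 'b set" where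
  "quot_map M N h A = (\<Union>a\<in>A. N +>\<^bsub>M\<^esub> h a)"

text \<open>The multiplication and unit fields of the record play no role for modules.\<close>
definition quot_module :: "('k, 'a) module \<Rightarrow> 'a set \<Rightarrow> ('k, 'a set) module" where
  "quot_module M N =
     \<lparr>carrier = a_rcosets\<^bsub>M\<^esub> N, mult = undefined, one = undefined, zero = N,
      add = (\<lambda>A B. A <+>\<^bsub>M\<^esub> B), smult = (\<lambda>k. quot_map M N (\<lambda>a. k \<odot>\<^bsub>M\<^esub> a))\<rparr>"

definition support :: "('k, 'z) ring_scheme \<Rightarrow> ('s \<Rightarrow> 'k) \<Rightarrow> 's set" where
  "support K c = {s. c s \<noteq> \<zero>\<^bsub>K\<^esub>}"

definition free_module :: "('k, 'z) ring_scheme \<Rightarrow> 's set \<Rightarrow> ('k, 's \<Rightarrow> 'k) module" where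
  "free_module K S =
     \<lparr>carrier = {c. range c \<subseteq> carrier K \<and> finite (support K c) \<and> support K c \<subseteq> S},
      mult = undefined, one = undefined, zero = (\<lambda>s. \<zero>\<^bsub>K\<^esub>),
      add = (\<lambda>c e s. c s \<oplus>\<^bsub>K\<^esub> e s), smult = (\<lambda>k c s. k \<otimes>\<^bsub>K\<^esub> c s)\<rparr>"

text \<open>The linear map on finitely supported functions with prescribed values \<open>T s\<close> on the basis.\<close>
definition linear_extension ::
    "('k, 'z) ring_scheme \<Rightarrow> ('s \<Rightarrow> 't \<Rightarrow> 'k) \<Rightarrow> ('s \<Rightarrow> 'k) \<Rightarrow> 't \<Rightarrow> 'k" where
  "linear_extension K T c = (\<lambda>t. \<Oplus>\<^bsub>K\<^esub>s\<in>support K c. c s \<otimes>\<^bsub>K\<^esub> T s t)"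


section \<open>Module-valued functors\<close>

text \<open>The argument of \<open>Comp\<close> of type \<open>'o\<close> is the source of the composite.\<close>
record ('o, 'm) cat =
  Ob :: "'o set"
  Hom :: "'o \<Rightarrow> 'o \<Rightarrow> 'm set"
  Ident :: "'o \<Rightarrow> 'm"
  Comp :: "'o \<Rightarrow> 'm \<Rightarrow> 'm \<Rightarrow> 'm"

definition prod_cat :: "('o, 'm) cat \<Rightarrow> ('p, 'n) cat \<Rightarrow> ('o \<times> 'p, 'm \<times> 'n) cat" where
  "prod_cat C D =
     \<lparr>Ob = Ob C \<times> Ob D,
      Hom = (\<lambda>(X, P) (Y, Q). Hom C X Y \<times> Hom D P Q),
      Ident = (\<lambda>(X, P). (Ident C X, Ident D P)),
      Comp = (\<lambda>(X, P) (g, v) (f, u). (Comp C X g f, Comp D P v u))\<rparr>"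

record ('o, 'm, 'k, 'a) mod_functor =
  fobj :: "'o \<Rightarrow> ('k, 'a) module"
  farr :: "'o \<Rightarrow> 'o \<Rightarrow> 'm \<Rightarrow> 'a \<Rightarrow> 'a"

definition is_functor ::
    "('k, 'z) ring_scheme \<Rightarrow> ('o, 'm) cat \<Rightarrow> ('o, 'm, 'k, 'a) mod_functor \<Rightarrow> bool" where
  "is_functor K C F \<longleftrightarrow>
     (\<forall>X\<in>Ob C. module K (fobj F X)) \<and>
     (\<forall>X\<in>Ob C. \<forall>Y\<in>Ob C. \<forall>f\<in>Hom C X Y. farr F X Y f \<in> module_homs K (fobj F X) (fobj F Y)) \<and>
     (\<forall>X\<in>Ob C. \<forall>a\<in>carrier (fobj F X). farr F X X (Ident C X) a = a) \<and>
     (\<forall>X\<in>Ob C. \<forall>Y\<in>Ob C. \<forall>Z\<in>Ob C. \<forall>f\<in>Hom C X Y. \<forall>g\<in>Hom C Y Z. \<forall>a\<in>carrier (fobj F X).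
        farr F X Z (Comp C X g f) a = farr F Y Z g (farr F X Y f a))"

definition naturally_isomorphic ::
    "('k, 'z) ring_scheme \<Rightarrow> ('o, 'm) cat \<Rightarrow> ('o, 'm, 'k, 'a) mod_functor \<Rightarrow>
     ('o, 'm, 'k, 'b) mod_functor \<Rightarrow> bool" where
  "naturally_isomorphic K C F G \<longleftrightarrow>
     is_functor K C F \<and> is_functor K C G \<and>
     (\<exists>\<eta>. (\<forall>X\<in>Ob C. \<eta> X \<in> module_iso K (fobj F X) (fobj G X)) \<and>
          (\<forall>X\<in>Ob C. \<forall>Y\<in>Ob C. \<forall>f\<in>Hom C X Y. \<forall>a\<in>carrier (fobj F X).
             \<eta> Y (farr F X Y f a) = farr G X Y f (\<eta> X a)))"

text \<open>\<open>S\<close> is a subquotient of \<open>M\<close>: isomorphic to \<open>Z/B\<close> for subfunctors \<open>B \<subseteq> Z \<subseteq> M\<close>.\<close>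
definition subquotient_functor ::
    "('k, 'z) ring_scheme \<Rightarrow> ('o, 'm) cat \<Rightarrow> ('o, 'm, 'k, 'b) mod_functor \<Rightarrow>
     ('o, 'm, 'k, 'a) mod_functor \<Rightarrow> bool" where
  "subquotient_functor K C S M \<longleftrightarrow>
     is_functor K C M \<and>
     (\<exists>Z B. (\<forall>X\<in>Ob C. submodule (Z X) K (fobj M X) \<and> submodule (B X) K (fobj M X) \<and> B X \<subseteq> Z X) \<and>
            (\<forall>X\<in>Ob C. \<forall>Y\<in>Ob C. \<forall>f\<in>Hom C X Y.
               farr M X Y f ` Z X \<subseteq> Z Y \<and> farr M X Y f ` B X \<subseteq> B Y) \<and>
            naturally_isomorphic K C
              \<lparr>fobj = (\<lambda>X. quot_module (restrict_module (fobj M X) (Z X)) (B X)),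
               farr = (\<lambda>X Y f. quot_map (fobj M Y) (B Y) (farr M X Y f))\<rparr> S)"


section \<open>Quasimetric spaces\<close>

record 'x qspace =
  Pts :: "'x set"
  Dist :: "'x \<Rightarrow> 'x \<Rightarrow> ennreal"

definition quasimetric :: "'x qspace \<Rightarrow> bool" where
  "quasimetric X \<longleftrightarrow>
     (\<forall>x\<in>Pts X. \<forall>y\<in>Pts X. Dist X x y = 0 \<longleftrightarrow> x = y) \<and>
     (\<forall>x\<in>Pts X. \<forall>y\<in>Pts X. \<forall>z\<in>Pts X. Dist X x z \<le> Dist X x y + Dist X y z)"

definition short_maps :: "'x qspace \<Rightarrow> 'y qspace \<Rightarrow> ('x \<Rightarrow> 'y) set" where
  "short_maps X Y =
     {f \<in> Pts X \<rightarrow>\<^sub>E Pts Y. \<forall>x\<in>Pts X. \<forall>x'\<in>Pts X. Dist Y (f x) (f x') \<le> Dist X x x'}"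

definition short_dist :: "'x qspace \<Rightarrow> 'y qspace \<Rightarrow> ('x \<Rightarrow> 'y) \<Rightarrow> ('x \<Rightarrow> 'y) \<Rightarrow> ennreal" where
  "short_dist X Y \<phi> \<psi> = (SUP x\<in>Pts X. Dist Y (\<phi> x) (\<psi> x))"

definition homotopic :: "real \<Rightarrow> 'x qspace \<Rightarrow> 'y qspace \<Rightarrow> (('x \<Rightarrow> 'y) \<times> ('x \<Rightarrow> 'y)) set" where
  "homotopic r X Y =
     \<Inter>{R. equiv (short_maps X Y) R \<and>
         {(\<phi>, \<psi>). \<phi> \<in> short_maps X Y \<and> \<psi> \<in> short_maps X Y \<and> short_dist X Y \<phi> \<psi> \<le> ennreal r} \<subseteq> R}"

definition qmet :: "('x qspace, 'x \<Rightarrow> 'x) cat" where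
  "qmet = \<lparr>Ob = {X. quasimetric X}, Hom = short_maps,
           Ident = (\<lambda>X. \<lambda>x\<in>Pts X. x), Comp = (\<lambda>X g f. compose (Pts X) g f)\<rparr>"

definition halfline :: "(real, unit) cat" where
  "halfline = \<lparr>Ob = {0..}, Hom = (\<lambda>l l'. {u. l \<le> l'}), Ident = (\<lambda>l. ()), Comp = (\<lambda>l v u. ())\<rparr>"

text \<open>
  A functor from quasimetric spaces to persistent modules (functors \<open>[0,\<infinity>) \<rightarrow> K-Mod\<close>) is
  represented, by currying, as a functor \<open>qmet_pers \<rightarrow> K-Mod\<close>. For every fixed space \<open>X\<close>, its
  values at \<open>(X, l)\<close> form a persistent module, and isomorphisms and subquotients of such
  functors restrict to isomorphisms and subquotients of persistent modules.
\<close>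
definition qmet_pers :: "('x qspace \<times> real, ('x \<Rightarrow> 'x) \<times> unit) cat" where
  "qmet_pers = prod_cat qmet halfline"

definition homotopy_invariant :: "real \<Rightarrow> ('x qspace, 'x \<Rightarrow> 'x, 'k, 'a) mod_functor \<Rightarrow> bool" where
  "homotopy_invariant r F \<longleftrightarrow>
     (\<forall>X Y. quasimetric X \<longrightarrow> quasimetric Y \<longrightarrow>
        (\<forall>(\<phi>, \<psi>)\<in>homotopic r X Y. \<forall>a\<in>carrier (fobj F X). farr F X Y \<phi> a = farr F X Y \<psi> a))"

definition homotopy_invariant_pers ::
    "real \<Rightarrow> ('x qspace \<times> real, ('x \<Rightarrow> 'x) \<times> unit, 'k, 'a) mod_functor \<Rightarrow> bool" where
  "homotopy_invariant_pers r F \<longleftrightarrow>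
     (\<forall>X Y. quasimetric X \<longrightarrow> quasimetric Y \<longrightarrow>
        (\<forall>(\<phi>, \<psi>)\<in>homotopic r X Y. \<forall>l\<ge>0. \<forall>a\<in>carrier (fobj F (X, l)).
           farr F (X, l) (Y, l) (\<phi>, ()) a = farr F (X, l) (Y, l) (\<psi>, ()) a))"


section \<open>Chain complexes\<close>

text \<open>\<open>bdry C n\<close> is the differential from degree \<open>n\<close> to degree \<open>n - 1\<close>.\<close>
record ('k, 'c) chain_complex =
  chain :: "int \<Rightarrow> ('k, 'c) module"
  bdry :: "int \<Rightarrow> 'c \<Rightarrow> 'c"

record ('k, 'c) filtered_complex = "('k, 'c) chain_complex" +
  filt :: "real \<Rightarrow> int \<Rightarrow> 'c set"

definition sub_complex ::
    "('k, 'c, 'e) chain_complex_scheme \<Rightarrow> (int \<Rightarrow> 'c set) \<Rightarrow> ('k, 'c) chain_complex" where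
  "sub_complex C P = \<lparr>chain = (\<lambda>n. restrict_module (chain C n) (P n)), bdry = bdry C\<rparr>"

definition quot_complex ::
    "('k, 'c, 'e) chain_complex_scheme \<Rightarrow> (int \<Rightarrow> 'c set) \<Rightarrow> (int \<Rightarrow> 'c set) \<Rightarrow>
     ('k, 'c set) chain_complex" where
  "quot_complex C P Q =
     \<lparr>chain = (\<lambda>n. quot_module (restrict_module (chain C n) (P n)) (Q n)),
      bdry = (\<lambda>n. quot_map (chain C (n - 1)) (Q (n - 1)) (bdry C n))\<rparr>"

definition cycles :: "('k, 'c, 'e) chain_complex_scheme \<Rightarrow> int \<Rightarrow> 'c set" where
  "cycles C n = a_kernel (chain C n) (chain C (n - 1)) (bdry C n)"

definition boundaries :: "('k, 'c, 'e) chain_complex_scheme \<Rightarrow> int \<Rightarrow> 'c set" where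
  "boundaries C n = bdry C (n + 1) ` carrier (chain C (n + 1))"

definition homology :: "('k, 'c, 'e) chain_complex_scheme \<Rightarrow> int \<Rightarrow> ('k, 'c set) module" where
  "homology C n = quot_module (restrict_module (chain C n) (cycles C n)) (boundaries C n)"

text \<open>The map into the homology of \<open>D\<close> induced by a chain map \<open>f\<close> with target \<open>D\<close>.\<close>
definition homology_map ::
    "('k, 'd, 'e) chain_complex_scheme \<Rightarrow> int \<Rightarrow> (int \<Rightarrow> 'c \<Rightarrow> 'd) \<Rightarrow> 'c set \<Rightarrow> 'd set" where
  "homology_map D n f = quot_map (chain D n) (boundaries D n) (f n)"

text \<open>The chain map into the quotient of a subcomplex of \<open>D\<close> by \<open>Q\<close> induced by \<open>f\<close>.\<close>
definition quot_chain_map ::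
    "('k, 'd, 'e) chain_complex_scheme \<Rightarrow> (int \<Rightarrow> 'd set) \<Rightarrow> (int \<Rightarrow> 'c \<Rightarrow> 'd) \<Rightarrow>
     int \<Rightarrow> 'c set \<Rightarrow> 'd set" where
  "quot_chain_map D Q f n = quot_map (chain D n) (Q n) (f n)"


section \<open>Spectral homology\<close>

definition right_part :: "real set \<Rightarrow> real set" where
  "right_part I = {s. \<exists>i\<in>I. s \<le> i}"

definition left_part :: "real set \<Rightarrow> real set" where
  "left_part I = {s. \<forall>i\<in>I. s < i}"

definition shift_left :: "real \<Rightarrow> real set \<Rightarrow> real set" where
  "shift_left r I = right_part I - (\<lambda>s. s - r) ` left_part I"

definition shift_right :: "real \<Rightarrow> real set \<Rightarrow> real set" where
  "shift_right r I = (\<lambda>s. s + r) ` right_part I - left_part I"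

definition filt_down ::
    "('k, 'c, 'e) filtered_complex_scheme \<Rightarrow> real set \<Rightarrow> int \<Rightarrow> 'c set" where
  "filt_down C L n = (if L = {} then {\<zero>\<^bsub>chain C n\<^esub>} else (\<Union>s\<in>L. filt C s n))"

definition interval_complex ::
    "('k, 'c, 'e) filtered_complex_scheme \<Rightarrow> real set \<Rightarrow> ('k, 'c set) chain_complex" where
  "interval_complex C I = quot_complex C (filt_down C (right_part I)) (filt_down C (left_part I))"

text \<open>
  The map \<open>H_n(C_I) \<rightarrow> H_n(D_J)\<close> induced by a filtered chain map \<open>f : C \<rightarrow> D\<close>, for \<open>I\<close> below \<open>J\<close>.
  Taking identities for \<open>f\<close> gives the maps induced by inclusions.
\<close>
definition interval_map ::
    "('k, 'd, 'e) filtered_complex_scheme \<Rightarrow> int \<Rightarrow> real set \<Rightarrow> (int \<Rightarrow> 'c \<Rightarrow> 'd) \<Rightarrow>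
     'c set set \<Rightarrow> 'd set set" where
  "interval_map D n J f =
     homology_map (interval_complex D J) n (quot_chain_map D (filt_down D (left_part J)) f)"

definition spectral_cycles ::
    "('k, 'c, 'e) filtered_complex_scheme \<Rightarrow> real \<Rightarrow> int \<Rightarrow> real set \<Rightarrow> 'c set set set" where
  "spectral_cycles C r n I =
     interval_map C n I (\<lambda>m c. c) ` carrier (homology (interval_complex C (shift_left r I)) n)"

definition spectral_boundaries ::
    "('k, 'c, 'e) filtered_complex_scheme \<Rightarrow> real \<Rightarrow> int \<Rightarrow> real set \<Rightarrow> 'c set set set" where
  "spectral_boundaries C r n I =
     a_kernel (homology (interval_complex C I) n)
       (homology (interval_complex C (shift_right r I)) n)
       (interval_map C n (shift_right r I) (\<lambda>m c. c))"

definition spectral_homology ::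
    "('k, 'c, 'e) filtered_complex_scheme \<Rightarrow> real \<Rightarrow> int \<Rightarrow> real set \<Rightarrow>
     ('k, 'c set set set) module" where
  "spectral_homology C r n I =
     quot_module (restrict_module (homology (interval_complex C I) n) (spectral_cycles C r n I))
       (spectral_boundaries C r n I)"

text \<open>
  The morphism from \<open>SH^r_{n,I}(C)\<close> to \<open>SH^r_{n,J}(D)\<close> induced by a filtered chain map \<open>f : C \<rightarrow> D\<close>,
  for \<open>I\<close> below \<open>J\<close>: the map of subquotients induced by \<open>H_n(C_I) \<rightarrow> H_n(D_J)\<close>. Under the
  identification of \<open>SH^r_{n,I}\<close> with the image of \<open>H_n(C_{I_{-r}})\<close> in \<open>H_n(C_{I^{+r}})\<close>
  it is the restriction of the morphism \<open>H_n(C_{I^{+r}}) \<rightarrow> H_n(D_{J^{+r}})\<close>.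
\<close>
definition spectral_map ::
    "('k, 'd, 'e) filtered_complex_scheme \<Rightarrow> real \<Rightarrow> int \<Rightarrow> real set \<Rightarrow> (int \<Rightarrow> 'c \<Rightarrow> 'd) \<Rightarrow>
     'c set set set \<Rightarrow> 'd set set set" where
  "spectral_map D r n J f =
     quot_map (homology (interval_complex D J) n) (spectral_boundaries D r n J)
       (interval_map D n J f)"


section \<open>The reachability complex\<close>

text \<open>The tuple \<open>(x_0, ..., x_n)\<close> is the list of its entries, of length \<open>n + 1\<close>.\<close>
definition reach_tuples :: "'x qspace \<Rightarrow> int \<Rightarrow> 'x list set" where
  "reach_tuples X n =
     {xs. xs \<noteq> [] \<and> int (length xs) = n + 1 \<and> set xs \<subseteq> Pts X \<and>
          distinct_adj xs \<and> successively (\<lambda>x y. Dist X x y < \<infinity>) xs}"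

definition tuple_length :: "'x qspace \<Rightarrow> 'x list \<Rightarrow> ennreal" where
  "tuple_length X xs = (\<Sum>i<length xs - 1. Dist X (xs ! i) (xs ! Suc i))"

text \<open>
  The tuple \<open>xs\<close> as a chain. Tuples with a consecutive repetition are zero, and so is the empty
  tuple, since there are no chains in degree \<open>-1\<close>.
\<close>
definition tuple_chain :: "('k, 'z) ring_scheme \<Rightarrow> 'x list \<Rightarrow> 'x list \<Rightarrow> 'k" where
  "tuple_chain K xs =
     (\<lambda>ys. if ys = xs \<and> xs \<noteq> [] \<and> distinct_adj xs then \<one>\<^bsub>K\<^esub> else \<zero>\<^bsub>K\<^esub>)"

definition face :: "nat \<Rightarrow> 'x list \<Rightarrow> 'x list" where
  "face i xs = take i xs @ drop (Suc i) xs"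

definition reach_bdry :: "('k, 'z) ring_scheme \<Rightarrow> ('x list \<Rightarrow> 'k) \<Rightarrow> 'x list \<Rightarrow> 'k" where
  "reach_bdry K = linear_extension K
     (\<lambda>xs ys. \<Oplus>\<^bsub>K\<^esub>i\<in>{..<length xs}.
        ((\<ominus>\<^bsub>K\<^esub> \<one>\<^bsub>K\<^esub>) [^]\<^bsub>K\<^esub> i) \<otimes>\<^bsub>K\<^esub> tuple_chain K (face i xs) ys)"

text \<open>
  The filtration level is compared in \<^typ>\<open>ereal\<close>, because \<^const>\<open>ennreal\<close> sends negative reals
  to \<open>0\<close>; so the filtration vanishes at negative levels.
\<close>
definition RC :: "('k, 'z) ring_scheme \<Rightarrow> 'x qspace \<Rightarrow> ('k, 'x list \<Rightarrow> 'k) filtered_complex" where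
  "RC K X =
     \<lparr>chain = (\<lambda>n. free_module K (reach_tuples X n)),
      bdry = (\<lambda>n. reach_bdry K),
      filt = (\<lambda>s n. carrier (free_module K
                {xs \<in> reach_tuples X n. enn2ereal (tuple_length X xs) \<le> ereal s}))\<rparr>"

definition reach_map ::
    "('k, 'z) ring_scheme \<Rightarrow> ('x \<Rightarrow> 'y) \<Rightarrow> int \<Rightarrow> ('x list \<Rightarrow> 'k) \<Rightarrow> 'y list \<Rightarrow> 'k" where
  "reach_map K f n = linear_extension K (\<lambda>xs. tuple_chain K (map f xs))"


section \<open>Homology theories of quasimetric spaces\<close>

definition SH ::
    "('k, 'z) ring_scheme \<Rightarrow> real \<Rightarrow> int \<Rightarrow> real set \<Rightarrow>
     ('x qspace, 'x \<Rightarrow> 'x, 'k, ('x list \<Rightarrow> 'k) set set set) mod_functor" where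
  "SH K r n I =
     \<lparr>fobj = (\<lambda>X. spectral_homology (RC K X) r n I),
      farr = (\<lambda>X Y f. spectral_map (RC K Y) r n I (reach_map K f))\<rparr>"

definition PSH ::
    "('k, 'z) ring_scheme \<Rightarrow> real \<Rightarrow> int \<Rightarrow>
     ('x qspace \<times> real, ('x \<Rightarrow> 'x) \<times> unit, 'k, ('x list \<Rightarrow> 'k) set set set) mod_functor" where
  "PSH K r n =
     \<lparr>fobj = (\<lambda>(X, l). spectral_homology (RC K X) r n {0..l}),
      farr = (\<lambda>(X, l) (Y, l') (f, u). spectral_map (RC K Y) r n {0..l'} (reach_map K f))\<rparr>"

definition MH ::
    "('k, 'z) ring_scheme \<Rightarrow> int \<Rightarrow> real \<Rightarrow>
     ('x qspace, 'x \<Rightarrow> 'x, 'k, ('x list \<Rightarrow> 'k) set set) mod_functor" where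
  "MH K n l =
     (let Q = (\<lambda>X. filt_down (RC K X) {..<l});
          C = (\<lambda>X. quot_complex (RC K X) (filt (RC K X) l) (Q X))
      in \<lparr>fobj = (\<lambda>X. homology (C X) n),
          farr = (\<lambda>X Y f. homology_map (C Y) n (quot_chain_map (RC K Y) (Q Y) (reach_map K f)))\<rparr>)"

definition BMH ::
    "('k, 'z) ring_scheme \<Rightarrow> int \<Rightarrow>
     ('x qspace \<times> real, ('x \<Rightarrow> 'x) \<times> unit, 'k, ('x list \<Rightarrow> 'k) set) mod_functor" where
  "BMH K n =
     (let C = (\<lambda>X l. sub_complex (RC K X) (filt (RC K X) l))
      in \<lparr>fobj = (\<lambda>(X, l). homology (C X l) n),
          farr = (\<lambda>(X, l) (Y, l') (f, u). homology_map (C Y l') n (reach_map K f))\<rparr>)"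

definition RH ::
    "('k, 'z) ring_scheme \<Rightarrow> int \<Rightarrow>
     ('x qspace, 'x \<Rightarrow> 'x, 'k, ('x list \<Rightarrow> 'k) set) mod_functor" where
  "RH K n =
     \<lparr>fobj = (\<lambda>X. homology (RC K X) n),
      farr = (\<lambda>X Y f. homology_map (RC K Y) n (reach_map K f))\<rparr>"


section \<open>Digraphs\<close>

record 'g digraph =
  verts :: "'g set"
  arrows :: "('g \<times> 'g) set"

definition is_digraph :: "'g digraph \<Rightarrow> bool" where
  "is_digraph G \<longleftrightarrow> arrows G \<subseteq> verts G \<times> verts G \<and> (\<forall>g\<in>verts G. (g, g) \<in> arrows G)"

definition digraph_space :: "'g digraph \<Rightarrow> 'g qspace" where
  "digraph_space G =
     \<lparr>Pts = verts G, Dist = (\<lambda>g h. INF k\<in>{k. (g, h) \<in> arrows G ^^ k}. of_nat k)\<rparr>"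

text \<open>
  The page \<open>E^r_{p,q}\<close> (\<open>r \<ge> 1\<close>) of the spectral sequence of a complex \<open>C\<close> with an increasing
  \<open>\<int>\<close>-filtration \<open>F\<close>, in the usual presentation \<open>Z^r_p / (Z^{r-1}_{p-1} + \<partial> Z^{r-1}_{p+r-1})\<close>, where
  \<open>Z^r_p\<close> consists of the elements of \<open>F_p\<close> with boundary in \<open>F_{p-r}\<close>. The total degree is
  \<open>p + q\<close>, and \<open>E^1_{p,q} = Z^1_p / (F_{p-1} + \<partial> F_p) \<cong> H_{p+q}(F_p / F_{p-1})\<close>.
\<close>
definition approx_cycles ::
    "('k, 'c, 'e) chain_complex_scheme \<Rightarrow> (int \<Rightarrow> int \<Rightarrow> 'c set) \<Rightarrow> int \<Rightarrow> int \<Rightarrow> int \<Rightarrow> 'c set" where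
  "approx_cycles C F r p n = {c \<in> F p n. bdry C n c \<in> F (p - r) (n - 1)}"

definition spectral_page ::
    "('k, 'c, 'e) chain_complex_scheme \<Rightarrow> (int \<Rightarrow> int \<Rightarrow> 'c set) \<Rightarrow> int \<Rightarrow> int \<Rightarrow> int \<Rightarrow>
     ('k, 'c set) module" where
  "spectral_page C F r p q =
     (let n = p + q in
      quot_module (restrict_module (chain C n) (approx_cycles C F r p n))
        (approx_cycles C F (r - 1) (p - 1) n <+>\<^bsub>chain C n\<^esub>
         bdry C (n + 1) ` approx_cycles C F (r - 1) (p + r - 1) (n + 1)))"

definition MPSS ::
    "('k, 'z) ring_scheme \<Rightarrow> 'g digraph \<Rightarrow> int \<Rightarrow> int \<Rightarrow> int \<Rightarrow> ('k, ('g list \<Rightarrow> 'k) set) module" where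
  "MPSS K G = spectral_page (RC K (digraph_space G)) (\<lambda>p. filt (RC K (digraph_space G)) (real_of_int p))"

definition path_chains :: "('k, 'z) ring_scheme \<Rightarrow> 'g digraph \<Rightarrow> int \<Rightarrow> ('g list \<Rightarrow> 'k) set" where
  "path_chains K G n = carrier (free_module K
     {gs \<in> reach_tuples (digraph_space G) n. successively (\<lambda>g h. (g, h) \<in> arrows G) gs})"

definition omega_chains :: "('k, 'z) ring_scheme \<Rightarrow> 'g digraph \<Rightarrow> int \<Rightarrow> ('g list \<Rightarrow> 'k) set" where
  "omega_chains K G n =
     {v \<in> path_chains K G n. bdry (RC K (digraph_space G)) n v \<in> path_chains K G (n - 1)}"

definition PH :: "('k, 'z) ring_scheme \<Rightarrow> 'g digraph \<Rightarrow> int \<Rightarrow> ('k, ('g list \<Rightarrow> 'k) set) module" where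
  "PH K G n = homology (sub_complex (RC K (digraph_space G)) (omega_chains K G)) n"

end

theory Submission
  imports Defs
begin

text \<open>
  Every module in the theorem is a subquotient \<open>Z/B\<close> of the module of \<open>n\<close>-chains of the reachability
  complex, so that the proof consists in determining the pairs \<open>(Z, B)\<close> and comparing them. Two
  functors with the same representatives \<open>Z\<close> and the same relations \<open>B\<close> are naturally isomorphic
  (\<open>presents_functor_isomorphic\<close>). If \<open>Z' \<subseteq> Z\<close> and \<open>Z' \<inter> B \<subseteq> B'\<close>, then \<open>Z'/B'\<close> is a subquotient
  of \<open>Z/B\<close> (\<open>presents_functor_subquotient\<close>). Working with representatives avoids calculations with
  cosets of cosets of cosets.

  For a filtered complex \<open>C\<close> and a nonempty \<open>I = R - L\<close>, the spectral homology has
    \<open>Z = {c \<in> F_R C_n. \<partial>c \<in> F_(L-r) C_(n-1)}\<close> and \<open>B = Z \<inter> (F_L C_n + \<partial> F_(R+r) C_(n+1))\<close>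
  (\<open>presents_spectral_homology\<close>). Indeed \<open>Z\<close> represents the image of the homology of the interval
  with \<open>L\<close> lowered by \<open>r\<close>, and the class of \<open>c\<close> dies in the interval with \<open>R\<close> raised by \<open>r\<close> iff
  \<open>c = a + \<partial>b\<close> with \<open>a \<in> F_L\<close> and \<open>b \<in> F_(R+r)\<close>; in that case the cycle \<open>\<partial>b\<close> represents the same class.
  The five parts are special cases.
    \<^item> For \<open>r = 0\<close> and \<open>I = {l}\<close> these are the representatives and relations of magnitude homology.
      Increasing \<open>r\<close> shrinks \<open>Z\<close> and adds relations between its elements.
    \<^item> For \<open>I = [0, l]\<close> the part \<open>F_L\<close> is zero, since lengths are nonnegative. So \<open>Z\<close> consists of
      the cycles of \<open>F_l\<close>, and for \<open>r = 0\<close> the relations are the boundaries of \<open>F_l\<close>.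
    \<^item> For \<open>I = \<real>\<close> the part \<open>F_L\<close> is zero and \<open>F_R\<close> is everything, because a chain involves finitely
      many tuples and hence has bounded length; neither depends on \<open>r\<close>.
    \<^item> In a digraph all finite lengths are natural numbers, so \<open>F_s\<close> for \<open>s < p\<close> lies in \<open>F_(p-1)\<close>, and
      \<open>Z\<close>, \<open>B\<close> for \<open>I = {l}\<close> and \<open>r - 1\<close> become the terms of the page \<open>E^r\<close> of the spectral sequence.
    \<^item> A nondegenerate \<open>(n+1)\<close>-tuple of vertices has length at least \<open>n\<close>, with equality iff it is a
      path. Hence in degree \<open>n\<close> the level \<open>F_n\<close> is spanned by paths and lower levels vanish, and
      for \<open>r = 1\<close>, \<open>l = n\<close> the sets \<open>Z\<close> and \<open>B\<close> are the cycles and boundaries of path homology.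

  Homotopy invariance comes from the prism operator \<open>h\<close> between short maps \<open>f\<close> and \<open>g\<close> at distance at
  most \<open>r\<close>, which raises lengths by at most \<open>r\<close>. For \<open>c \<in> Z\<close> the difference \<open>g c - f c = h \<partial>c + \<partial> h c\<close>
  lies in \<open>F_L + \<partial> F_(R+r)\<close>, hence in \<open>B\<close> (\<open>spectral_map_homotopy\<close>).

  The identities \<open>\<partial>\<partial> = 0\<close> and \<open>h\<partial> + \<partial>h = g - f\<close> are proved for formal sums of arbitrary tuples, degenerate
  and empty ones included. There the operators are given by the recursions \<open>\<partial>(x\<cdot>c) = c - x\<cdot>\<partial>c\<close> and
  \<open>h(x\<cdot>c) = f x\<cdot>g x\<cdot>g c - f x\<cdot>h c\<close>, where \<open>x\<cdot>\<close> puts \<open>x\<close> in front of each tuple, and the identities follow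
  by induction on the tuple. Afterwards the degenerate tuples and the empty one are projected away.
\<close>

section \<open>Presentations of modules as subquotients\<close>

lemma restrict_module_ops [simp]:
  "a_r_coset (restrict_module M H) = a_r_coset M"
  "set_add (restrict_module M H) = set_add M"
  "quot_map (restrict_module M H) = quot_map M"
  by (auto simp: fun_eq_iff a_r_coset_def' set_add_def' quot_map_def)

lemma submodule_closed:
  assumes "submodule H K M"
  shows "H \<subseteq> carrier M" "\<zero>\<^bsub>M\<^esub> \<in> H"
    and "\<And>x y. x \<in> H \<Longrightarrow> y \<in> H \<Longrightarrow> x \<oplus>\<^bsub>M\<^esub> y \<in> H"
    and "\<And>k x. k \<in> carrier K \<Longrightarrow> x \<in> H \<Longrightarrow> k \<odot>\<^bsub>M\<^esub> x \<in> H"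
  using submodule.axioms(1)[OF assms] submodule.smult_closed[OF assms]
  by (auto simp: subgroup_def)

lemma (in module) uminus_eq_smult:
  "x \<in> carrier M \<Longrightarrow> \<ominus>\<^bsub>M\<^esub> x = (\<ominus> \<one>) \<odot>\<^bsub>M\<^esub> x"
  by (simp add: smult_l_minus)

lemma (in module) submoduleI':
  assumes "H \<subseteq> carrier M" "\<zero>\<^bsub>M\<^esub> \<in> H"
    and "\<And>x y. x \<in> H \<Longrightarrow> y \<in> H \<Longrightarrow> x \<oplus>\<^bsub>M\<^esub> y \<in> H"
    and "\<And>k x. k \<in> carrier R \<Longrightarrow> x \<in> H \<Longrightarrow> k \<odot>\<^bsub>M\<^esub> x \<in> H"
  shows "submodule H R M"
proof (rule submoduleI)
  fix a assume "a \<in> H"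
  then show "\<ominus>\<^bsub>M\<^esub> a \<in> H"
    using assms(1) assms(4)[of "\<ominus> \<one>" a] uminus_eq_smult by auto
qed (use assms in auto)

lemma submodule_minus:
  assumes "module K M" "submodule H K M" "x \<in> H" "y \<in> H"
  shows "x \<ominus>\<^bsub>M\<^esub> y \<in> H"
  using module.submoduleE(3)[OF assms(1,2)] submodule_closed[OF assms(2)] assms(3,4)
  by (simp add: a_minus_def)

lemma module_homsD:
  assumes "h \<in> module_homs K M N"
  shows "\<And>x. x \<in> carrier M \<Longrightarrow> h x \<in> carrier N"
    and "\<And>x y. x \<in> carrier M \<Longrightarrow> y \<in> carrier M \<Longrightarrow> h (x \<oplus>\<^bsub>M\<^esub> y) = h x \<oplus>\<^bsub>N\<^esub> h y"
    and "\<And>k x. k \<in> carrier K \<Longrightarrow> x \<in> carrier M \<Longrightarrow> h (k \<odot>\<^bsub>M\<^esub> x) = k \<odot>\<^bsub>N\<^esub> h x"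
  using assms by (auto simp: module_homs_def)

lemma module_hom_zero:
  assumes "module K M" "module K N" "h \<in> module_homs K M N"
  shows "h \<zero>\<^bsub>M\<^esub> = \<zero>\<^bsub>N\<^esub>"
proof -
  interpret M: module K M by fact
  interpret N: module K N by fact
  have "h (\<zero>\<^bsub>K\<^esub> \<odot>\<^bsub>M\<^esub> \<zero>\<^bsub>M\<^esub>) = \<zero>\<^bsub>K\<^esub> \<odot>\<^bsub>N\<^esub> h \<zero>\<^bsub>M\<^esub>"
    by (rule module_homsD(3)[OF assms(3)]) auto
  then show ?thesis
    using module_homsD(1)[OF assms(3)] by simp
qed

lemma module_hom_minus:
  assumes "module K M" "module K N" "h \<in> module_homs K M N" "x \<in> carrier M" "y \<in> carrier M"
  shows "h (x \<ominus>\<^bsub>M\<^esub> y) = h x \<ominus>\<^bsub>N\<^esub> h y"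
proof -
  interpret M: module K M by fact
  interpret N: module K N by fact
  note h = module_homsD[OF assms(3)]
  have "h (x \<ominus>\<^bsub>M\<^esub> y) = h (x \<oplus>\<^bsub>M\<^esub> (\<ominus>\<^bsub>K\<^esub> \<one>\<^bsub>K\<^esub>) \<odot>\<^bsub>M\<^esub> y)"
    using assms by (simp add: a_minus_def M.uminus_eq_smult)
  also have "\<dots> = h x \<oplus>\<^bsub>N\<^esub> (\<ominus>\<^bsub>K\<^esub> \<one>\<^bsub>K\<^esub>) \<odot>\<^bsub>N\<^esub> h y"
    using assms h by simp
  also have "\<dots> = h x \<ominus>\<^bsub>N\<^esub> h y"
    using assms h by (simp add: a_minus_def N.uminus_eq_smult)
  finally show ?thesis .
qed

lemma module_minus_eq_zero_iff:
  assumes "module K M" "x \<in> carrier M" "y \<in> carrier M"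
  shows "x \<ominus>\<^bsub>M\<^esub> y = \<zero>\<^bsub>M\<^esub> \<longleftrightarrow> x = y"
proof -
  interpret M: module K M by fact
  show ?thesis using assms(2,3) M.add.right_cancel[of "\<ominus>\<^bsub>M\<^esub> y" x y]
    by (auto simp: a_minus_def M.r_neg)
qed

text \<open>
  The module axioms are equations and existence statements about inverses, so they pass from \<open>M\<close>
  to its image. Applied to coset maps this makes quotients into modules.
\<close>
lemma module_surjective_image:
  assumes "module K M"
    and surj: "p ` carrier M = carrier H" and zero: "p \<zero>\<^bsub>M\<^esub> = \<zero>\<^bsub>H\<^esub>"
    and add: "\<And>x y. x \<in> carrier M \<Longrightarrow> y \<in> carrier M \<Longrightarrow> p (x \<oplus>\<^bsub>M\<^esub> y) = p x \<oplus>\<^bsub>H\<^esub> p y"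
    and smult: "\<And>k x. k \<in> carrier K \<Longrightarrow> x \<in> carrier M \<Longrightarrow> p (k \<odot>\<^bsub>M\<^esub> x) = k \<odot>\<^bsub>H\<^esub> p x"
  shows "module K H"
proof -
  interpret M: module K M by fact
  have rep: "\<exists>x\<in>carrier M. h = p x" if "h \<in> carrier H" for h
    using that surj by blast
  have cl: "p x \<in> carrier H" if "x \<in> carrier M" for x
    using that surj by blast
  note pull = zero[symmetric] add[symmetric] smult[symmetric]
  show ?thesis
  proof (rule moduleI)
    show "cring K" by (rule M.R.is_cring)
    show "abelian_group H"
    proof (rule abelian_groupI)
      fix x y assume "x \<in> carrier H" "y \<in> carrier H"
      then obtain a b where "a \<in> carrier M" "b \<in> carrier M" "x = p a" "y = p b"
        using rep by metis
      then show "x \<oplus>\<^bsub>H\<^esub> y \<in> carrier H" "x \<oplus>\<^bsub>H\<^esub> y = y \<oplus>\<^bsub>H\<^esub> x"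
        by (simp_all add: pull cl M.a_comm)
    next
      fix x y z assume "x \<in> carrier H" "y \<in> carrier H" "z \<in> carrier H"
      then obtain a b c where "a \<in> carrier M" "b \<in> carrier M" "c \<in> carrier M"
          "x = p a" "y = p b" "z = p c"
        using rep by metis
      then show "(x \<oplus>\<^bsub>H\<^esub> y) \<oplus>\<^bsub>H\<^esub> z = x \<oplus>\<^bsub>H\<^esub> (y \<oplus>\<^bsub>H\<^esub> z)"
        by (simp add: pull M.a_assoc)
    next
      fix x assume "x \<in> carrier H"
      then obtain a where a: "a \<in> carrier M" "x = p a"
        using rep by metis
      then show "\<zero>\<^bsub>H\<^esub> \<oplus>\<^bsub>H\<^esub> x = x"
        by (simp add: pull)
      have "p (\<ominus>\<^bsub>M\<^esub> a) \<oplus>\<^bsub>H\<^esub> x = \<zero>\<^bsub>H\<^esub>"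
        using a by (simp add: pull M.l_neg)
      then show "\<exists>y\<in>carrier H. y \<oplus>\<^bsub>H\<^esub> x = \<zero>\<^bsub>H\<^esub>"
        using a cl by blast
    qed (simp add: pull cl)
  next
    fix k l x assume k: "k \<in> carrier K" "l \<in> carrier K" "x \<in> carrier H"
    then obtain a where a: "a \<in> carrier M" "x = p a"
      using rep by metis
    show "(k \<oplus>\<^bsub>K\<^esub> l) \<odot>\<^bsub>H\<^esub> x = k \<odot>\<^bsub>H\<^esub> x \<oplus>\<^bsub>H\<^esub> l \<odot>\<^bsub>H\<^esub> x"
      using a k by (simp add: pull M.smult_l_distr)
    show "(k \<otimes>\<^bsub>K\<^esub> l) \<odot>\<^bsub>H\<^esub> x = k \<odot>\<^bsub>H\<^esub> (l \<odot>\<^bsub>H\<^esub> x)"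
      using a k by (simp add: pull M.smult_assoc1)
  next
    fix k x assume k: "k \<in> carrier K" "x \<in> carrier H"
    then obtain a where a: "a \<in> carrier M" "x = p a"
      using rep by metis
    show "k \<odot>\<^bsub>H\<^esub> x \<in> carrier H"
      using a k by (simp add: pull cl)
  next
    fix x assume k: "x \<in> carrier H"
    then obtain a where a: "a \<in> carrier M" "x = p a"
      using rep by metis
    show "\<one>\<^bsub>K\<^esub> \<odot>\<^bsub>H\<^esub> x = x"
      using a by (simp add: pull)
  next
    fix k x y assume k: "k \<in> carrier K" "x \<in> carrier H" "y \<in> carrier H"
    then obtain a b where a: "a \<in> carrier M" "x = p a" "b \<in> carrier M" "y = p b"
      using rep by metis
    show "k \<odot>\<^bsub>H\<^esub> (x \<oplus>\<^bsub>H\<^esub> y) = k \<odot>\<^bsub>H\<^esub> x \<oplus>\<^bsub>H\<^esub> k \<odot>\<^bsub>H\<^esub> y"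
      using a k by (simp add: pull M.smult_r_distr)
  qed
qed

lemma rcoset_eq_self_iff:
  assumes "module K M" "submodule N K M" "x \<in> carrier M"
  shows "N +>\<^bsub>M\<^esub> x = N \<longleftrightarrow> x \<in> N"
proof -
  interpret M: module K M by fact
  have N: "subgroup N (add_monoid M)"
    using submodule.axioms(1)[OF assms(2)] by auto
  show ?thesis
    using M.a_coset_join1[of N x] M.a_coset_join2[of x N] assms(3) N by auto
qed

lemma rcoset_sum:
  assumes "module K M" "submodule N K M" "x \<in> carrier M" "y \<in> carrier M"
  shows "(N +>\<^bsub>M\<^esub> x) <+>\<^bsub>M\<^esub> (N +>\<^bsub>M\<^esub> y) = N +>\<^bsub>M\<^esub> (x \<oplus>\<^bsub>M\<^esub> y)"
proof -
  interpret M: module K M by fact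
  interpret N: abelian_subgroup N M
    using submodule.axioms(1)[OF assms(2)] M.a_comm_group by (rule abelian_subgroupI2[rotated])
  show ?thesis using assms(3,4) by (rule N.a_rcos_sum)
qed

lemma quot_map_eqI:
  assumes "A \<noteq> {}" "\<And>a. a \<in> A \<Longrightarrow> N +>\<^bsub>M\<^esub> h a = B"
  shows "quot_map M N h A = B"
  using assms by (auto simp: quot_map_def)

text \<open>
  \<open>H\<close> is the subquotient \<open>Z/B\<close> of \<open>M\<close>, where \<open>p\<close> sends a representative to its class. The ambient
  module \<open>M\<close> is kept in order to compare different subquotients of it.
\<close>
definition presents ::
    "('k, 'z) ring_scheme \<Rightarrow> ('k, 'c) module \<Rightarrow> 'c set \<Rightarrow> 'c set \<Rightarrow> ('k, 'h) module \<Rightarrow>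
     ('c \<Rightarrow> 'h) \<Rightarrow> bool" where
  "presents K M Z B H p \<longleftrightarrow>
     module K M \<and> module K H \<and> submodule Z K M \<and> submodule B K M \<and> B \<subseteq> Z \<and>
     p \<in> module_homs K (restrict_module M Z) H \<and> p ` Z = carrier H \<and>
     (\<forall>z\<in>Z. p z = \<zero>\<^bsub>H\<^esub> \<longleftrightarrow> z \<in> B)"

lemma presentsD:
  assumes "presents K M Z B H p"
  shows "module K M" "module K H" "submodule Z K M" "submodule B K M" "B \<subseteq> Z" "Z \<subseteq> carrier M"
    and "p ` Z = carrier H"
    and "\<And>z. z \<in> Z \<Longrightarrow> p z \<in> carrier H"
    and "\<And>x y. x \<in> Z \<Longrightarrow> y \<in> Z \<Longrightarrow> p (x \<oplus>\<^bsub>M\<^esub> y) = p x \<oplus>\<^bsub>H\<^esub> p y"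
    and "\<And>k x. k \<in> carrier K \<Longrightarrow> x \<in> Z \<Longrightarrow> p (k \<odot>\<^bsub>M\<^esub> x) = k \<odot>\<^bsub>H\<^esub> p x"
    and "\<And>z. z \<in> Z \<Longrightarrow> p z = \<zero>\<^bsub>H\<^esub> \<longleftrightarrow> z \<in> B"
  using assms submodule_closed(1)[of Z K M] by (auto simp: presents_def module_homs_def)

lemma presents_minus:
  assumes "presents K M Z B H p" "x \<in> Z" "y \<in> Z"
  shows "p (x \<ominus>\<^bsub>M\<^esub> y) = p x \<ominus>\<^bsub>H\<^esub> p y"
proof -
  note P = presentsD[OF assms(1)]
  interpret M: module K M by (rule P(1))
  interpret H: module K H by (rule P(2))
  have "p (x \<ominus>\<^bsub>M\<^esub> y) = p (x \<oplus>\<^bsub>M\<^esub> (\<ominus>\<^bsub>K\<^esub> \<one>\<^bsub>K\<^esub>) \<odot>\<^bsub>M\<^esub> y)"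
    using assms P(6) by (auto simp: a_minus_def M.uminus_eq_smult)
  also have "\<dots> = p x \<oplus>\<^bsub>H\<^esub> (\<ominus>\<^bsub>K\<^esub> \<one>\<^bsub>K\<^esub>) \<odot>\<^bsub>H\<^esub> p y"
    using assms(2,3) P(9,10) submodule_closed(4)[OF P(3)] by simp
  also have "\<dots> = p x \<ominus>\<^bsub>H\<^esub> p y"
    using assms P(8) by (simp add: a_minus_def H.uminus_eq_smult)
  finally show ?thesis .
qed

lemma presents_eq_iff:
  assumes "presents K M Z B H p" "x \<in> Z" "y \<in> Z"
  shows "p x = p y \<longleftrightarrow> x \<ominus>\<^bsub>M\<^esub> y \<in> B"
proof -
  note P = presentsD[OF assms(1)]
  have "x \<ominus>\<^bsub>M\<^esub> y \<in> Z"
    using submodule_minus[OF P(1,3)] assms by auto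
  then show ?thesis
    using P(11)[of "x \<ominus>\<^bsub>M\<^esub> y"] presents_minus[OF assms]
      module_minus_eq_zero_iff[OF P(2) P(8)[OF assms(2)] P(8)[OF assms(3)]] by simp
qed

lemma presents_refl:
  assumes "module K M"
  shows "presents K M (carrier M) {\<zero>\<^bsub>M\<^esub>} M (\<lambda>x. x)"
proof -
  interpret M: module K M by fact
  have "submodule {\<zero>\<^bsub>M\<^esub>} K M"
    by (rule M.submoduleI') auto
  then show ?thesis
    using assms M.carrier_is_submodule by (auto simp: presents_def module_homs_def)
qed

lemma presents_image_submodule:
  assumes "presents K M Z B H p" "submodule Z' K M" "Z' \<subseteq> Z"
  shows "submodule (p ` Z') K H"
proof -
  note P = presentsD[OF assms(1)]
  interpret H: module K H by (rule P(2))
  note Z' = submodule_closed[OF assms(2)]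
  have zero: "p \<zero>\<^bsub>M\<^esub> = \<zero>\<^bsub>H\<^esub>"
    using P(11) submodule_closed(2)[OF P(4)] P(5) by auto
  show ?thesis
  proof (rule H.submoduleI')
    show "p ` Z' \<subseteq> carrier H" using P(8) assms(3) by auto
    show "\<zero>\<^bsub>H\<^esub> \<in> p ` Z'" using zero Z'(2) by (metis imageI)
    fix x y assume "x \<in> p ` Z'" "y \<in> p ` Z'"
    then obtain a b where ab: "a \<in> Z'" "b \<in> Z'" "x = p a" "y = p b" by auto
    then have "x \<oplus>\<^bsub>H\<^esub> y = p (a \<oplus>\<^bsub>M\<^esub> b)"
      using P(9)[of a b] assms(3) by (simp add: subset_iff)
    then show "x \<oplus>\<^bsub>H\<^esub> y \<in> p ` Z'" using Z'(3)[OF ab(1,2)] by simp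
  next
    fix k x assume "k \<in> carrier K" "x \<in> p ` Z'"
    then obtain a where a: "k \<in> carrier K" "a \<in> Z'" "x = p a" by auto
    then have "k \<odot>\<^bsub>H\<^esub> x = p (k \<odot>\<^bsub>M\<^esub> a)"
      using P(10)[of k a] assms(3) by (simp add: subset_iff)
    then show "k \<odot>\<^bsub>H\<^esub> x \<in> p ` Z'" using Z'(4)[OF a(1,2)] by simp
  qed
qed

text \<open>
  The tool for iterated quotients: a quotient formed inside \<open>H = Z/B\<close> from the images of
  \<open>B' \<subseteq> Z'\<close> is again presented by \<open>Z'\<close> and \<open>B'\<close>. The condition \<open>Z' \<inter> B \<subseteq> B'\<close> says that passing to
  \<open>H\<close> adds no relations between elements of \<open>Z'\<close> beyond those in \<open>B'\<close>.
\<close>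
lemma presents_subquotient:
  assumes P: "presents K M Z B H p"
    and Z': "submodule Z' K M" "Z' \<subseteq> Z"
    and B': "submodule B' K M" "B' \<subseteq> Z'" "Z' \<inter> B \<subseteq> B'"
  shows "presents K M Z' B' (quot_module (restrict_module H (p ` Z')) (p ` B'))
           (\<lambda>z. p ` B' +>\<^bsub>H\<^esub> p z)"
    (is "presents K M Z' B' ?Q ?q")
proof -
  note PD = presentsD[OF P]
  interpret M: module K M by (rule PD(1))
  interpret H: module K H by (rule PD(2))
  have sB: "submodule (p ` B') K H"
    using presents_image_submodule[OF P B'(1)] B'(2) Z'(2) by blast
  note Zc = submodule_closed[OF Z'(1)]
  note sBc = submodule_closed[OF sB]
  have pc: "p z \<in> carrier H" if "z \<in> Z'" for z
    using that PD(8) Z'(2) by auto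
  have padd: "p (x \<oplus>\<^bsub>M\<^esub> y) = p x \<oplus>\<^bsub>H\<^esub> p y" if "x \<in> Z'" "y \<in> Z'" for x y
    using that PD(9)[of x y] Z'(2) by (simp add: subset_iff)
  have psmult: "p (k \<odot>\<^bsub>M\<^esub> x) = k \<odot>\<^bsub>H\<^esub> p x" if "k \<in> carrier K" "x \<in> Z'" for k x
    using that PD(10)[of k x] Z'(2) by (simp add: subset_iff)
  have mem: "p z \<in> p ` B' \<longleftrightarrow> z \<in> B'" if z: "z \<in> Z'" for z
  proof
    assume "p z \<in> p ` B'"
    then obtain b where b: "b \<in> B'" "p z = p b" by auto
    then have bz: "b \<in> Z'" using B' by auto
    have "z \<ominus>\<^bsub>M\<^esub> b \<in> B"
      using presents_eq_iff[OF P, of z b] b bz z Z'(2) by auto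
    then have "z \<ominus>\<^bsub>M\<^esub> b \<in> B'"
      using submodule_minus[OF PD(1) Z'(1) z bz] B'(3) by auto
    then have "(z \<ominus>\<^bsub>M\<^esub> b) \<oplus>\<^bsub>M\<^esub> b \<in> B'"
      using submodule_closed(3)[OF B'(1)] b(1) by blast
    moreover have "(z \<ominus>\<^bsub>M\<^esub> b) \<oplus>\<^bsub>M\<^esub> b = z"
    proof -
      have "z \<in> carrier M" "b \<in> carrier M"
        using z bz Zc(1) by auto
      then show ?thesis by (simp add: a_minus_def M.a_assoc M.l_neg)
    qed
    ultimately show "z \<in> B'" by simp
  qed auto
  have zero: "\<zero>\<^bsub>?Q\<^esub> = p ` B'" by (simp add: quot_module_def)
  have qadd: "?q (x \<oplus>\<^bsub>M\<^esub> y) = ?q x \<oplus>\<^bsub>?Q\<^esub> ?q y" if "x \<in> Z'" "y \<in> Z'" for x y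
    using that padd[of x y] rcoset_sum[OF PD(2) sB pc pc, of x y]
    by (simp add: quot_module_def)
  have qsmult: "?q (k \<odot>\<^bsub>M\<^esub> x) = k \<odot>\<^bsub>?Q\<^esub> ?q x" if k: "k \<in> carrier K" and x: "x \<in> Z'" for k x
  proof -
    have "p ` B' +>\<^bsub>H\<^esub> k \<odot>\<^bsub>H\<^esub> a = p ` B' +>\<^bsub>H\<^esub> p (k \<odot>\<^bsub>M\<^esub> x)" if a: "a \<in> p ` B' +>\<^bsub>H\<^esub> p x" for a
    proof -
      obtain b where b: "b \<in> B'" "a = p b \<oplus>\<^bsub>H\<^esub> p x"
        using a by (auto simp: a_r_coset_def')
      have bz: "b \<in> Z'" using b B' by auto
      have "a = p (b \<oplus>\<^bsub>M\<^esub> x)"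
        using b bz x padd by simp
      then have "k \<odot>\<^bsub>H\<^esub> a = p (k \<odot>\<^bsub>M\<^esub> (b \<oplus>\<^bsub>M\<^esub> x))"
        using psmult k Zc(3)[OF bz x] by simp
      also have "k \<odot>\<^bsub>M\<^esub> (b \<oplus>\<^bsub>M\<^esub> x) = k \<odot>\<^bsub>M\<^esub> b \<oplus>\<^bsub>M\<^esub> k \<odot>\<^bsub>M\<^esub> x"
        using k bz x Zc(1) by (intro M.smult_r_distr) auto
      finally have ka: "k \<odot>\<^bsub>H\<^esub> a = p (k \<odot>\<^bsub>M\<^esub> b) \<oplus>\<^bsub>H\<^esub> p (k \<odot>\<^bsub>M\<^esub> x)"
        using padd Zc(4)[OF k bz] Zc(4)[OF k x] by simp
      have kb: "p (k \<odot>\<^bsub>M\<^esub> b) \<in> p ` B'"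
        using submodule_closed(4)[OF B'(1) k b(1)] by auto
      have kx: "p (k \<odot>\<^bsub>M\<^esub> x) \<in> carrier H"
        using pc[OF Zc(4)[OF k x]] .
      have "p ` B' +>\<^bsub>H\<^esub> (k \<odot>\<^bsub>H\<^esub> a) = (p ` B' +>\<^bsub>H\<^esub> p (k \<odot>\<^bsub>M\<^esub> b)) +>\<^bsub>H\<^esub> p (k \<odot>\<^bsub>M\<^esub> x)"
        unfolding ka using kb kx sBc(1) by (subst H.a_coset_add_assoc) auto
      also have "p ` B' +>\<^bsub>H\<^esub> p (k \<odot>\<^bsub>M\<^esub> b) = p ` B'"
        using rcoset_eq_self_iff[OF PD(2) sB] kb sBc(1) by blast
      finally show ?thesis .
    qed
    moreover have "p ` B' +>\<^bsub>H\<^esub> p x \<noteq> {}"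
      using sBc(2) by (auto simp: a_r_coset_def')
    ultimately show ?thesis
      by (auto simp: quot_module_def intro!: quot_map_eqI[symmetric])
  qed
  have surj: "?q ` Z' = carrier ?Q"
    by (auto simp: quot_module_def A_RCOSETS_def')
  have ker: "?q z = \<zero>\<^bsub>?Q\<^esub> \<longleftrightarrow> z \<in> B'" if "z \<in> Z'" for z
    using rcoset_eq_self_iff[OF PD(2) sB pc[OF that]] mem[OF that] zero by simp
  have mZ: "module K (restrict_module M Z')"
    using submodule.submodule_is_module[OF Z'(1)] PD(1) by blast
  have "module K ?Q"
    by (rule module_surjective_image[OF mZ, of ?q])
      (use surj ker qadd qsmult Zc(2) submodule_closed(2)[OF B'(1)] in auto)
  then show ?thesis
    using PD(1) Z' B' surj ker qadd qsmult by (auto simp: presents_def module_homs_def)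
qed

lemma presents_quot_module:
  assumes "module K M" "submodule Z K M" "submodule B K M" "B \<subseteq> Z"
  shows "presents K M Z B (quot_module (restrict_module M Z) B) (\<lambda>z. B +>\<^bsub>M\<^esub> z)"
  using presents_subquotient[OF presents_refl[OF assms(1)] assms(2) _ assms(3,4)]
    submodule_closed[OF assms(2)] submodule_closed[OF assms(3)] by simp

text \<open>
  On classes, an induced map is computed by applying \<open>f\<close> to a representative. Since the maps \<open>p\<close>
  and \<open>p'\<close> may themselves be coset maps, repeated use of this evaluates maps between iterated
  quotients.
\<close>
lemma quot_map_presents:
  assumes P: "presents K M Z B H p" and P': "presents K M' Z' B' H' p'"
    and S: "S \<subseteq> Z" "submodule S K M" "T \<subseteq> S" "submodule T K M"
    and T': "T' \<subseteq> Z'" "submodule T' K M'"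
    and f: "\<And>x y. x \<in> S \<Longrightarrow> y \<in> S \<Longrightarrow> f (x \<oplus>\<^bsub>M\<^esub> y) = f x \<oplus>\<^bsub>M'\<^esub> f y" "f ` S \<subseteq> Z'" "f ` T \<subseteq> T'"
    and g: "\<And>z. z \<in> S \<Longrightarrow> g (p z) = p' (f z)"
    and z: "z \<in> S"
  shows "quot_map H' (p' ` T') g (p ` T +>\<^bsub>H\<^esub> p z) = p' ` T' +>\<^bsub>H'\<^esub> p' (f z)"
proof (rule quot_map_eqI)
  note D = presentsD[OF P] and D' = presentsD[OF P']
  interpret H': module K H' by (rule D'(2))
  show "p ` T +>\<^bsub>H\<^esub> p z \<noteq> {}"
    using submodule_closed(2)[OF S(4)] by (auto simp: a_r_coset_def')
  fix a assume "a \<in> p ` T +>\<^bsub>H\<^esub> p z"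
  then obtain t where t: "t \<in> T" "a = p t \<oplus>\<^bsub>H\<^esub> p z" by (auto simp: a_r_coset_def')
  have ts: "t \<in> S" using t S by auto
  have "a = p (t \<oplus>\<^bsub>M\<^esub> z)"
    using t ts z S(1) D(9)[of t z] by (simp add: subset_iff)
  then have "g a = p' (f (t \<oplus>\<^bsub>M\<^esub> z))"
    using g submodule_closed(3)[OF S(2) ts z] by auto
  also have "\<dots> = p' (f t) \<oplus>\<^bsub>H'\<^esub> p' (f z)"
    using f(1)[OF ts z] f(2) ts z D'(9)[of "f t" "f z"] by auto
  finally have ga: "g a = p' (f t) \<oplus>\<^bsub>H'\<^esub> p' (f z)" .
  have sT: "submodule (p' ` T') K H'"
    by (rule presents_image_submodule[OF P' T'(2,1)])
  have ft: "p' (f t) \<in> p' ` T'" using t f(3) by auto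
  have "p' ` T' +>\<^bsub>H'\<^esub> g a = (p' ` T' +>\<^bsub>H'\<^esub> p' (f t)) +>\<^bsub>H'\<^esub> p' (f z)"
    unfolding ga using ft submodule_closed(1)[OF sT] D'(8) f(2) z
    by (subst H'.a_coset_add_assoc) auto
  also have "p' ` T' +>\<^bsub>H'\<^esub> p' (f t) = p' ` T'"
    using rcoset_eq_self_iff[OF D'(2) sT] ft submodule_closed(1)[OF sT] by blast
  finally show "p' ` T' +>\<^bsub>H'\<^esub> g a = p' ` T' +>\<^bsub>H'\<^esub> p' (f z)" .
qed

text \<open>
  Whether \<open>p x = p y\<close> depends only on \<open>x - y \<in> B\<close>, so \<open>p z \<mapsto> p' z\<close> is well defined and injective.
\<close>
lemma presents_isomorphic:
  assumes P: "presents K M Z B H p" and P': "presents K M Z B H' p'"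
  shows "\<exists>h. h \<in> module_iso K H H' \<and> (\<forall>z\<in>Z. h (p z) = p' z)"
proof -
  note D = presentsD[OF P] and D' = presentsD[OF P']
  \<comment> \<open>the value is independent of the chosen representative\<close>
  define h where "h a = p' (SOME z. z \<in> Z \<and> p z = a)" for a
  have h: "h (p z) = p' z" if z: "z \<in> Z" for z
  proof -
    let ?y = "SOME y. y \<in> Z \<and> p y = p z"
    have y: "?y \<in> Z \<and> p ?y = p z"
      by (rule someI[of "\<lambda>y. y \<in> Z \<and> p y = p z" z]) (simp add: z)
    then have "p' ?y = p' z"
      using presents_eq_iff[OF P, of ?y z] presents_eq_iff[OF P', of ?y z] z by simp
    then show ?thesis unfolding h_def .
  qed
  have rep: "\<exists>z\<in>Z. a = p z" if "a \<in> carrier H" for a using that D(7) by blast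
  have "h \<in> module_homs K H H'"
    unfolding module_homs_def
  proof (intro CollectI conjI ballI Pi_I)
    fix a assume "a \<in> carrier H"
    then show "h a \<in> carrier H'" using rep h D'(8) by metis
  next
    fix a b assume "a \<in> carrier H" "b \<in> carrier H"
    then obtain x y where xy: "x \<in> Z" "y \<in> Z" "a = p x" "b = p y" using rep by metis
    then have "a \<oplus>\<^bsub>H\<^esub> b = p (x \<oplus>\<^bsub>M\<^esub> y)" using D(9) by simp
    then show "h (a \<oplus>\<^bsub>H\<^esub> b) = h a \<oplus>\<^bsub>H'\<^esub> h b"
      using xy h submodule_closed(3)[OF D(3)] D'(9) by simp
  next
    fix k a assume k: "k \<in> carrier K" and "a \<in> carrier H"
    then obtain x where xy: "x \<in> Z" "a = p x" using rep by metis
    then have "k \<odot>\<^bsub>H\<^esub> a = p (k \<odot>\<^bsub>M\<^esub> x)" using k D(10) by simp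
    then show "h (k \<odot>\<^bsub>H\<^esub> a) = k \<odot>\<^bsub>H'\<^esub> h a"
      using xy k h submodule_closed(4)[OF D(3)] D'(10) by simp
  qed
  moreover have "inj_on h (carrier H)"
  proof (rule inj_onI)
    fix a b assume ab: "a \<in> carrier H" "b \<in> carrier H" "h a = h b"
    then obtain x y where xy: "x \<in> Z" "y \<in> Z" "a = p x" "b = p y" using rep by metis
    then show "a = b"
      using ab(3) h presents_eq_iff[OF P xy(1,2)] presents_eq_iff[OF P' xy(1,2)] by simp
  qed
  moreover have "h ` carrier H = carrier H'"
    unfolding D(7)[symmetric] D'(7)[symmetric] image_image using h by auto
  ultimately show ?thesis using h by (auto simp: module_iso_def bij_betw_def)
qed

lemma presents_modules_isomorphic:
  assumes P: "presents K M Z B H p" and P': "presents K M Z B H' p'"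
  shows "modules_isomorphic K H H'"
  using presents_isomorphic[OF assms] presentsD(2)[OF P] presentsD(2)[OF P']
  by (auto simp: modules_isomorphic_def)

section \<open>Presented functors\<close>

text \<open>
  What a functor presented by another one needs in order to inherit functoriality from it.
\<close>
definition closed_category :: "('o, 'm) cat \<Rightarrow> bool" where
  "closed_category C \<longleftrightarrow>
     (\<forall>X\<in>Ob C. Ident C X \<in> Hom C X X) \<and>
     (\<forall>X\<in>Ob C. \<forall>Y\<in>Ob C. \<forall>Z\<in>Ob C. \<forall>f\<in>Hom C X Y. \<forall>g\<in>Hom C Y Z. Comp C X g f \<in> Hom C X Z)"

text \<open>
  \<open>F\<close> is the subquotient \<open>Z/B\<close> of the functor \<open>U\<close>. Its action on arrows is then determined by that
  of \<open>U\<close> on representatives.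
\<close>
definition presents_functor ::
    "('k, 'z) ring_scheme \<Rightarrow> ('o, 'm) cat \<Rightarrow> ('o, 'm, 'k, 'c) mod_functor \<Rightarrow> ('o \<Rightarrow> 'c set) \<Rightarrow>
     ('o \<Rightarrow> 'c set) \<Rightarrow> ('o, 'm, 'k, 'h) mod_functor \<Rightarrow> ('o \<Rightarrow> 'c \<Rightarrow> 'h) \<Rightarrow> bool" where
  "presents_functor K C U Z B F p \<longleftrightarrow>
     closed_category C \<and> is_functor K C U \<and>
     (\<forall>X\<in>Ob C. presents K (fobj U X) (Z X) (B X) (fobj F X) (p X)) \<and>
     (\<forall>X\<in>Ob C. \<forall>Y\<in>Ob C. \<forall>f\<in>Hom C X Y.
        farr U X Y f ` Z X \<subseteq> Z Y \<and> farr U X Y f ` B X \<subseteq> B Y \<and>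
        (\<forall>z\<in>Z X. farr F X Y f (p X z) = p Y (farr U X Y f z)))"

lemma presents_functorD:
  assumes "presents_functor K C U Z B F p"
  shows "closed_category C" "is_functor K C U"
    and "\<And>X. X \<in> Ob C \<Longrightarrow> presents K (fobj U X) (Z X) (B X) (fobj F X) (p X)"
    and "\<And>X Y f. X \<in> Ob C \<Longrightarrow> Y \<in> Ob C \<Longrightarrow> f \<in> Hom C X Y \<Longrightarrow> farr U X Y f ` Z X \<subseteq> Z Y"
    and "\<And>X Y f. X \<in> Ob C \<Longrightarrow> Y \<in> Ob C \<Longrightarrow> f \<in> Hom C X Y \<Longrightarrow> farr U X Y f ` B X \<subseteq> B Y"
    and "\<And>X Y f z. X \<in> Ob C \<Longrightarrow> Y \<in> Ob C \<Longrightarrow> f \<in> Hom C X Y \<Longrightarrow> z \<in> Z X \<Longrightarrow>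
           farr F X Y f (p X z) = p Y (farr U X Y f z)"
  using assms unfolding presents_functor_def by blast+

lemma is_functorD:
  assumes "is_functor K C F"
  shows "\<And>X. X \<in> Ob C \<Longrightarrow> module K (fobj F X)"
    and "\<And>X Y f. X \<in> Ob C \<Longrightarrow> Y \<in> Ob C \<Longrightarrow> f \<in> Hom C X Y \<Longrightarrow>
           farr F X Y f \<in> module_homs K (fobj F X) (fobj F Y)"
    and "\<And>X a. X \<in> Ob C \<Longrightarrow> a \<in> carrier (fobj F X) \<Longrightarrow> farr F X X (Ident C X) a = a"
    and "\<And>X Y Z f g a. X \<in> Ob C \<Longrightarrow> Y \<in> Ob C \<Longrightarrow> Z \<in> Ob C \<Longrightarrow> f \<in> Hom C X Y \<Longrightarrow> g \<in> Hom C Y Z \<Longrightarrow>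
           a \<in> carrier (fobj F X) \<Longrightarrow> farr F X Z (Comp C X g f) a = farr F Y Z g (farr F X Y f a)"
  using assms unfolding is_functor_def by blast+

lemma presents_functor_is_functor:
  assumes P: "presents_functor K C U Z B F p"
  shows "is_functor K C F"
proof -
  note D = presents_functorD[OF P]
  note U = is_functorD[OF D(2)]
  have rep: "\<exists>z\<in>Z X. a = p X z" if "X \<in> Ob C" "a \<in> carrier (fobj F X)" for X a
    using presentsD(7)[OF D(3)[OF that(1)]] that(2) by blast
  have sub: "z \<in> carrier (fobj U X)" if "X \<in> Ob C" "z \<in> Z X" for X z
    using presentsD(6)[OF D(3)[OF that(1)]] that(2) by blast
  show ?thesis
    unfolding is_functor_def
  proof (intro conjI ballI)
    fix X assume "X \<in> Ob C" then show "module K (fobj F X)"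
      by (rule presentsD(2)[OF D(3)])
  next
    fix X Y f assume XY: "X \<in> Ob C" "Y \<in> Ob C" and f: "f \<in> Hom C X Y"
    note PX = presentsD[OF D(3)[OF XY(1)]] and PY = presentsD[OF D(3)[OF XY(2)]]
    note hom = module_homsD[OF U(2)[OF XY f]]
    have fz: "farr U X Y f z \<in> Z Y" if "z \<in> Z X" for z
      using D(4)[OF XY f] that by blast
    note nat = D(6)[OF XY f]
    show "farr F X Y f \<in> module_homs K (fobj F X) (fobj F Y)"
      unfolding module_homs_def
    proof (intro CollectI conjI ballI Pi_I)
      fix a assume "a \<in> carrier (fobj F X)"
      then obtain x where "x \<in> Z X" "a = p X x" using rep[OF XY(1)] by blast
      then show "farr F X Y f a \<in> carrier (fobj F Y)"
        using nat fz PY(8) by simp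
    next
      fix a b assume "a \<in> carrier (fobj F X)" "b \<in> carrier (fobj F X)"
      then obtain x y where xy: "x \<in> Z X" "a = p X x" "y \<in> Z X" "b = p X y"
        using rep[OF XY(1)] by blast
      have "a \<oplus>\<^bsub>fobj F X\<^esub> b = p X (x \<oplus>\<^bsub>fobj U X\<^esub> y)"
        using xy PX(9) by simp
      then show "farr F X Y f (a \<oplus>\<^bsub>fobj F X\<^esub> b) = farr F X Y f a \<oplus>\<^bsub>fobj F Y\<^esub> farr F X Y f b"
        using xy nat fz PY(9) submodule_closed(3)[OF PX(3)] hom(2) sub[OF XY(1)] by simp
    next
      fix k a assume k: "k \<in> carrier K" and "a \<in> carrier (fobj F X)"
      then obtain x where xy: "x \<in> Z X" "a = p X x" using rep[OF XY(1)] by blast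
      have "k \<odot>\<^bsub>fobj F X\<^esub> a = p X (k \<odot>\<^bsub>fobj U X\<^esub> x)"
        using xy k PX(10) by simp
      then show "farr F X Y f (k \<odot>\<^bsub>fobj F X\<^esub> a) = k \<odot>\<^bsub>fobj F Y\<^esub> farr F X Y f a"
        using xy k nat fz PY(10) submodule_closed(4)[OF PX(3)] hom(3) sub[OF XY(1)] by simp
    qed
  next
    fix X a assume X: "X \<in> Ob C" and a: "a \<in> carrier (fobj F X)"
    have i: "Ident C X \<in> Hom C X X" using D(1) X by (simp add: closed_category_def)
    obtain x where x: "x \<in> Z X" "a = p X x" using rep[OF X a] by blast
    then show "farr F X X (Ident C X) a = a"
      using D(6)[OF X X i x(1)] U(3)[OF X sub[OF X x(1)]] by simp
  next
    fix X Y W f g a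
    assume X: "X \<in> Ob C" and Y: "Y \<in> Ob C" and W: "W \<in> Ob C"
      and f: "f \<in> Hom C X Y" and g: "g \<in> Hom C Y W" and a: "a \<in> carrier (fobj F X)"
    have gf: "Comp C X g f \<in> Hom C X W"
      using D(1) X Y W f g by (simp add: closed_category_def)
    obtain x where x: "x \<in> Z X" "a = p X x" using rep[OF X a] by blast
    have "farr U X Y f x \<in> Z Y" using D(4)[OF X Y f] x by blast
    then show "farr F X W (Comp C X g f) a = farr F Y W g (farr F X Y f a)"
      using D(6)[OF X Y f x(1)] D(6)[OF X W gf x(1)] D(6)[OF Y W g]
        U(4)[OF X Y W f g sub[OF X x(1)]] x by simp
  qed
qed

lemma presents_functor_isomorphic:
  assumes P: "presents_functor K C U Z B F p" and Q: "presents_functor K C U Z B G q"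
  shows "naturally_isomorphic K C F G"
proof -
  note D = presents_functorD[OF P] and E = presents_functorD[OF Q]
  have "\<exists>h. h \<in> module_iso K (fobj F X) (fobj G X) \<and> (\<forall>z\<in>Z X. h (p X z) = q X z)" if "X \<in> Ob C" for X
    using presents_isomorphic[OF D(3) E(3)] that by blast
  then obtain \<eta> where \<eta>: "\<And>X. X \<in> Ob C \<Longrightarrow> \<eta> X \<in> module_iso K (fobj F X) (fobj G X)"
      "\<And>X z. X \<in> Ob C \<Longrightarrow> z \<in> Z X \<Longrightarrow> \<eta> X (p X z) = q X z"
    by metis
  have "\<eta> Y (farr F X Y f a) = farr G X Y f (\<eta> X a)"
    if XY: "X \<in> Ob C" "Y \<in> Ob C" and f: "f \<in> Hom C X Y" and a: "a \<in> carrier (fobj F X)" for X Y f a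
  proof -
    obtain x where x: "x \<in> Z X" "a = p X x"
      using presentsD(7)[OF D(3)[OF XY(1)]] a by blast
    have "farr U X Y f x \<in> Z Y" using D(4)[OF XY f] x by blast
    then show ?thesis
      using x \<eta>(2)[OF XY(1)] \<eta>(2)[OF XY(2)] D(6)[OF XY f x(1)] E(6)[OF XY f x(1)] by simp
  qed
  then show ?thesis
    using presents_functor_is_functor[OF P] presents_functor_is_functor[OF Q] \<eta>(1)
    unfolding naturally_isomorphic_def by blast
qed

text \<open>
  The subfunctors of \<open>M\<close> in question are the images of \<open>Z'\<close> and \<open>B'\<close>; their quotient has the same
  representatives and relations as \<open>S\<close>.
\<close>
lemma presents_functor_subquotient:
  assumes P: "presents_functor K C U Z B M p" and Q: "presents_functor K C U Z' B' S q"
    and sub: "\<And>X. X \<in> Ob C \<Longrightarrow> Z' X \<subseteq> Z X" "\<And>X. X \<in> Ob C \<Longrightarrow> Z' X \<inter> B X \<subseteq> B' X"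
  shows "subquotient_functor K C S M"
proof -
  note D = presents_functorD[OF P] and E = presents_functorD[OF Q]
  let ?Q = "\<lparr>fobj = (\<lambda>X. quot_module (restrict_module (fobj M X) (p X ` Z' X)) (p X ` B' X)),
             farr = (\<lambda>X Y f. quot_map (fobj M Y) (p Y ` B' Y) (farr M X Y f))\<rparr>"
  have sm: "submodule (Z' X) K (fobj U X)" "submodule (B' X) K (fobj U X)" "B' X \<subseteq> Z' X"
    if "X \<in> Ob C" for X
    using presentsD[OF E(3)[OF that]] by auto
  have "presents_functor K C U Z' B' ?Q (\<lambda>X z. p X ` B' X +>\<^bsub>fobj M X\<^esub> p X z)"
    unfolding presents_functor_def
  proof (intro conjI ballI)
    fix X assume X: "X \<in> Ob C"
    show "presents K (fobj U X) (Z' X) (B' X) (fobj ?Q X) (\<lambda>z. p X ` B' X +>\<^bsub>fobj M X\<^esub> p X z)"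
      using presents_subquotient[OF D(3)[OF X]] sm[OF X] sub[OF X] by simp
  next
    fix X Y f z assume XY: "X \<in> Ob C" "Y \<in> Ob C" and f: "f \<in> Hom C X Y" and z: "z \<in> Z' X"
    note hom = module_homsD[OF is_functorD(2)[OF D(2) XY f]]
    have "quot_map (fobj M Y) (p Y ` B' Y) (farr M X Y f) (p X ` B' X +>\<^bsub>fobj M X\<^esub> p X z) =
        p Y ` B' Y +>\<^bsub>fobj M Y\<^esub> p Y (farr U X Y f z)"
    proof (rule quot_map_presents[OF D(3)[OF XY(1)] D(3)[OF XY(2)] sub(1)[OF XY(1)]])
      show "farr U X Y f ` Z' X \<subseteq> Z Y" using E(4)[OF XY f] sub(1)[OF XY(2)] by blast
      show "farr U X Y f ` B' X \<subseteq> B' Y" by (rule E(5)[OF XY f])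
      show "B' Y \<subseteq> Z Y" using sm(3)[OF XY(2)] sub(1)[OF XY(2)] by blast
      show "farr U X Y f (x \<oplus>\<^bsub>fobj U X\<^esub> y) = farr U X Y f x \<oplus>\<^bsub>fobj U Y\<^esub> farr U X Y f y"
        if "x \<in> Z' X" "y \<in> Z' X" for x y
        using hom(2) that submodule_closed(1)[OF sm(1)[OF XY(1)]] by blast
      show "farr M X Y f (p X y) = p Y (farr U X Y f y)" if "y \<in> Z' X" for y
        using D(6)[OF XY f] that sub(1)[OF XY(1)] by blast
    qed (use sm XY z in auto)
    then show "farr ?Q X Y f (p X ` B' X +>\<^bsub>fobj M X\<^esub> p X z) =
        p Y ` B' Y +>\<^bsub>fobj M Y\<^esub> p Y (farr U X Y f z)"
      by simp
  qed (use D(1,2) E(4,5) in auto)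
  then have iso: "naturally_isomorphic K C ?Q S"
    using Q by (rule presents_functor_isomorphic)
  have "submodule (p X ` Z' X) K (fobj M X) \<and> submodule (p X ` B' X) K (fobj M X) \<and>
      p X ` B' X \<subseteq> p X ` Z' X" if X: "X \<in> Ob C" for X
    using presents_image_submodule[OF D(3)[OF X]] sm[OF X] sub(1)[OF X]
    by (meson image_mono subset_trans)
  moreover have "farr M X Y f ` p X ` Z' X \<subseteq> p Y ` Z' Y \<and> farr M X Y f ` p X ` B' X \<subseteq> p Y ` B' Y"
    if XY: "X \<in> Ob C" "Y \<in> Ob C" and f: "f \<in> Hom C X Y" for X Y f
  proof -
    have "farr M X Y f (p X z) = p Y (farr U X Y f z)" if "z \<in> Z' X" for z
      using D(6)[OF XY f] that sub(1)[OF XY(1)] by blast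
    then show ?thesis using E(4,5)[OF XY f] sm(3)[OF XY(1)] by (auto simp: subset_iff)
  qed
  ultimately show ?thesis
    unfolding subquotient_functor_def
    using presents_functor_is_functor[OF P] iso
    by (intro conjI exI[of _ "\<lambda>X. p X ` Z' X"] exI[of _ "\<lambda>X. p X ` B' X"]) auto
qed

section \<open>Chain complexes\<close>

definition is_complex :: "('k, 'z) ring_scheme \<Rightarrow> ('k, 'c, 'e) chain_complex_scheme \<Rightarrow> bool" where
  "is_complex K C \<longleftrightarrow>
     (\<forall>n. module K (chain C n) \<and> bdry C n \<in> module_homs K (chain C n) (chain C (n - 1)) \<and>
          (\<forall>c\<in>carrier (chain C n). bdry C (n - 1) (bdry C n c) = \<zero>\<^bsub>chain C (n - 1 - 1)\<^esub>))"

definition subcomplex ::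
    "('k, 'z) ring_scheme \<Rightarrow> ('k, 'c, 'e) chain_complex_scheme \<Rightarrow> (int \<Rightarrow> 'c set) \<Rightarrow> bool" where
  "subcomplex K C P \<longleftrightarrow> (\<forall>n. submodule (P n) K (chain C n) \<and> bdry C n ` P n \<subseteq> P (n - 1))"

definition chain_map ::
    "('k, 'z) ring_scheme \<Rightarrow> ('k, 'c, 'e) chain_complex_scheme \<Rightarrow> ('k, 'd, 'f) chain_complex_scheme \<Rightarrow>
     (int \<Rightarrow> 'c \<Rightarrow> 'd) \<Rightarrow> bool" where
  "chain_map K C D f \<longleftrightarrow>
     (\<forall>n. f n \<in> module_homs K (chain C n) (chain D n) \<and>
          (\<forall>c\<in>carrier (chain C n). f (n - 1) (bdry C n c) = bdry D n (f n c)))"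

lemma is_complexD:
  assumes "is_complex K C"
  shows "\<And>n. module K (chain C n)"
    and "\<And>n. bdry C n \<in> module_homs K (chain C n) (chain C (n - 1))"
    and "\<And>n c. c \<in> carrier (chain C n) \<Longrightarrow> bdry C (n - 1) (bdry C n c) = \<zero>\<^bsub>chain C (n - 1 - 1)\<^esub>"
  using assms by (auto simp: is_complex_def)

lemma subcomplexD:
  assumes "subcomplex K C P"
  shows "\<And>n. submodule (P n) K (chain C n)"
    and "\<And>n c. c \<in> P n \<Longrightarrow> bdry C n c \<in> P (n - 1)"
    and "\<And>n c. c \<in> P n \<Longrightarrow> c \<in> carrier (chain C n)"
  using assms submodule_closed(1) by (fastforce simp: subcomplex_def)+

lemma chain_mapD:
  assumes "chain_map K C D f"
  shows "\<And>n. f n \<in> module_homs K (chain C n) (chain D n)"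
    and "\<And>n c. c \<in> carrier (chain C n) \<Longrightarrow> f (n - 1) (bdry C n c) = bdry D n (f n c)"
  using assms by (auto simp: chain_map_def)

lemma submodule_kernel_part:
  assumes "module K M" "module K N" "h \<in> module_homs K M N" "submodule P K M" "submodule Q K N"
  shows "submodule {c \<in> P. h c \<in> Q} K M"
proof -
  interpret M: module K M by fact
  note h = module_homsD[OF assms(3)]
  note P = submodule_closed[OF assms(4)] and Q = submodule_closed[OF assms(5)]
  show ?thesis
  proof (rule M.submoduleI')
    show "\<zero>\<^bsub>M\<^esub> \<in> {c \<in> P. h c \<in> Q}"
      using module_hom_zero[OF assms(1-3)] P Q by auto
  next
    fix x y assume "x \<in> {c \<in> P. h c \<in> Q}" "y \<in> {c \<in> P. h c \<in> Q}"
    then show "x \<oplus>\<^bsub>M\<^esub> y \<in> {c \<in> P. h c \<in> Q}"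
      using h(2)[of x y] P Q by (auto simp: subset_iff)
  next
    fix k x assume "k \<in> carrier K" "x \<in> {c \<in> P. h c \<in> Q}"
    then show "k \<odot>\<^bsub>M\<^esub> x \<in> {c \<in> P. h c \<in> Q}"
      using h(3)[of k x] P Q by (auto simp: subset_iff)
  qed (use P in auto)
qed

lemma submodule_image:
  assumes "module K M" "module K N" "h \<in> module_homs K M N" "submodule P K M"
  shows "submodule (h ` P) K N"
proof -
  interpret N: module K N by fact
  note h = module_homsD[OF assms(3)]
  note P = submodule_closed[OF assms(4)]
  show ?thesis
  proof (rule N.submoduleI')
    show "h ` P \<subseteq> carrier N" using h P by auto
    show "\<zero>\<^bsub>N\<^esub> \<in> h ` P"
      using module_hom_zero[OF assms(1-3)] P by (metis imageI)
    fix x y assume "x \<in> h ` P" "y \<in> h ` P"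
    then obtain a b where ab: "a \<in> P" "b \<in> P" "x = h a" "y = h b" by auto
    then have "x \<oplus>\<^bsub>N\<^esub> y = h (a \<oplus>\<^bsub>M\<^esub> b)"
      using h(2)[of a b] P(1) by (simp add: subset_iff)
    then show "x \<oplus>\<^bsub>N\<^esub> y \<in> h ` P" using P(3)[OF ab(1,2)] by simp
  next
    fix k x assume "k \<in> carrier K" "x \<in> h ` P"
    then obtain a where a: "k \<in> carrier K" "a \<in> P" "x = h a" by auto
    then have "k \<odot>\<^bsub>N\<^esub> x = h (k \<odot>\<^bsub>M\<^esub> a)"
      using h(3)[of k a] P(1) by (simp add: subset_iff)
    then show "k \<odot>\<^bsub>N\<^esub> x \<in> h ` P" using P(4)[OF a(1,2)] by simp
  qed
qed

lemma set_addI: "a \<in> A \<Longrightarrow> b \<in> B \<Longrightarrow> a \<oplus>\<^bsub>M\<^esub> b \<in> A <+>\<^bsub>M\<^esub> B"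
  by (auto simp: set_add_def')

lemma submodule_sum:
  assumes "module K M" "submodule P K M" "submodule Q K M"
  shows "submodule (P <+>\<^bsub>M\<^esub> Q) K M"
proof -
  interpret M: module K M by fact
  note P = submodule_closed[OF assms(2)] and Q = submodule_closed[OF assms(3)]
  have mem: "p \<oplus>\<^bsub>M\<^esub> q \<in> P <+>\<^bsub>M\<^esub> Q" if "p \<in> P" "q \<in> Q" for p q
    using that by (auto simp: set_add_def')
  show ?thesis
  proof (rule M.submoduleI')
    show "P <+>\<^bsub>M\<^esub> Q \<subseteq> carrier M" using P(1) Q(1) by (auto simp: set_add_def')
    show "\<zero>\<^bsub>M\<^esub> \<in> P <+>\<^bsub>M\<^esub> Q" using mem[OF P(2) Q(2)] by simp
  next
    fix x y assume "x \<in> P <+>\<^bsub>M\<^esub> Q" "y \<in> P <+>\<^bsub>M\<^esub> Q"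
    then obtain p q p' q' where pq: "p \<in> P" "q \<in> Q" "p' \<in> P" "q' \<in> Q"
        "x = p \<oplus>\<^bsub>M\<^esub> q" "y = p' \<oplus>\<^bsub>M\<^esub> q'"
      by (auto simp: set_add_def')
    then have "p \<in> carrier M" "q \<in> carrier M" "p' \<in> carrier M" "q' \<in> carrier M"
      using P(1) Q(1) by auto
    then have "x \<oplus>\<^bsub>M\<^esub> y = (p \<oplus>\<^bsub>M\<^esub> p') \<oplus>\<^bsub>M\<^esub> (q \<oplus>\<^bsub>M\<^esub> q')"
      using pq(5,6) by (simp add: M.a_ac)
    then show "x \<oplus>\<^bsub>M\<^esub> y \<in> P <+>\<^bsub>M\<^esub> Q"
      using mem P(3) Q(3) pq by simp
  next
    fix k x assume k: "k \<in> carrier K" and "x \<in> P <+>\<^bsub>M\<^esub> Q"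
    then obtain p q where pq: "p \<in> P" "q \<in> Q" "x = p \<oplus>\<^bsub>M\<^esub> q"
      by (auto simp: set_add_def')
    then have "p \<in> carrier M" "q \<in> carrier M" using P(1) Q(1) by auto
    then have "k \<odot>\<^bsub>M\<^esub> x = k \<odot>\<^bsub>M\<^esub> p \<oplus>\<^bsub>M\<^esub> k \<odot>\<^bsub>M\<^esub> q"
      using pq k by (simp add: M.smult_r_distr)
    then show "k \<odot>\<^bsub>M\<^esub> x \<in> P <+>\<^bsub>M\<^esub> Q"
      using mem P(4) Q(4) pq k by simp
  qed
qed

lemma submodule_Int:
  assumes "module K M" "submodule P K M" "submodule Q K M"
  shows "submodule (P \<inter> Q) K M"
proof -
  interpret M: module K M by fact
  note P = submodule_closed[OF assms(2)] and Q = submodule_closed[OF assms(3)]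
  show ?thesis
    by (rule M.submoduleI') (use P Q in auto)
qed

text \<open>
  The class in \<open>H_n(P/Q)\<close> of a chain of \<open>P\<close> whose boundary lies in \<open>Q\<close>.
\<close>
definition rel_class where
  "rel_class C P Q n c =
     boundaries (quot_complex C P Q) n +>\<^bsub>chain (quot_complex C P Q) n\<^esub> (Q n +>\<^bsub>chain C n\<^esub> c)"

lemma presents_quot_chain:
  assumes C: "is_complex K C" and P: "subcomplex K C P" and Q: "subcomplex K C Q" "\<And>n. Q n \<subseteq> P n"
  shows "presents K (chain C n) (P n) (Q n) (chain (quot_complex C P Q) n) (\<lambda>c. Q n +>\<^bsub>chain C n\<^esub> c)"
  using presents_quot_module[OF is_complexD(1)[OF C] subcomplexD(1)[OF P] subcomplexD(1)[OF Q(1)] Q(2)]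
  by (simp add: quot_complex_def)

lemma quot_map_coset:
  assumes "module K M" "module K M'" "submodule P K M" "submodule Q K M" "Q \<subseteq> P" "submodule Q' K M'"
    and f: "f \<in> module_homs K M M'" "f ` Q \<subseteq> Q'" and c: "c \<in> P"
  shows "quot_map M' Q' f (Q +>\<^bsub>M\<^esub> c) = Q' +>\<^bsub>M'\<^esub> f c"
proof -
  note h = module_homsD[OF f(1)] and Pc = subsetD[OF submodule_closed(1)[OF assms(3)]]
  have "quot_map M' ((\<lambda>x. x) ` Q') f ((\<lambda>x. x) ` Q +>\<^bsub>M\<^esub> c) = (\<lambda>x. x) ` Q' +>\<^bsub>M'\<^esub> f c"
    by (rule quot_map_presents[OF presents_refl[OF assms(1)] presents_refl[OF assms(2)]
          submodule_closed(1)[OF assms(3)] assms(3,5,4) submodule_closed(1)[OF assms(6)] assms(6)])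
      (use h f(2) c Pc in auto)
  then show ?thesis by simp
qed

lemma quot_complex_bdry:
  assumes C: "is_complex K C" and P: "subcomplex K C P" and Q: "subcomplex K C Q" "\<And>n. Q n \<subseteq> P n"
    and c: "c \<in> P n"
  shows "bdry (quot_complex C P Q) n (Q n +>\<^bsub>chain C n\<^esub> c) = Q (n - 1) +>\<^bsub>chain C (n - 1)\<^esub> bdry C n c"
proof -
  have "quot_map (chain C (n - 1)) (Q (n - 1)) (bdry C n) (Q n +>\<^bsub>chain C n\<^esub> c) =
      Q (n - 1) +>\<^bsub>chain C (n - 1)\<^esub> bdry C n c"
    by (rule quot_map_coset[OF is_complexD(1)[OF C] is_complexD(1)[OF C] subcomplexD(1)[OF P]
          subcomplexD(1)[OF Q(1)] Q(2) subcomplexD(1)[OF Q(1)] is_complexD(2)[OF C] _ c])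
      (use subcomplexD(2)[OF Q(1)] in auto)
  then show ?thesis by (simp add: quot_complex_def)
qed

abbreviation rel_cycles where
  "rel_cycles C P Q n \<equiv> {c \<in> P n. bdry C n c \<in> Q (n - 1)}"

abbreviation rel_boundaries where
  "rel_boundaries C P Q n \<equiv> Q n <+>\<^bsub>chain C n\<^esub> bdry C (n + 1) ` P (n + 1)"

lemma relative_cycles_submodule:
  assumes C: "is_complex K C" and P: "subcomplex K C P" and Q: "subcomplex K C Q"
  shows "submodule (rel_cycles C P Q n) K (chain C n)"
  by (rule submodule_kernel_part[OF is_complexD(1)[OF C] is_complexD(1)[OF C] is_complexD(2)[OF C]
        subcomplexD(1)[OF P] subcomplexD(1)[OF Q]])

lemma bdry_image_submodule:
  assumes C: "is_complex K C" and P: "subcomplex K C P"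
  shows "submodule (bdry C (n + 1) ` P (n + 1)) K (chain C n)"
proof -
  have "submodule (bdry C (n + 1) ` P (n + 1)) K (chain C (n + 1 - 1))"
    by (rule submodule_image[OF is_complexD(1)[OF C] is_complexD(1)[OF C] is_complexD(2)[OF C]
          subcomplexD(1)[OF P]])
  then show ?thesis by simp
qed

lemma bdry_bdry:
  assumes "is_complex K C" "b \<in> carrier (chain C (n + 1))"
  shows "bdry C n (bdry C (n + 1) b) = \<zero>\<^bsub>chain C (n - 1)\<^esub>"
  using is_complexD(3)[OF assms] by simp

lemma relative_boundaries_subset:
  assumes C: "is_complex K C" and P: "subcomplex K C P" and Q: "subcomplex K C Q" "\<And>n. Q n \<subseteq> P n"
  shows "rel_boundaries C P Q n \<subseteq> rel_cycles C P Q n"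
proof
  fix c assume "c \<in> rel_boundaries C P Q n"
  then obtain q b where qb: "q \<in> Q n" "b \<in> P (n + 1)" "c = q \<oplus>\<^bsub>chain C n\<^esub> bdry C (n + 1) b"
    by (auto simp: set_add_def')
  interpret N: module K "chain C (n - 1)" by (rule is_complexD(1)[OF C])
  have b: "bdry C (n + 1) b \<in> P n"
    using subcomplexD(2)[OF P qb(2)] by simp
  have "bdry C n c = bdry C n q \<oplus>\<^bsub>chain C (n - 1)\<^esub> bdry C n (bdry C (n + 1) b)"
    using qb b subcomplexD(3)[OF P] subcomplexD(3)[OF Q(1)]
    by (auto intro: module_homsD(2)[OF is_complexD(2)[OF C]])
  also have "\<dots> = bdry C n q"
    using bdry_bdry[OF C subcomplexD(3)[OF P qb(2)]] subcomplexD(2)[OF Q(1) qb(1)]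
      subcomplexD(3)[OF Q(1)] by auto
  finally have "bdry C n c \<in> Q (n - 1)"
    using subcomplexD(2)[OF Q(1) qb(1)] by simp
  moreover have "c \<in> P n"
    using submodule_closed(3)[OF subcomplexD(1)[OF P] subsetD[OF Q(2) qb(1)] b] qb(3) by simp
  ultimately show "c \<in> rel_cycles C P Q n" by simp
qed

text \<open>
  The coset of \<open>c \<in> P\<close> is a cycle of \<open>P/Q\<close> iff \<open>\<partial>c \<in> Q\<close>, and it is a boundary iff \<open>c\<close> differs from the
  boundary of an element of \<open>P\<close> by an element of \<open>Q\<close>.
\<close>
lemma presents_homology_quot:
  assumes C: "is_complex K C" and P: "subcomplex K C P" and Q: "subcomplex K C Q" "\<And>n. Q n \<subseteq> P n"
  shows "presents K (chain C n) (rel_cycles C P Q n)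
           (rel_boundaries C P Q n)
           (homology (quot_complex C P Q) n) (rel_class C P Q n)"
    (is "presents K _ ?Z ?B _ _")
    and "cycles (quot_complex C P Q) n = (\<lambda>c. Q n +>\<^bsub>chain C n\<^esub> c) ` (rel_cycles C P Q n)"
    and "boundaries (quot_complex C P Q) n =
           (\<lambda>c. Q n +>\<^bsub>chain C n\<^esub> c) ` (rel_boundaries C P Q n)"
proof -
  let ?D = "quot_complex C P Q" and ?q = "\<lambda>n c. Q n +>\<^bsub>chain C n\<^esub> c"
  note pq = presents_quot_chain[OF C P Q]
  have zero: "\<zero>\<^bsub>chain ?D n\<^esub> = Q n" for n
    by (simp add: quot_complex_def quot_module_def)
  have bd: "bdry ?D n (?q n c) = ?q (n - 1) (bdry C n c)" if "c \<in> P n" for n c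
    using quot_complex_bdry[OF C P Q that] .
  have iff: "bdry ?D n (?q n c) = Q (n - 1) \<longleftrightarrow> bdry C n c \<in> Q (n - 1)" if "c \<in> P n" for c
    using presentsD(11)[OF pq subcomplexD(2)[OF P that]] bd[OF that] zero by simp
  have "cycles ?D n = {A \<in> ?q n ` P n. bdry ?D n A = Q (n - 1)}"
    unfolding presentsD(7)[OF pq] by (simp add: cycles_def a_kernel_def kernel_def zero)
  also have "\<dots> = ?q n ` ?Z"
    using iff by auto
  finally show cyc: "cycles ?D n = ?q n ` ?Z" .
  have "boundaries ?D n = bdry ?D (n + 1) ` ?q (n + 1) ` P (n + 1)"
    unfolding presentsD(7)[OF pq] by (simp add: boundaries_def)
  also have "\<dots> = (\<lambda>b. ?q n (bdry C (n + 1) b)) ` P (n + 1)"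
    using bd[of _ "n + 1"] by (auto simp: image_image)
  also have "\<dots> = ?q n ` ?B"
  proof -
    interpret N: module K "chain C n" by (rule is_complexD(1)[OF C])
    note Qc = submodule_closed[OF subcomplexD(1)[OF Q(1), of n]]
    have bb: "bdry C (n + 1) b \<in> P n" if "b \<in> P (n + 1)" for b
      using subcomplexD(2)[OF P that] by simp
    have "?q n (q \<oplus>\<^bsub>chain C n\<^esub> bdry C (n + 1) b) = ?q n (bdry C (n + 1) b)"
      if "q \<in> Q n" "b \<in> P (n + 1)" for q b
    proof -
      have "?q n (q \<oplus>\<^bsub>chain C n\<^esub> bdry C (n + 1) b) = ?q n q +>\<^bsub>chain C n\<^esub> bdry C (n + 1) b"
        using that Qc(1) subcomplexD(3)[OF P bb] by (subst N.a_coset_add_assoc) auto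
      also have "?q n q = Q n"
        using that rcoset_eq_self_iff[OF is_complexD(1)[OF C] subcomplexD(1)[OF Q(1)]] Qc(1) by blast
      finally show ?thesis .
    qed
    then show ?thesis
      using Qc(2) by (auto simp: set_add_def' image_iff)
  qed
  finally show bds: "boundaries ?D n = ?q n ` ?B" .
  show "presents K (chain C n) ?Z ?B (homology ?D n) (rel_class C P Q n)"
  proof -
    have "presents K (chain C n) ?Z ?B
        (quot_module (restrict_module (chain ?D n) (?q n ` ?Z)) (?q n ` ?B))
        (\<lambda>z. ?q n ` ?B +>\<^bsub>chain ?D n\<^esub> ?q n z)"
    proof (rule presents_subquotient[OF pq])
      show "submodule ?Z K (chain C n)" by (rule relative_cycles_submodule[OF C P Q(1)])
      show B: "submodule ?B K (chain C n)"
        by (rule submodule_sum[OF is_complexD(1)[OF C] subcomplexD(1)[OF Q(1)] bdry_image_submodule[OF C P]])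
      show "?B \<subseteq> ?Z" by (rule relative_boundaries_subset[OF C P Q])
      show "?Z \<inter> Q n \<subseteq> ?B"
      proof
        fix c assume c: "c \<in> ?Z \<inter> Q n"
        interpret N: module K "chain C n" by (rule is_complexD(1)[OF C])
        have "c \<oplus>\<^bsub>chain C n\<^esub> \<zero>\<^bsub>chain C n\<^esub> \<in> ?B"
          using c by (intro set_addI submodule_closed(2)[OF bdry_image_submodule[OF C P]]) auto
        then show "c \<in> ?B" using c subcomplexD(3)[OF P] by simp
      qed
    qed auto
    then show ?thesis
      unfolding cyc[symmetric] bds[symmetric]
      by (simp add: homology_def rel_class_def[abs_def])
  qed
qed

lemma homology_map_rel_class:
  assumes C: "is_complex K C" and P: "subcomplex K C P" and Q: "subcomplex K C Q" "\<And>n. Q n \<subseteq> P n"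
    and D: "is_complex K D" and P': "subcomplex K D P'" and Q': "subcomplex K D Q'" "\<And>n. Q' n \<subseteq> P' n"
    and f: "chain_map K C D f" "\<And>n. f n ` P n \<subseteq> P' n" "\<And>n. f n ` Q n \<subseteq> Q' n"
    and c: "c \<in> P n" "bdry C n c \<in> Q (n - 1)"
  shows "homology_map (quot_complex D P' Q') n (quot_chain_map D Q' f) (rel_class C P Q n c) =
           rel_class D P' Q' n (f n c)"
proof -
  let ?B = "rel_boundaries C P Q n"
  let ?B' = "rel_boundaries D P' Q' n"
  let ?Z = "rel_cycles C P Q n"
  note pr = presentsD[OF presents_homology_quot(1)[OF C P Q, of n]]
  note pr' = presentsD[OF presents_homology_quot(1)[OF D P' Q', of n]]
  note h = module_homsD[OF chain_mapD(1)[OF f(1)]]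
  have fbd: "f n (bdry C (n + 1) b) = bdry D (n + 1) (f (n + 1) b)" if "b \<in> P (n + 1)" for b
    using chain_mapD(2)[OF f(1) subcomplexD(3)[OF P that]] by simp
  have fB: "f n ` ?B \<subseteq> ?B'"
  proof
    fix x assume "x \<in> f n ` ?B"
    then obtain q b where qb: "q \<in> Q n" "b \<in> P (n + 1)" "x = f n (q \<oplus>\<^bsub>chain C n\<^esub> bdry C (n + 1) b)"
      by (auto simp: set_add_def')
    have "bdry C (n + 1) b \<in> carrier (chain C n)"
      using subcomplexD(2)[OF P qb(2)] subcomplexD(3)[OF P] by simp
    then have "x = f n q \<oplus>\<^bsub>chain D n\<^esub> bdry D (n + 1) (f (n + 1) b)"
      using qb h(2)[where x=q] subcomplexD(3)[OF Q(1) qb(1)] fbd by simp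
    moreover have "f n q \<in> Q' n" "f (n + 1) b \<in> P' (n + 1)"
      using f(2,3) qb by blast+
    ultimately show "x \<in> ?B'" by (auto simp: set_add_def')
  qed
  have fc: "quot_chain_map D Q' f n (Q n +>\<^bsub>chain C n\<^esub> z) = Q' n +>\<^bsub>chain D n\<^esub> f n z" if "z \<in> P n" for z
    unfolding quot_chain_map_def
    by (rule quot_map_coset[OF is_complexD(1)[OF C] is_complexD(1)[OF D] subcomplexD(1)[OF P]
          subcomplexD(1)[OF Q(1)] Q(2) subcomplexD(1)[OF Q'(1)] chain_mapD(1)[OF f(1)] f(3) that])
  show ?thesis
    unfolding homology_map_def rel_class_def presents_homology_quot(3)[OF C P Q]
      presents_homology_quot(3)[OF D P' Q']
  proof (rule quot_map_presents[OF presents_quot_chain[OF C P Q] presents_quot_chain[OF D P' Q'],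
        where S = ?Z])
    show "submodule ?Z K (chain C n)" "submodule ?B K (chain C n)" "submodule ?B' K (chain D n)"
      "?B \<subseteq> ?Z"
      using pr(3,4,5) pr'(4) by auto
    show "?B' \<subseteq> P' n" using pr'(5) by auto
    show "f n ` ?Z \<subseteq> P' n" using f(2) by blast
    show "f n ` ?B \<subseteq> ?B'" by (rule fB)
    show "f n (x \<oplus>\<^bsub>chain C n\<^esub> y) = f n x \<oplus>\<^bsub>chain D n\<^esub> f n y" if "x \<in> ?Z" "y \<in> ?Z" for x y
      using that h(2) subcomplexD(3)[OF P] by blast
  qed (use fc c in auto)
qed

section \<open>Spectral homology\<close>

definition filtered_complex ::
    "('k, 'z) ring_scheme \<Rightarrow> ('k, 'c, 'e) filtered_complex_scheme \<Rightarrow> bool" where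
  "filtered_complex K C \<longleftrightarrow>
     is_complex K C \<and> (\<forall>s. subcomplex K C (filt C s)) \<and>
     (\<forall>s t n. s \<le> t \<longrightarrow> filt C s n \<subseteq> filt C t n)"

lemma filtered_complexD:
  assumes "filtered_complex K C"
  shows "is_complex K C" "\<And>s. subcomplex K C (filt C s)"
    and "\<And>s t n. s \<le> t \<Longrightarrow> filt C s n \<subseteq> filt C t n"
  using assms by (auto simp: filtered_complex_def)

lemma filt_down_mono:
  assumes "filtered_complex K C" "L \<subseteq> L'"
  shows "filt_down C L n \<subseteq> filt_down C L' n"
  using assms submodule_closed(2)[OF subcomplexD(1)[OF filtered_complexD(2)[OF assms(1)]]]
  by (auto simp: filt_down_def)

text \<open>
  The levels form a chain, so two elements of the union lie in a common level.
\<close>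
lemma subcomplex_filt_down:
  assumes C: "filtered_complex K C"
  shows "subcomplex K C (filt_down C L)"
proof -
  note D = filtered_complexD[OF C]
  note F = submodule_closed[OF subcomplexD(1)[OF D(2)]]
  have dir: "\<exists>s\<in>L. x \<in> filt C s n \<and> y \<in> filt C s n"
    if xy: "x \<in> filt_down C L n" "y \<in> filt_down C L n" and L: "L \<noteq> {}" for x y n
  proof -
    obtain s t where "s \<in> L" "t \<in> L" "x \<in> filt C s n" "y \<in> filt C t n"
      using xy L by (auto simp: filt_down_def)
    then show ?thesis
      using D(3)[of s t n] D(3)[of t s n] by (cases "s \<le> t") auto
  qed
  show ?thesis
    unfolding subcomplex_def
  proof (intro allI conjI)
    fix n
    interpret M: module K "chain C n" by (rule is_complexD(1)[OF D(1)])
    show "submodule (filt_down C L n) K (chain C n)"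
    proof (rule M.submoduleI')
      show "filt_down C L n \<subseteq> carrier (chain C n)"
        using F(1) by (auto simp: filt_down_def)
      show "\<zero>\<^bsub>chain C n\<^esub> \<in> filt_down C L n"
        using F(2) by (auto simp: filt_down_def)
      show "x \<oplus>\<^bsub>chain C n\<^esub> y \<in> filt_down C L n"
        if xy: "x \<in> filt_down C L n" "y \<in> filt_down C L n" for x y
      proof (cases "L = {}")
        case True
        then show ?thesis using xy by (auto simp: filt_down_def)
      next
        case False
        then obtain s where "s \<in> L" "x \<in> filt C s n" "y \<in> filt C s n" using dir[OF xy] by blast
        then have "s \<in> L" "x \<oplus>\<^bsub>chain C n\<^esub> y \<in> filt C s n" using F(3) by auto
        then show ?thesis using False by (auto simp: filt_down_def)
      qed
      show "k \<odot>\<^bsub>chain C n\<^esub> x \<in> filt_down C L n"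
        if "k \<in> carrier K" "x \<in> filt_down C L n" for k x
        using that F(4)[of k x _ n] by (cases "L = {}") (auto simp: filt_down_def)
    qed
    show "bdry C n ` filt_down C L n \<subseteq> filt_down C L (n - 1)"
      using module_hom_zero[OF is_complexD(1)[OF D(1)] is_complexD(1)[OF D(1)] is_complexD(2)[OF D(1)]]
        subcomplexD(2)[OF D(2)] by (auto simp: filt_down_def)
  qed
qed

definition filtered_map where
  "filtered_map K C D f \<longleftrightarrow> chain_map K C D f \<and> (\<forall>s n. f n ` filt C s n \<subseteq> filt D s n)"

lemma filtered_map_filt_down:
  assumes C: "filtered_complex K C" and D: "filtered_complex K D"
    and f: "filtered_map K C D f" and L: "L \<subseteq> L'"
  shows "f n ` filt_down C L n \<subseteq> filt_down D L' n"
proof -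
  have "f n \<zero>\<^bsub>chain C n\<^esub> = \<zero>\<^bsub>chain D n\<^esub>"
    using module_hom_zero is_complexD(1) filtered_complexD(1) chain_mapD(1) assms(1,2) f
    unfolding filtered_map_def by metis
  then have "f n ` filt_down C L n \<subseteq> filt_down D L n"
    using f by (auto simp: filt_down_def filtered_map_def)
  then show ?thesis using filt_down_mono[OF D L] by blast
qed

lemma left_part_subset_right_part:
  "I \<noteq> {} \<Longrightarrow> left_part I \<subseteq> right_part I"
  by (fastforce simp: left_part_def right_part_def)

text \<open>
  Write \<open>R = right_part I\<close> and \<open>L = left_part I\<close>. Both are downward closed with \<open>L - r \<subseteq> L \<subseteq> R \<subseteq> R + r\<close>,
  and \<open>I\<close> lies in \<open>R - L\<close>. So a point of \<open>I\<close> is in both shifted sets and bounds everything outside \<open>R\<close>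
  from below and everything in \<open>L\<close> from above, which makes \<open>R\<close>, \<open>L\<close> and their shifts recoverable.
\<close>
lemma shift_parts:
  fixes r :: real
  assumes "I \<noteq> {}" "0 \<le> r"
  shows "right_part (shift_left r I) = right_part I"
    and "left_part (shift_left r I) = (\<lambda>s. s - r) ` left_part I"
    and "right_part (shift_right r I) = (\<lambda>s. s + r) ` right_part I"
    and "left_part (shift_right r I) = left_part I"
    and "shift_left r I \<noteq> {}" "shift_right r I \<noteq> {}"
    and "(\<lambda>s. s - r) ` left_part I \<subseteq> left_part I"
    and "right_part I \<subseteq> (\<lambda>s. s + r) ` right_part I"
proof -
  have R: "s \<in> right_part I \<longleftrightarrow> (\<exists>i\<in>I. s \<le> i)" for s by (simp add: right_part_def)
  have L: "s \<in> left_part I \<longleftrightarrow> (\<forall>i\<in>I. s < i)" for s by (simp add: left_part_def)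
  have Lr: "s \<in> (\<lambda>s. s - r) ` left_part I \<longleftrightarrow> (\<forall>i\<in>I. s + r < i)" for s
  proof -
    have "s \<in> (\<lambda>s. s - r) ` left_part I \<longleftrightarrow> s + r \<in> left_part I"
      by (auto simp: image_iff algebra_simps intro: bexI[of _ "s + r"])
    then show ?thesis by (simp add: L)
  qed
  have Rr: "s \<in> (\<lambda>s. s + r) ` right_part I \<longleftrightarrow> (\<exists>i\<in>I. s - r \<le> i)" for s
  proof -
    have "s \<in> (\<lambda>s. s + r) ` right_part I \<longleftrightarrow> s - r \<in> right_part I"
      by (auto simp: image_iff algebra_simps intro: bexI[of _ "s - r"])
    then show ?thesis by (simp add: R)
  qed
  have SL: "s \<in> shift_left r I \<longleftrightarrow> (\<exists>i\<in>I. s \<le> i) \<and> (\<exists>i\<in>I. i \<le> s + r)" for s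
    unfolding shift_left_def Diff_iff R Lr by (auto simp: not_less)
  have SR: "s \<in> shift_right r I \<longleftrightarrow> (\<exists>i\<in>I. s - r \<le> i) \<and> (\<exists>i\<in>I. i \<le> s)" for s
    unfolding shift_right_def Diff_iff Rr L by (auto simp: not_less)
  obtain i0 where i0: "i0 \<in> I" using assms(1) by blast
  have IL: "i \<in> shift_left r I" "i \<in> shift_right r I" if "i \<in> I" for i
    using that assms(2) unfolding SL SR by (auto intro: bexI[of _ i])
  show "shift_left r I \<noteq> {}" "shift_right r I \<noteq> {}" using IL i0 by auto
  show "(\<lambda>s. s - r) ` left_part I \<subseteq> left_part I"
    unfolding subset_iff L Lr
  proof (intro allI impI ballI)
    fix t i assume "\<forall>i\<in>I. t + r < i" "i \<in> I"
    then have "t + r < i" by blast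
    then show "t < i" using assms(2) by simp
  qed
  show "right_part I \<subseteq> (\<lambda>s. s + r) ` right_part I"
    unfolding subset_iff R Rr
  proof (intro allI impI)
    fix t assume "\<exists>i\<in>I. t \<le> i"
    then obtain i where "i \<in> I" "t \<le> i" by blast
    then have "i \<in> I" "t - r \<le> i" using assms(2) by auto
    then show "\<exists>i\<in>I. t - r \<le> i" by blast
  qed
  show "right_part (shift_left r I) = right_part I"
  proof (intro Set.set_eqI)
    fix s
    show "s \<in> right_part (shift_left r I) \<longleftrightarrow> s \<in> right_part I"
      using IL unfolding R by (auto simp: right_part_def SL) (meson order_trans)
  qed
  show "left_part (shift_right r I) = left_part I"
  proof (intro Set.set_eqI)
    fix s
    show "s \<in> left_part (shift_right r I) \<longleftrightarrow> s \<in> left_part I"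
      using IL unfolding L by (auto simp: left_part_def SR) (meson order_less_le_trans)
  qed
  show "left_part (shift_left r I) = (\<lambda>s. s - r) ` left_part I"
  proof (intro Set.set_eqI iffI)
    fix s assume s: "s \<in> left_part (shift_left r I)"
    have False if "\<not> s + r < i" "i \<in> I" for i
    proof (cases "\<exists>j\<in>I. s \<le> j")
      case True
      then have "s \<in> shift_left r I" using that unfolding SL by (auto simp: not_less)
      then show False using s by (auto simp: left_part_def)
    next
      case False
      then have "i0 < s" using i0 by (meson not_le)
      then show False using s IL(1)[OF i0] by (auto simp: left_part_def)
    qed
    then show "s \<in> (\<lambda>s. s - r) ` left_part I" unfolding Lr by blast
  next
    fix s assume "s \<in> (\<lambda>s. s - r) ` left_part I"
    then show "s \<in> left_part (shift_left r I)" unfolding Lr by (force simp: left_part_def SL)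
  qed
  show "right_part (shift_right r I) = (\<lambda>s. s + r) ` right_part I"
  proof (intro Set.set_eqI iffI)
    fix s assume s: "s \<in> (\<lambda>s. s + r) ` right_part I"
    show "s \<in> right_part (shift_right r I)"
    proof (cases "\<exists>i\<in>I. i \<le> s")
      case True
      then have "s \<in> shift_right r I" using s unfolding SR Rr by blast
      then show ?thesis by (auto simp: right_part_def)
    next
      case False
      then have "s \<le> i0" using i0 by force
      then show ?thesis using IL(2)[OF i0] by (auto simp: right_part_def)
    qed
  next
    fix s assume "s \<in> right_part (shift_right r I)"
    then obtain t i where "s \<le> t" "i \<in> I" "t - r \<le> i" by (auto simp: right_part_def SR)
    then show "s \<in> (\<lambda>s. s + r) ` right_part I" unfolding Rr by (auto intro!: bexI[of _ i])
  qed
qed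

abbreviation right_level where "right_level C I \<equiv> filt_down C (right_part I)"
abbreviation left_level where "left_level C I \<equiv> filt_down C (left_part I)"

definition interval_class where
  "interval_class C I = rel_class C (right_level C I) (left_level C I)"

lemma presents_interval_homology:
  assumes C: "filtered_complex K C" and I: "I \<noteq> {}"
  shows "presents K (chain C n)
     (rel_cycles C (right_level C I) (left_level C I) n)
     (rel_boundaries C (right_level C I) (left_level C I) n)
     (homology (interval_complex C I) n) (interval_class C I n)"
  unfolding interval_class_def interval_complex_def
  by (rule presents_homology_quot(1)[OF filtered_complexD(1)[OF C] subcomplex_filt_down[OF C]
        subcomplex_filt_down[OF C] filt_down_mono[OF C left_part_subset_right_part[OF I]]])

lemma interval_map_class:
  assumes C: "filtered_complex K C" and D: "filtered_complex K D" and f: "filtered_map K C D f"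
    and IJ: "I \<noteq> {}" "J \<noteq> {}" "right_part I \<subseteq> right_part J" "left_part I \<subseteq> left_part J"
    and c: "c \<in> right_level C I n" "bdry C n c \<in> left_level C I (n - 1)"
  shows "interval_map D n J f (interval_class C I n c) = interval_class D J n (f n c)"
  unfolding interval_map_def interval_complex_def interval_class_def
  by (rule homology_map_rel_class[OF filtered_complexD(1)[OF C] subcomplex_filt_down[OF C]
        subcomplex_filt_down[OF C] filt_down_mono[OF C left_part_subset_right_part[OF IJ(1)]]
        filtered_complexD(1)[OF D] subcomplex_filt_down[OF D]
        subcomplex_filt_down[OF D] filt_down_mono[OF D left_part_subset_right_part[OF IJ(2)]]
        _ _ _ c])
    (use f filtered_map_filt_down[OF C D f] IJ in \<open>auto simp: filtered_map_def\<close>)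

lemma filtered_map_id:
  assumes C: "filtered_complex K C"
  shows "filtered_map K C C (\<lambda>n c. c)"
  by (auto simp: filtered_map_def chain_map_def module_homs_def)

text \<open>
  The chains of \<open>F_R\<close> with boundary in \<open>F_(L-r)\<close>, that is, representatives of the classes of
  \<open>H_n(C_I)\<close> that come from the interval with \<open>L\<close> lowered by \<open>r\<close>.
\<close>
definition cycle_reps ::
    "('k, 'c, 'e) filtered_complex_scheme \<Rightarrow> real \<Rightarrow> int \<Rightarrow> real set \<Rightarrow> 'c set" where
  "cycle_reps C r n I =
     rel_cycles C (right_level C I) (filt_down C ((\<lambda>s. s - r) ` left_part I)) n"

text \<open>
  The elements \<open>a + \<partial>b\<close> of \<open>cycle_reps\<close> with \<open>a \<in> F_L\<close> and \<open>b \<in> F_(R+r)\<close>: those whose class vanishes in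
  the interval with \<open>R\<close> raised by \<open>r\<close>.
\<close>
definition boundary_reps ::
    "('k, 'c, 'e) filtered_complex_scheme \<Rightarrow> real \<Rightarrow> int \<Rightarrow> real set \<Rightarrow> 'c set" where
  "boundary_reps C r n I = cycle_reps C r n I \<inter>
     (rel_boundaries C (filt_down C ((\<lambda>s. s + r) ` right_part I)) (left_level C I) n)"

definition spectral_class where
  "spectral_class C r n I c =
     spectral_boundaries C r n I +>\<^bsub>homology (interval_complex C I) n\<^esub> interval_class C I n c"

lemma spectral_cycles_eq:
  assumes C: "filtered_complex K C" and I: "I \<noteq> {}" and r: "0 \<le> r"
  shows "spectral_cycles C r n I = interval_class C I n ` cycle_reps C r n I"
proof -
  note sh = shift_parts[OF I r]
  have "spectral_cycles C r n I =
      interval_map C n I (\<lambda>m c. c) ` interval_class C (shift_left r I) n ` cycle_reps C r n I"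
    unfolding spectral_cycles_def presentsD(7)[OF presents_interval_homology[OF C sh(5)], symmetric]
    by (simp add: sh cycle_reps_def)
  also have "\<dots> = interval_class C I n ` cycle_reps C r n I"
    unfolding image_image
    by (rule image_cong[OF refl], rule interval_map_class[OF C C filtered_map_id[OF C] sh(5) I])
      (use sh in \<open>auto simp: cycle_reps_def\<close>)
  finally show ?thesis .
qed

lemma cycle_reps_subset:
  assumes C: "filtered_complex K C" and I: "I \<noteq> {}" and r: "0 \<le> r"
  shows "cycle_reps C r n I \<subseteq>
    rel_cycles C (right_level C I) (left_level C I) n"
  using filt_down_mono[OF C shift_parts(7)[OF I r]] by (auto simp: cycle_reps_def)

lemma filt_down_add_cancel:
  assumes C: "filtered_complex K C" and a: "a \<in> filt_down C L n" and b: "b \<in> carrier (chain C n)"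
    and ab: "a \<oplus>\<^bsub>chain C n\<^esub> b \<in> filt_down C L n"
  shows "b \<in> filt_down C L n"
proof -
  interpret M: module K "chain C n" by (rule is_complexD(1)[OF filtered_complexD(1)[OF C]])
  have ac: "a \<in> carrier (chain C n)" using subcomplexD(3)[OF subcomplex_filt_down[OF C] a] .
  have "\<ominus>\<^bsub>chain C n\<^esub> a \<oplus>\<^bsub>chain C n\<^esub> (a \<oplus>\<^bsub>chain C n\<^esub> b) = b"
    using ac b by (simp add: M.r_neg1)
  moreover have "\<ominus>\<^bsub>chain C n\<^esub> a \<in> filt_down C L n"
    using M.submoduleE(3)[OF subcomplexD(1)[OF subcomplex_filt_down[OF C]] a] .
  ultimately show ?thesis
    using submodule_closed(3)[OF subcomplexD(1)[OF subcomplex_filt_down[OF C]] _ ab] by metis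
qed

text \<open>
  A class in the kernel has a representative \<open>c = a + \<partial>b\<close> with \<open>a \<in> F_L\<close> and \<open>b \<in> F_(R+r)\<close>. Then
  \<open>\<partial>b = c - a\<close> lies in \<open>F_R\<close> and represents the same class, and being a cycle it belongs to
  \<open>cycle_reps\<close> for every \<open>r\<close>. In particular the kernel is contained in the spectral cycles.
\<close>
lemma spectral_boundaries_eq:
  assumes C: "filtered_complex K C" and I: "I \<noteq> {}" and r: "0 \<le> r"
  shows "spectral_boundaries C r n I = interval_class C I n ` boundary_reps C r n I"
proof -
  note sh = shift_parts[OF I r]
  note CC = filtered_complexD(1)[OF C]
  let ?Z = "rel_cycles C (right_level C I) (left_level C I) n"
  let ?B = "rel_boundaries C (filt_down C ((\<lambda>s. s + r) ` right_part I)) (left_level C I) n"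
  let ?H = "homology (interval_complex C (shift_right r I)) n"
  note pI = presents_interval_homology[OF C I, of n]
  note pS = presents_interval_homology[OF C sh(6), of n]
  have Zs: "?Z \<subseteq> rel_cycles C (filt_down C (right_part (shift_right r I))) (filt_down C (left_part (shift_right r I))) n"
    using filt_down_mono[OF C sh(8)] sh by auto
  have iff: "interval_map C n (shift_right r I) (\<lambda>m c. c) (interval_class C I n c) = \<zero>\<^bsub>?H\<^esub> \<longleftrightarrow> c \<in> ?B"
    if c: "c \<in> ?Z" for c
  proof -
    have "interval_map C n (shift_right r I) (\<lambda>m c. c) (interval_class C I n c) =
        interval_class C (shift_right r I) n c"
      by (rule interval_map_class[OF C C filtered_map_id[OF C] I sh(6)]) (use sh c in auto)
    then show ?thesis
      using presentsD(11)[OF pS, of c] c Zs sh by auto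
  qed
  have "spectral_boundaries C r n I = {h \<in> interval_class C I n ` ?Z.
      interval_map C n (shift_right r I) (\<lambda>m c. c) h = \<zero>\<^bsub>?H\<^esub>}"
    unfolding presentsD(7)[OF pI]
    by (simp add: spectral_boundaries_def a_kernel_def kernel_def)
  also have "\<dots> = interval_class C I n ` (?Z \<inter> ?B)"
    using iff by auto
  also have "\<dots> = interval_class C I n ` boundary_reps C r n I"
  proof
    show "interval_class C I n ` boundary_reps C r n I \<subseteq> interval_class C I n ` (?Z \<inter> ?B)"
      using cycle_reps_subset[OF C I r] by (auto simp: boundary_reps_def)
    show "interval_class C I n ` (?Z \<inter> ?B) \<subseteq> interval_class C I n ` boundary_reps C r n I"
    proof
      fix h assume "h \<in> interval_class C I n ` (?Z \<inter> ?B)"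
      then obtain c where c: "c \<in> ?Z" "c \<in> ?B" "h = interval_class C I n c" by blast
      then obtain a b where ab: "a \<in> left_level C I n"
          "b \<in> filt_down C ((\<lambda>s. s + r) ` right_part I) (n + 1)"
          "c = a \<oplus>\<^bsub>chain C n\<^esub> bdry C (n + 1) b"
        by (auto simp: set_add_def')
      interpret M: module K "chain C n" by (rule is_complexD(1)[OF CC])
      note F = subcomplex_filt_down[OF C]
      have bc: "b \<in> carrier (chain C (n + 1))" using subcomplexD(3)[OF F ab(2)] .
      have dbc: "bdry C (n + 1) b \<in> carrier (chain C n)"
        using module_homsD(1)[OF is_complexD(2)[OF CC] bc] by simp
      have ac: "a \<in> carrier (chain C n)" using subcomplexD(3)[OF F ab(1)] .
      have aR: "a \<in> right_level C I n"
        using ab(1) filt_down_mono[OF C left_part_subset_right_part[OF I]] by blast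
      have dbR: "bdry C (n + 1) b \<in> right_level C I n"
        using filt_down_add_cancel[OF C aR dbc] c ab by auto
      have ddb: "bdry C n (bdry C (n + 1) b) \<in> filt_down C L (n - 1)" for L
        using bdry_bdry[OF CC bc] submodule_closed(2)[OF subcomplexD(1)[OF F]] by simp
      have z: "bdry C (n + 1) b \<in> ?Z" using dbR ddb by simp
      have "\<zero>\<^bsub>chain C n\<^esub> \<oplus>\<^bsub>chain C n\<^esub> bdry C (n + 1) b \<in> ?B"
        by (rule set_addI[OF submodule_closed(2)[OF subcomplexD(1)[OF F]] imageI[OF ab(2)]])
      then have "bdry C (n + 1) b \<in> boundary_reps C r n I"
        using dbR ddb dbc by (simp add: boundary_reps_def cycle_reps_def)
      moreover have "h = interval_class C I n (bdry C (n + 1) b)"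
      proof -
        have "c \<ominus>\<^bsub>chain C n\<^esub> bdry C (n + 1) b = a"
          using ab(3) ac dbc by (simp add: a_minus_def M.a_assoc M.r_neg)
        moreover have "a \<oplus>\<^bsub>chain C n\<^esub> \<zero>\<^bsub>chain C n\<^esub> \<in> rel_boundaries C (right_level C I) (left_level C I) n"
          by (rule set_addI[OF ab(1) submodule_closed(2)[OF bdry_image_submodule[OF CC F]]])
        ultimately show ?thesis
          using presents_eq_iff[OF pI c(1) z] c(3) ac by simp
      qed
      ultimately show "h \<in> interval_class C I n ` boundary_reps C r n I" by blast
    qed
  qed
  finally show ?thesis .
qed

lemma boundary_reps_submodule:
  assumes C: "filtered_complex K C"
  shows "submodule (cycle_reps C r n I) K (chain C n)" "submodule (boundary_reps C r n I) K (chain C n)"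
proof -
  note CC = filtered_complexD(1)[OF C]
  note F = subcomplex_filt_down[OF C]
  show Z: "submodule (cycle_reps C r n I) K (chain C n)"
    unfolding cycle_reps_def by (rule relative_cycles_submodule[OF CC F F])
  show "submodule (boundary_reps C r n I) K (chain C n)"
    unfolding boundary_reps_def
    by (rule submodule_Int[OF is_complexD(1)[OF CC] Z
          submodule_sum[OF is_complexD(1)[OF CC] subcomplexD(1)[OF F] bdry_image_submodule[OF CC F]]])
qed

text \<open>
  Elements of \<open>cycle_reps\<close> that are relations of \<open>H_n(C_I)\<close> lie in \<open>F_L + \<partial> F_R \<subseteq> F_L + \<partial> F_(R+r)\<close>, so
  they are in \<open>boundary_reps\<close>.
\<close>
lemma presents_spectral_homology:
  assumes C: "filtered_complex K C" and I: "I \<noteq> {}" and r: "0 \<le> r"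
  shows "presents K (chain C n) (cycle_reps C r n I) (boundary_reps C r n I)
           (spectral_homology C r n I) (spectral_class C r n I)"
proof -
  note sh = shift_parts[OF I r]
  have "presents K (chain C n) (cycle_reps C r n I) (boundary_reps C r n I)
      (quot_module (restrict_module (homology (interval_complex C I) n)
          (interval_class C I n ` cycle_reps C r n I)) (interval_class C I n ` boundary_reps C r n I))
      (\<lambda>c. interval_class C I n ` boundary_reps C r n I +>\<^bsub>homology (interval_complex C I) n\<^esub>
          interval_class C I n c)"
  proof (rule presents_subquotient[OF presents_interval_homology[OF C I] boundary_reps_submodule(1)[OF C]
        cycle_reps_subset[OF C I r] boundary_reps_submodule(2)[OF C]])
    show "boundary_reps C r n I \<subseteq> cycle_reps C r n I" by (simp add: boundary_reps_def)
    show "cycle_reps C r n I \<inter> (rel_boundaries C (right_level C I) (left_level C I) n) \<subseteq> boundary_reps C r n I"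
      using filt_down_mono[OF C sh(8), of "n + 1"] unfolding boundary_reps_def set_add_def' by blast
  qed
  then show ?thesis
    unfolding spectral_cycles_eq[OF C I r, symmetric] spectral_boundaries_eq[OF C I r, symmetric]
    by (simp add: spectral_homology_def spectral_class_def[abs_def])
qed

lemma filtered_map_reps:
  assumes C: "filtered_complex K C" and D: "filtered_complex K D" and f: "filtered_map K C D f"
    and IJ: "right_part I \<subseteq> right_part J" "left_part I \<subseteq> left_part J"
  shows "f n ` cycle_reps C r n I \<subseteq> cycle_reps D r n J"
    and "f n ` boundary_reps C r n I \<subseteq> boundary_reps D r n J"
proof -
  have cm: "chain_map K C D f" using f by (simp add: filtered_map_def)
  note h = module_homsD[OF chain_mapD(1)[OF cm]]
  note fd = filtered_map_filt_down[OF C D f]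
  note F = subcomplex_filt_down[OF C]
  have fZ: "f n c \<in> cycle_reps D r n J" if c: "c \<in> cycle_reps C r n I" for c
  proof -
    have "f (n - 1) (bdry C n c) = bdry D n (f n c)"
      using chain_mapD(2)[OF cm] subcomplexD(3)[OF F] c by (auto simp: cycle_reps_def)
    moreover have "f (n - 1) (bdry C n c) \<in> filt_down D ((\<lambda>s. s - r) ` left_part J) (n - 1)"
      using fd[OF image_mono[OF IJ(2)], of "n - 1"] c by (auto simp: cycle_reps_def)
    ultimately show ?thesis
      using fd[OF IJ(1), of n] c by (auto simp: cycle_reps_def)
  qed
  then show "f n ` cycle_reps C r n I \<subseteq> cycle_reps D r n J" by blast
  have "f n c \<in> boundary_reps D r n J" if c: "c \<in> boundary_reps C r n I" for c
  proof -
    obtain a b where ab: "a \<in> left_level C I n"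
        "b \<in> filt_down C ((\<lambda>s. s + r) ` right_part I) (n + 1)"
        "c = a \<oplus>\<^bsub>chain C n\<^esub> bdry C (n + 1) b"
      using c by (auto simp: set_add_def' boundary_reps_def)
    have "bdry C (n + 1) b \<in> carrier (chain C n)"
      using subcomplexD(2)[OF F ab(2)] subcomplexD(3)[OF F] by simp
    moreover have "f n (bdry C (n + 1) b) = bdry D (n + 1) (f (n + 1) b)"
      using chain_mapD(2)[OF cm subcomplexD(3)[OF F ab(2)]] by simp
    ultimately have "f n c = f n a \<oplus>\<^bsub>chain D n\<^esub> bdry D (n + 1) (f (n + 1) b)"
      using ab(3) h(2)[where x=a] subcomplexD(3)[OF F ab(1)] by simp
    moreover have "f n a \<in> left_level D J n"
      "f (n + 1) b \<in> filt_down D ((\<lambda>s. s + r) ` right_part J) (n + 1)"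
      using fd[OF IJ(2)] fd[OF image_mono[OF IJ(1)]] ab by blast+
    ultimately show ?thesis
      using fZ c unfolding boundary_reps_def set_add_def' by blast
  qed
  then show "f n ` boundary_reps C r n I \<subseteq> boundary_reps D r n J" by blast
qed

lemma spectral_map_class:
  assumes C: "filtered_complex K C" and D: "filtered_complex K D" and f: "filtered_map K C D f"
    and I: "I \<noteq> {}" and J: "J \<noteq> {}" and r: "0 \<le> r"
    and IJ: "right_part I \<subseteq> right_part J" "left_part I \<subseteq> left_part J"
    and c: "c \<in> cycle_reps C r n I"
  shows "spectral_map D r n J f (spectral_class C r n I c) = spectral_class D r n J (f n c)"
  unfolding spectral_map_def spectral_class_def spectral_boundaries_eq[OF C I r] spectral_boundaries_eq[OF D J r]
proof (rule quot_map_presents[OF presents_interval_homology[OF C I] presents_interval_homology[OF D J]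
      cycle_reps_subset[OF C I r] boundary_reps_submodule(1)[OF C] _ boundary_reps_submodule(2)[OF C] _
      boundary_reps_submodule(2)[OF D]])
  have cm: "chain_map K C D f" using f by (simp add: filtered_map_def)
  note h = module_homsD[OF chain_mapD(1)[OF cm]]
  show "boundary_reps C r n I \<subseteq> cycle_reps C r n I" by (simp add: boundary_reps_def)
  show "boundary_reps D r n J \<subseteq>
      rel_cycles D (right_level D J) (left_level D J) n"
    using cycle_reps_subset[OF D J r, of n] by (auto simp: boundary_reps_def)
  show "f n ` cycle_reps C r n I \<subseteq>
      rel_cycles D (right_level D J) (left_level D J) n"
    using cycle_reps_subset[OF D J r, of n] filtered_map_reps(1)[OF C D f IJ] by blast
  show "f n ` boundary_reps C r n I \<subseteq> boundary_reps D r n J"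
    by (rule filtered_map_reps(2)[OF C D f IJ])
  show "f n (x \<oplus>\<^bsub>chain C n\<^esub> y) = f n x \<oplus>\<^bsub>chain D n\<^esub> f n y"
    if "x \<in> cycle_reps C r n I" "y \<in> cycle_reps C r n I" for x y
    using that subsetD[OF submodule_closed(1)[OF boundary_reps_submodule(1)[OF C]]] by (intro h(2)) auto
  show "interval_map D n J f (interval_class C I n z) = interval_class D J n (f n z)"
    if "z \<in> cycle_reps C r n I" for z
    by (rule interval_map_class[OF C D f I J IJ]) (use that cycle_reps_subset[OF C I r, of n] in auto)
qed (rule c)

text \<open>
  For \<open>c\<close> in \<open>F_R\<close> with \<open>\<partial>c \<in> F_(L-r)\<close>, a homotopy that raises the filtration by \<open>r\<close> has
  \<open>h \<partial>c \<in> F_L\<close> and \<open>h c \<in> F_(R+r)\<close>. So \<open>g c - f c\<close> is a relation of the spectral homology.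
\<close>
lemma spectral_map_homotopy:
  assumes C: "filtered_complex K C" and D: "filtered_complex K D"
    and f: "filtered_map K C D f" and g: "filtered_map K C D g"
    and I: "I \<noteq> {}" and r: "0 \<le> r"
    and h: "\<And>n. h n \<in> module_homs K (chain C n) (chain D (n + 1))"
      "\<And>s n. h n ` filt C s n \<subseteq> filt D (s + r) (n + 1)"
    and eq: "\<And>n c. c \<in> carrier (chain C n) \<Longrightarrow>
      h (n - 1) (bdry C n c) \<oplus>\<^bsub>chain D n\<^esub> bdry D (n + 1) (h n c) = g n c \<ominus>\<^bsub>chain D n\<^esub> f n c"
    and a: "a \<in> carrier (spectral_homology C r n I)"
  shows "spectral_map D r n I f a = spectral_map D r n I g a"
proof -
  note CC = filtered_complexD(1)[OF C] and DD = filtered_complexD(1)[OF D]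
  note F = subcomplex_filt_down[OF C]
  have hL: "h m ` filt_down C L m \<subseteq> filt_down D ((\<lambda>s. s + r) ` L) (m + 1)" for L m
  proof (cases "L = {}")
    case True
    then show ?thesis
      using module_hom_zero[OF is_complexD(1)[OF CC] is_complexD(1)[OF DD] h(1)]
      by (simp add: filt_down_def)
  next
    case False
    then show ?thesis using h(2)[of m] unfolding filt_down_def by auto
  qed
  obtain c where c: "c \<in> cycle_reps C r n I" "a = spectral_class C r n I c"
    using a presentsD(7)[OF presents_spectral_homology[OF C I r, of n]] by blast
  have cc: "c \<in> carrier (chain C n)" "c \<in> right_level C I n"
    "bdry C n c \<in> filt_down C ((\<lambda>s. s - r) ` left_part I) (n - 1)"
    using c subcomplexD(3)[OF F] by (auto simp: cycle_reps_def)
  have fc: "f n c \<in> cycle_reps D r n I" "g n c \<in> cycle_reps D r n I"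
    using filtered_map_reps(1)[OF C D f order_refl order_refl]
      filtered_map_reps(1)[OF C D g order_refl order_refl] c by blast+
  have "(\<lambda>s. s + r) ` (\<lambda>s. s - r) ` left_part I = left_part I"
    by (simp add: image_image)
  then have 1: "h (n - 1) (bdry C n c) \<in> left_level D I n"
    using hL[of "n - 1" "(\<lambda>s. s - r) ` left_part I"] cc(3) by auto
  have 2: "h n c \<in> filt_down D ((\<lambda>s. s + r) ` right_part I) (n + 1)"
    using hL[of n] cc(2) by blast
  have "g n c \<ominus>\<^bsub>chain D n\<^esub> f n c \<in> rel_boundaries D (filt_down D ((\<lambda>s. s + r) ` right_part I)) (left_level D I) n"
    unfolding eq[OF cc(1), symmetric] by (rule set_addI[OF 1 imageI[OF 2]])
  moreover have "g n c \<ominus>\<^bsub>chain D n\<^esub> f n c \<in> cycle_reps D r n I"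
    by (rule submodule_minus[OF is_complexD(1)[OF DD] boundary_reps_submodule(1)[OF D] fc(2,1)])
  ultimately have "spectral_class D r n I (g n c) = spectral_class D r n I (f n c)"
    using presents_eq_iff[OF presents_spectral_homology[OF D I r] fc(2,1)] by (simp add: boundary_reps_def)
  then show ?thesis
    using spectral_map_class[OF C D f I I r order_refl order_refl c(1)]
      spectral_map_class[OF C D g I I r order_refl order_refl c(1)] c(2) by simp
qed

section \<open>Linear maps between free modules\<close>

definition basis_chain :: "('k, 'z) ring_scheme \<Rightarrow> 's \<Rightarrow> 's \<Rightarrow> 'k" where
  "basis_chain K s = (\<lambda>t. if t = s then \<one>\<^bsub>K\<^esub> else \<zero>\<^bsub>K\<^esub>)"

abbreviation all_chains :: "('k, 'z) ring_scheme \<Rightarrow> ('k, 's \<Rightarrow> 'k) module" where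
  "all_chains K \<equiv> free_module K UNIV"

abbreviation lin where
  "lin K \<equiv> module_homs K (all_chains K) (all_chains K)"

lemma free_module_simps [simp]:
  "\<zero>\<^bsub>free_module K S\<^esub> = (\<lambda>s. \<zero>\<^bsub>K\<^esub>)"
  "c \<oplus>\<^bsub>free_module K S\<^esub> e = (\<lambda>s. c s \<oplus>\<^bsub>K\<^esub> e s)"
  "k \<odot>\<^bsub>free_module K S\<^esub> c = (\<lambda>s. k \<otimes>\<^bsub>K\<^esub> c s)"
  by (simp_all add: free_module_def)

lemma free_module_carrier_iff:
  "c \<in> carrier (free_module K S) \<longleftrightarrow>
     (\<forall>s. c s \<in> carrier K) \<and> finite (support K c) \<and> (\<forall>s. c s \<noteq> \<zero>\<^bsub>K\<^esub> \<longrightarrow> s \<in> S)"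
  by (auto simp: free_module_def support_def)

lemma free_module_carrier_mono:
  "S \<subseteq> T \<Longrightarrow> carrier (free_module K S) \<subseteq> carrier (free_module K T)"
  by (auto simp: free_module_carrier_iff subset_iff)

lemma module_homs_cong:
  assumes "module K M" "\<And>c. c \<in> carrier M \<Longrightarrow> h c = h' c"
  shows "h \<in> module_homs K M N \<longleftrightarrow> h' \<in> module_homs K M N"
proof -
  interpret M: module K M by fact
  show ?thesis
    using assms(2) by (simp add: module_homs_def Pi_def)
qed

context cring
begin

lemma free_module_val [simp]: "c \<in> carrier (free_module R S) \<Longrightarrow> c s \<in> carrier R"
  by (simp add: free_module_carrier_iff)

abbreviation formal_sums :: "('s \<Rightarrow> 'a) set" where
  "formal_sums \<equiv> carrier (all_chains R)"

lemma free_module_all: "c \<in> carrier (free_module R S) \<Longrightarrow> c \<in> formal_sums"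
  by (simp add: free_module_carrier_iff)

lemma free_module_supportI:
  assumes "finite A" "\<And>s. c s \<in> carrier R" "\<And>s. c s \<noteq> \<zero> \<Longrightarrow> s \<in> A" "\<And>s. c s \<noteq> \<zero> \<Longrightarrow> s \<in> S"
  shows "c \<in> carrier (free_module R S)"
proof -
  have "support R c \<subseteq> A" using assms(3) by (auto simp: support_def)
  then show ?thesis using assms finite_subset by (auto simp: free_module_carrier_iff)
qed

lemma free_module_add_closed:
  assumes "c \<in> carrier (free_module R S)" "e \<in> carrier (free_module R S)"
  shows "(\<lambda>s. c s \<oplus> e s) \<in> carrier (free_module R S)"
proof (rule free_module_supportI[where A = "support R c \<union> support R e"])
  fix s assume "c s \<oplus> e s \<noteq> \<zero>"
  then have "c s \<noteq> \<zero> \<or> e s \<noteq> \<zero>" by auto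
  then show "s \<in> support R c \<union> support R e" "s \<in> S"
    using assms by (auto simp: free_module_carrier_iff support_def)
qed (use assms in \<open>auto simp: free_module_carrier_iff\<close>)

lemma free_module_smult_closed:
  assumes "k \<in> carrier R" "c \<in> carrier (free_module R S)"
  shows "(\<lambda>s. k \<otimes> c s) \<in> carrier (free_module R S)"
proof (rule free_module_supportI[where A = "support R c"])
  fix s assume "k \<otimes> c s \<noteq> \<zero>"
  then have "c s \<noteq> \<zero>" using assms(1) by auto
  then show "s \<in> support R c" "s \<in> S"
    using assms by (auto simp: free_module_carrier_iff support_def)
qed (use assms in \<open>auto simp: free_module_carrier_iff\<close>)

lemma free_module_zero_closed: "(\<lambda>s. \<zero>) \<in> carrier (free_module R S)"
  by (simp add: free_module_carrier_iff support_def)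

lemma free_module_is_module: "module R (free_module R S)"
proof (rule moduleI)
  show "cring R" by (rule is_cring)
  show "abelian_group (free_module R S)"
  proof (rule abelian_groupI)
    fix c assume c: "c \<in> carrier (free_module R S)"
    have "(\<lambda>s. \<ominus> \<one> \<otimes> c s) \<in> carrier (free_module R S)"
      by (rule free_module_smult_closed[OF _ c]) simp
    moreover have "(\<lambda>s. \<ominus> \<one> \<otimes> c s) \<oplus>\<^bsub>free_module R S\<^esub> c = \<zero>\<^bsub>free_module R S\<^esub>"
      using c by (simp add: l_minus l_neg)
    ultimately show "\<exists>e\<in>carrier (free_module R S). e \<oplus>\<^bsub>free_module R S\<^esub> c = \<zero>\<^bsub>free_module R S\<^esub>"
      by blast
  qed (auto simp: free_module_add_closed free_module_zero_closed a_ac)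
qed (auto simp: free_module_smult_closed l_distr r_distr m_assoc)

lemma free_module_submodule:
  assumes "S \<subseteq> T"
  shows "submodule (carrier (free_module R S)) R (free_module R T)"
  by (rule module.submoduleI'[OF free_module_is_module])
    (use free_module_carrier_mono[OF assms] in
      \<open>auto simp: free_module_add_closed free_module_smult_closed free_module_zero_closed\<close>)

lemma free_module_uminus:
  assumes "c \<in> carrier (free_module R S)"
  shows "\<ominus>\<^bsub>free_module R S\<^esub> c = (\<lambda>s. \<ominus> c s)"
  using module.uminus_eq_smult[OF free_module_is_module assms] assms by (simp add: l_minus)

lemma free_module_minus:
  assumes "c \<in> carrier (free_module R S)" "e \<in> carrier (free_module R S)"
  shows "c \<ominus>\<^bsub>free_module R S\<^esub> e = (\<lambda>s. c s \<ominus> e s)"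
  using free_module_uminus[OF assms(2)] by (simp add: a_minus_def)

lemma free_module_minus_closed:
  assumes "c \<in> carrier (free_module R S)" "e \<in> carrier (free_module R S)"
  shows "(\<lambda>s. c s \<ominus> e s) \<in> carrier (free_module R S)"
proof -
  interpret M: module R "free_module R S" by (rule free_module_is_module)
  show ?thesis using M.minus_closed[OF assms] free_module_minus[OF assms] by simp
qed

lemma basis_chain_val [simp]: "basis_chain R s t \<in> carrier R"
  by (simp add: basis_chain_def)

lemma basis_chain_closed: "s \<in> S \<Longrightarrow> basis_chain R s \<in> carrier (free_module R S)"
  by (rule free_module_supportI[where A = "{s}"]) (auto simp: basis_chain_def split: if_splits)

lemma basis_chain_all [simp]: "basis_chain R s \<in> formal_sums"
  by (rule basis_chain_closed) simp

lemma free_module_induct [consumes 1, case_names zero add]: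
  assumes "c \<in> carrier (free_module R S)"
    and zero: "P (\<lambda>s. \<zero>)"
    and step: "\<And>k s e. k \<in> carrier R \<Longrightarrow> s \<in> S \<Longrightarrow> e \<in> carrier (free_module R S) \<Longrightarrow> P e \<Longrightarrow>
      P (\<lambda>t. (k \<otimes> basis_chain R s t) \<oplus> e t)"
  shows "P c"
proof -
  have "P c" if "finite A" "c \<in> carrier (free_module R S)" "support R c \<subseteq> A" for A c
    using that
  proof (induction A arbitrary: c rule: finite_induct)
    case empty
    then have "c = (\<lambda>s. \<zero>)" by (auto simp: support_def)
    then show ?case using zero by simp
  next
    case (insert a A)
    note c = insert.prems(1)
    let ?e = "c(a := \<zero>)"
    have e: "?e \<in> carrier (free_module R S)"
      by (rule free_module_supportI[where A = "support R c"])
        (use c in \<open>auto simp: free_module_carrier_iff support_def split: if_splits\<close>)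
    have "support R ?e \<subseteq> A"
      using insert.prems(2) by (auto simp: support_def split: if_splits)
    then have Pe: "P ?e" by (rule insert.IH[OF e])
    show ?case
    proof (cases "c a = \<zero>")
      case True
      then have "?e = c" by auto
      then show ?thesis using Pe by simp
    next
      case False
      then have "a \<in> S" using c by (auto simp: free_module_carrier_iff)
      then have "P (\<lambda>t. (c a \<otimes> basis_chain R a t) \<oplus> ?e t)"
        using step[OF _ _ e Pe] c by simp
      moreover have "(\<lambda>t. (c a \<otimes> basis_chain R a t) \<oplus> ?e t) = c"
        using c by (auto simp: basis_chain_def fun_eq_iff)
      ultimately show ?thesis by simp
    qed
  qed
  then show ?thesis
    using assms(1) by (auto simp: free_module_carrier_iff)
qed

lemma lin_closed:
  "h \<in> lin R \<Longrightarrow> c \<in> formal_sums \<Longrightarrow> h c \<in> formal_sums"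
  by (erule module_homsD(1))

lemma lin_add:
  assumes "h \<in> lin R" "c \<in> formal_sums" "e \<in> formal_sums"
  shows "h (\<lambda>s. c s \<oplus> e s) = (\<lambda>s. h c s \<oplus> h e s)"
  using module_homsD(2)[OF assms] by simp

lemma lin_smult:
  assumes "h \<in> lin R" "k \<in> carrier R" "c \<in> formal_sums"
  shows "h (\<lambda>s. k \<otimes> c s) = (\<lambda>s. k \<otimes> h c s)"
  using module_homsD(3)[OF assms] by simp

lemma lin_zero:
  assumes "h \<in> lin R"
  shows "h (\<lambda>s. \<zero>) = (\<lambda>s. \<zero>)"
  using module_hom_zero[OF free_module_is_module free_module_is_module assms] by simp

lemma lin_minus:
  assumes "h \<in> lin R" "c \<in> formal_sums" "e \<in> formal_sums"
  shows "h (\<lambda>s. c s \<ominus> e s) = (\<lambda>s. h c s \<ominus> h e s)"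
  using module_hom_minus[OF free_module_is_module free_module_is_module assms]
  unfolding free_module_minus[OF assms(2,3)]
    free_module_minus[OF lin_closed[OF assms(1,2)] lin_closed[OF assms(1,3)]] .

lemma linI:
  assumes "\<And>c. c \<in> formal_sums \<Longrightarrow> h c \<in> formal_sums"
    and "\<And>c e s. c \<in> formal_sums \<Longrightarrow> e \<in> formal_sums \<Longrightarrow>
           h (\<lambda>s. c s \<oplus> e s) s = h c s \<oplus> h e s"
    and "\<And>k c s. k \<in> carrier R \<Longrightarrow> c \<in> formal_sums \<Longrightarrow> h (\<lambda>s. k \<otimes> c s) s = k \<otimes> h c s"
  shows "h \<in> lin R"
  using assms by (auto simp: module_homs_def fun_eq_iff)

lemma lin_compose:
  assumes "h \<in> lin R" "h' \<in> lin R"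
  shows "(\<lambda>c. h' (h c)) \<in> lin R"
  by (rule linI) (use assms in \<open>auto simp: lin_closed lin_add lin_smult\<close>)

lemma lin_plus:
  fixes h h' :: "('s \<Rightarrow> 'a) \<Rightarrow> 't \<Rightarrow> 'a"
  assumes "h \<in> lin R" "h' \<in> lin R"
  shows "(\<lambda>c s. h c s \<oplus> h' c s) \<in> lin R"
proof (rule linI)
  fix c :: "'s \<Rightarrow> 'a" assume c: "c \<in> formal_sums"
  show "(\<lambda>s. h c s \<oplus> h' c s) \<in> formal_sums"
    using assms c by (simp add: free_module_add_closed lin_closed)
next
  fix c e :: "'s \<Rightarrow> 'a" and s :: 't
  assume c: "c \<in> formal_sums" "e \<in> formal_sums"
  have "h c s \<in> carrier R" "h e s \<in> carrier R" "h' c s \<in> carrier R" "h' e s \<in> carrier R"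
    using assms c by (meson free_module_val lin_closed)+
  then show "h (\<lambda>s. c s \<oplus> e s) s \<oplus> h' (\<lambda>s. c s \<oplus> e s) s = (h c s \<oplus> h' c s) \<oplus> (h e s \<oplus> h' e s)"
    using assms c by (simp add: lin_add a_ac)
next
  fix k and c :: "'s \<Rightarrow> 'a" and s :: 't assume k: "k \<in> carrier R" and c: "c \<in> formal_sums"
  have "h c s \<in> carrier R" "h' c s \<in> carrier R"
    using assms c by (meson free_module_val lin_closed)+
  then show "h (\<lambda>s. k \<otimes> c s) s \<oplus> h' (\<lambda>s. k \<otimes> c s) s = k \<otimes> (h c s \<oplus> h' c s)"
    using assms c k by (simp add: lin_smult r_distr)
qed

lemma lin_diff:
  fixes h h' :: "('s \<Rightarrow> 'a) \<Rightarrow> 't \<Rightarrow> 'a"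
  assumes "h \<in> lin R" "h' \<in> lin R"
  shows "(\<lambda>c s. h c s \<ominus> h' c s) \<in> lin R"
proof -
  have neg: "(\<lambda>(c :: 't \<Rightarrow> 'a) s. \<ominus> \<one> \<otimes> c s) \<in> lin R"
    by (rule linI) (auto simp: free_module_smult_closed r_distr m_lcomm)
  have "(\<lambda>c s. h c s \<oplus> \<ominus> \<one> \<otimes> h' c s) \<in> lin R"
    by (rule lin_plus[OF assms(1) lin_compose[OF assms(2) neg]])
  moreover
  have "(\<lambda>c s. h c s \<oplus> \<ominus> \<one> \<otimes> h' c s) \<in> lin R \<longleftrightarrow> (\<lambda>c s. h c s \<ominus> h' c s) \<in> lin R"
  proof (rule module_homs_cong[OF free_module_is_module])
    show "(\<lambda>s. h c s \<oplus> \<ominus> \<one> \<otimes> h' c s) = (\<lambda>s. h c s \<ominus> h' c s)"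
      if "c \<in> formal_sums" for c
      using lin_closed[OF assms(2) that] by (simp add: a_minus_def l_minus)
  qed
  ultimately show ?thesis by blast
qed

lemma lin_eqI:
  assumes "h \<in> lin R" "h' \<in> lin R" "\<And>s. s \<in> S \<Longrightarrow> h (basis_chain R s) = h' (basis_chain R s)"
    and "c \<in> carrier (free_module R S)"
  shows "h c = h' c"
  using assms(4)
proof (induction rule: free_module_induct)
  case zero
  then show ?case using assms lin_zero by metis
next
  case (add k s e)
  have "(\<lambda>t. k \<otimes> basis_chain R s t) \<in> formal_sums"
    by (rule free_module_smult_closed[OF add(1) basis_chain_all])
  moreover have "e \<in> formal_sums" by (rule free_module_all[OF add(3)])
  ultimately show ?case
    using add(1,4) assms(3)[OF add(2)]
    by (simp add: lin_add[OF assms(1)] lin_add[OF assms(2)] lin_smult[OF assms(1)] lin_smult[OF assms(2)])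
qed

lemma lin_free_closed:
  assumes "h \<in> lin R" "\<And>s t. s \<in> S \<Longrightarrow> h (basis_chain R s) t \<noteq> \<zero> \<Longrightarrow> t \<in> T"
    and "c \<in> carrier (free_module R S)"
  shows "h c \<in> carrier (free_module R T)"
  using assms(3)
proof (induction rule: free_module_induct)
  case zero
  then show ?case using lin_zero[OF assms(1)] by (simp add: free_module_zero_closed)
next
  case (add k s e)
  have 1: "(\<lambda>t. k \<otimes> basis_chain R s t) \<in> formal_sums"
    by (rule free_module_smult_closed[OF add(1) basis_chain_all])
  have 2: "e \<in> formal_sums" by (rule free_module_all[OF add(3)])
  have "h (basis_chain R s) \<in> formal_sums" by (rule lin_closed[OF assms(1)]) simp
  then have "h (basis_chain R s) \<in> carrier (free_module R T)"
    using assms(2)[OF add(2)] by (auto simp: free_module_carrier_iff)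
  then show ?case
    using add(1,4) by (simp add: lin_add[OF assms(1) 1 2] lin_smult[OF assms(1)]
        free_module_add_closed free_module_smult_closed)
qed

lemma lin_free_hom:
  assumes "h \<in> lin R" "\<And>s t. s \<in> S \<Longrightarrow> h (basis_chain R s) t \<noteq> \<zero> \<Longrightarrow> t \<in> T"
  shows "h \<in> module_homs R (free_module R S) (free_module R T)"
  using lin_free_closed[OF assms]
    lin_add[OF assms(1) free_module_all[of _ S] free_module_all[of _ S]]
    lin_smult[OF assms(1) _ free_module_all[of _ S]]
  by (auto simp: module_homs_def)

lemma linear_extension_eq:
  assumes c: "c \<in> carrier (free_module R S)" and A: "finite A" "support R c \<subseteq> A"
    and T: "\<And>s. T s t \<in> carrier R"
  shows "linear_extension R T c t = (\<Oplus>s\<in>A. c s \<otimes> T s t)"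
  unfolding linear_extension_def
  by (rule add.finprod_mono_neutral_cong_left) (use assms in \<open>auto simp: support_def\<close>)

lemma linear_extension_lin:
  assumes T: "\<And>s. T s \<in> formal_sums"
  shows "linear_extension R T \<in> lin R"
proof (rule linI)
  fix c :: "'c \<Rightarrow> 'a" assume c: "c \<in> formal_sums"
  have fin: "finite (support R c)" using c by (simp add: free_module_carrier_iff)
  show "linear_extension R T c \<in> formal_sums"
  proof (rule free_module_supportI[where A = "\<Union>s\<in>support R c. support R (T s)"])
    show "finite (\<Union>s\<in>support R c. support R (T s))"
      using T fin by (auto simp: free_module_carrier_iff)
    show "linear_extension R T c t \<in> carrier R" for t
      unfolding linear_extension_def using c free_module_val[OF T] by (intro add.finprod_closed) auto
    show "t \<in> (\<Union>s\<in>support R c. support R (T s))" if "linear_extension R T c t \<noteq> \<zero>" for t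
    proof (rule ccontr)
      assume "t \<notin> (\<Union>s\<in>support R c. support R (T s))"
      then have "(\<Oplus>s\<in>support R c. c s \<otimes> T s t) = (\<Oplus>s\<in>support R c. \<zero>)"
        using c by (intro add.finprod_cong') (auto simp: support_def)
      then show False using that by (simp add: linear_extension_def)
    qed
  qed auto
next
  fix c e :: "'c \<Rightarrow> 'a" and t
  assume c: "c \<in> formal_sums" and e: "e \<in> formal_sums"
  let ?A = "support R c \<union> support R e"
  have A: "finite ?A" using c e by (simp add: free_module_carrier_iff)
  have T': "\<And>s t. T s t \<in> carrier R" by (rule free_module_val[OF T])
  have "linear_extension R T (\<lambda>s. c s \<oplus> e s) t = (\<Oplus>s\<in>?A. (c s \<oplus> e s) \<otimes> T s t)"
    by (rule linear_extension_eq[OF free_module_add_closed[OF c e] A]) (use T' c e in \<open>auto simp: support_def\<close>)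
  also have "\<dots> = (\<Oplus>s\<in>?A. c s \<otimes> T s t \<oplus> e s \<otimes> T s t)"
    using c e T' by (intro add.finprod_cong') (auto simp: l_distr)
  also have "\<dots> = (\<Oplus>s\<in>?A. c s \<otimes> T s t) \<oplus> (\<Oplus>s\<in>?A. e s \<otimes> T s t)"
    using c e T' by (intro add.finprod_multf) auto
  also have "\<dots> = linear_extension R T c t \<oplus> linear_extension R T e t"
    using linear_extension_eq[OF c A, of T t] linear_extension_eq[OF e A, of T t] T' by simp
  finally show "linear_extension R T (\<lambda>s. c s \<oplus> e s) t = linear_extension R T c t \<oplus> linear_extension R T e t" .
next
  fix k and c :: "'c \<Rightarrow> 'a" and t assume k: "k \<in> carrier R" and c: "c \<in> formal_sums"
  have A: "finite (support R c)" using c by (simp add: free_module_carrier_iff)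
  have T': "\<And>s t. T s t \<in> carrier R" by (rule free_module_val[OF T])
  have "linear_extension R T (\<lambda>s. k \<otimes> c s) t = (\<Oplus>s\<in>support R c. (k \<otimes> c s) \<otimes> T s t)"
    by (rule linear_extension_eq[OF free_module_smult_closed[OF k c] A]) (use T' c k in \<open>auto simp: support_def\<close>)
  also have "\<dots> = (\<Oplus>s\<in>support R c. k \<otimes> (c s \<otimes> T s t))"
    using c k T' by (intro add.finprod_cong') (auto simp: m_assoc)
  also have "\<dots> = k \<otimes> linear_extension R T c t"
    unfolding linear_extension_def using c k T' A by (intro finsum_rdistr[symmetric]) auto
  finally show "linear_extension R T (\<lambda>s. k \<otimes> c s) t = k \<otimes> linear_extension R T c t" .
qed

lemma linear_extension_basis:
  assumes T: "\<And>s. T s \<in> formal_sums"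
  shows "linear_extension R T (basis_chain R s) = T s"
proof
  fix t
  have T': "\<And>s t. T s t \<in> carrier R" by (rule free_module_val[OF T])
  have "linear_extension R T (basis_chain R s) t = (\<Oplus>u\<in>{s}. basis_chain R s u \<otimes> T u t)"
    by (rule linear_extension_eq[OF basis_chain_all])
      (use T' in \<open>auto simp: support_def basis_chain_def split: if_splits\<close>)
  then show "linear_extension R T (basis_chain R s) t = T s t"
    using T' by (simp add: basis_chain_def)
qed

section \<open>Simplicial operators on formal sums of tuples\<close>

text \<open>
  The linear map that puts \<open>x\<close> in front of every tuple.
\<close>
definition cone :: "'x \<Rightarrow> ('x list \<Rightarrow> 'a) \<Rightarrow> 'x list \<Rightarrow> 'a" where
  "cone x c = (\<lambda>ys. case ys of [] \<Rightarrow> \<zero> | y # zs \<Rightarrow> if y = x then c zs else \<zero>)"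

lemma cone_simps [simp]:
  "cone x c [] = \<zero>" "cone x c (y # zs) = (if y = x then c zs else \<zero>)"
  by (simp_all add: cone_def)

lemma cone_basis: "cone x (basis_chain R ys) = basis_chain R (x # ys)"
  by (auto simp: cone_def basis_chain_def fun_eq_iff split: list.split)

lemma cone_lin: "cone x \<in> lin R"
proof (rule linI)
  fix c :: "'c list \<Rightarrow> 'a" assume c: "c \<in> formal_sums"
  show "cone x c \<in> formal_sums"
  proof (rule free_module_supportI[where A = "(#) x ` support R c"])
    show "finite ((#) x ` support R c)" using c by (simp add: free_module_carrier_iff)
    show "cone x c s \<in> carrier R" for s using c by (cases s) auto
    show "s \<in> (#) x ` support R c" if "cone x c s \<noteq> \<zero>" for s
      using that by (cases s) (auto simp: support_def split: if_splits)
  qed auto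
next
  fix c e :: "'c list \<Rightarrow> 'a" and s show "cone x (\<lambda>s. c s \<oplus> e s) s = cone x c s \<oplus> cone x e s"
    by (cases s) auto
next
  fix k and c :: "'c list \<Rightarrow> 'a" and s assume "k \<in> carrier R"
  then show "cone x (\<lambda>s. k \<otimes> c s) s = k \<otimes> cone x c s"
    by (cases s) auto
qed

text \<open>
  The alternating sum of the faces of a tuple: the first face is \<open>xs\<close>, the others keep \<open>x\<close>. The empty
  tuple is a basis element like any other and is the boundary of a singleton; without this
  augmentation the recursion would fail for tuples of length two.
\<close>
fun tuple_bdry :: "'x list \<Rightarrow> 'x list \<Rightarrow> 'a" where
  "tuple_bdry [] = (\<lambda>ys. \<zero>)"
| "tuple_bdry (x # xs) = (\<lambda>ys. basis_chain R xs ys \<ominus> cone x (tuple_bdry xs) ys)"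

text \<open>
  The alternating sum over \<open>i\<close> of the tuples \<open>(f x_0, ..., f x_i, g x_i, ..., g x_n)\<close>; the summand for
  \<open>i = 0\<close> is split off.
\<close>
fun tuple_prism :: "('x \<Rightarrow> 'y) \<Rightarrow> ('x \<Rightarrow> 'y) \<Rightarrow> 'x list \<Rightarrow> 'y list \<Rightarrow> 'a" where
  "tuple_prism f g [] = (\<lambda>ys. \<zero>)"
| "tuple_prism f g (x # xs) =
     (\<lambda>ys. basis_chain R (f x # map g (x # xs)) ys \<ominus> cone (f x) (tuple_prism f g xs) ys)"

definition "aug_bdry = linear_extension R tuple_bdry"
definition "aug_map f = linear_extension R (\<lambda>xs. basis_chain R (map f xs))"
definition "aug_prism f g = linear_extension R (tuple_prism f g)"

lemma tuple_bdry_closed: "tuple_bdry xs \<in> formal_sums"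
  by (induction xs) (auto simp: free_module_zero_closed intro: free_module_minus_closed lin_closed[OF cone_lin])

lemma tuple_prism_closed: "tuple_prism f g xs \<in> formal_sums"
  by (induction xs) (auto simp: free_module_zero_closed intro!: free_module_minus_closed lin_closed[OF cone_lin])

lemma aug_lin: "aug_bdry \<in> lin R" "aug_map f \<in> lin R" "aug_prism f g \<in> lin R"
  unfolding aug_bdry_def aug_map_def aug_prism_def
  by (auto intro!: linear_extension_lin simp: tuple_bdry_closed tuple_prism_closed)

lemma aug_basis:
  "aug_bdry (basis_chain R xs) = tuple_bdry xs"
  "aug_map f (basis_chain R xs) = basis_chain R (map f xs)"
  "aug_prism f g (basis_chain R xs) = tuple_prism f g xs"
  unfolding aug_bdry_def aug_map_def aug_prism_def
  by (auto intro!: linear_extension_basis simp: tuple_bdry_closed tuple_prism_closed)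

lemma aug_bdry_cone:
  assumes "c \<in> formal_sums"
  shows "aug_bdry (cone x c) = (\<lambda>ys. c ys \<ominus> cone x (aug_bdry c) ys)"
proof -
  have id: "(\<lambda>c. c) \<in> lin R" by (auto simp: module_homs_def)
  show ?thesis
    by (rule lin_eqI[where h = "\<lambda>c. aug_bdry (cone x c)" and h' = "\<lambda>c ys. c ys \<ominus> cone x (aug_bdry c) ys",
          OF lin_compose[OF cone_lin aug_lin(1)] lin_diff[OF id lin_compose[OF aug_lin(1) cone_lin]] _ assms])
      (simp add: cone_basis aug_basis)
qed

lemma aug_map_cone:
  assumes "c \<in> formal_sums"
  shows "aug_map f (cone x c) = cone (f x) (aug_map f c)"
  by (rule lin_eqI[where h = "\<lambda>c. aug_map f (cone x c)" and h' = "\<lambda>c. cone (f x) (aug_map f c)",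
        OF lin_compose[OF cone_lin aug_lin(2)] lin_compose[OF aug_lin(2) cone_lin] _ assms])
    (simp add: cone_basis aug_basis)

lemma aug_prism_cone:
  assumes "c \<in> formal_sums"
  shows "aug_prism f g (cone x c) =
    (\<lambda>ys. cone (f x) (cone (g x) (aug_map g c)) ys \<ominus> cone (f x) (aug_prism f g c) ys)"
  by (rule lin_eqI[where h = "\<lambda>c. aug_prism f g (cone x c)" and
        h' = "\<lambda>c ys. cone (f x) (cone (g x) (aug_map g c)) ys \<ominus> cone (f x) (aug_prism f g c) ys",
        OF lin_compose[OF cone_lin aug_lin(3)]
          lin_diff[OF lin_compose[OF lin_compose[OF aug_lin(2) cone_lin] cone_lin]
            lin_compose[OF aug_lin(3) cone_lin]] _ assms])
    (simp add: cone_basis aug_basis)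

lemma zero_lin: "(\<lambda>c s. \<zero>) \<in> lin R"
  by (rule linI) (auto simp: free_module_zero_closed)

text \<open>
  The inductive step is \<open>\<partial>\<partial>(x\<cdot>c) = \<partial>c - \<partial>(x\<cdot>\<partial>c) = \<partial>c - (\<partial>c - x\<cdot>\<partial>\<partial>c) = 0\<close>.
\<close>
lemma aug_bdry_bdry:
  assumes "c \<in> formal_sums"
  shows "aug_bdry (aug_bdry c) = (\<lambda>ys. \<zero>)"
proof -
  have basis: "aug_bdry (aug_bdry (basis_chain R xs)) = (\<lambda>ys. \<zero>)" for xs :: "'c list"
  proof (induction xs)
    case Nil
    then show ?case by (simp add: aug_basis lin_zero[OF aug_lin(1)])
  next
    case (Cons x xs)
    let ?d = "aug_bdry (basis_chain R xs)"
    have d: "?d \<in> formal_sums" by (simp add: lin_closed aug_lin)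
    have cd: "cone x ?d \<in> formal_sums" by (rule lin_closed[OF cone_lin d])
    have "aug_bdry (basis_chain R (x # xs)) = (\<lambda>ys. basis_chain R xs ys \<ominus> cone x ?d ys)"
      using aug_bdry_cone[OF basis_chain_all, of x xs] by (simp add: cone_basis)
    then have "aug_bdry (aug_bdry (basis_chain R (x # xs))) =
        (\<lambda>ys. ?d ys \<ominus> (?d ys \<ominus> cone x (aug_bdry ?d) ys))"
      using lin_minus[OF aug_lin(1) basis_chain_all cd] aug_bdry_cone[OF d] by simp
    also have "\<dots> = (\<lambda>ys. \<zero>)"
      using d by (simp add: Cons lin_zero[OF cone_lin] a_minus_def r_neg)
    finally show ?case .
  qed
  show ?thesis
    by (rule lin_eqI[where h = "\<lambda>c. aug_bdry (aug_bdry c)" and h' = "\<lambda>c s. \<zero>",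
          OF lin_compose[OF aug_lin(1) aug_lin(1)] zero_lin basis assms])
qed

lemma aug_map_bdry:
  assumes "c \<in> formal_sums"
  shows "aug_map f (aug_bdry c) = aug_bdry (aug_map f c)"
proof -
  have basis: "aug_map f (aug_bdry (basis_chain R xs)) = aug_bdry (aug_map f (basis_chain R xs))" for xs :: "'c list"
  proof (induction xs)
    case Nil
    then show ?case by (simp add: aug_basis lin_zero[OF aug_lin(2)])
  next
    case (Cons x xs)
    let ?d = "aug_bdry (basis_chain R xs)"
    have d: "?d \<in> formal_sums" by (simp add: lin_closed aug_lin)
    have cd: "cone x ?d \<in> formal_sums" by (rule lin_closed[OF cone_lin d])
    have "aug_bdry (basis_chain R (x # xs)) = (\<lambda>ys. basis_chain R xs ys \<ominus> cone x ?d ys)"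
      using aug_bdry_cone[OF basis_chain_all, of x xs] by (simp add: cone_basis)
    then have "aug_map f (aug_bdry (basis_chain R (x # xs))) =
        (\<lambda>ys. basis_chain R (map f xs) ys \<ominus> cone (f x) (aug_map f ?d) ys)"
      using lin_minus[OF aug_lin(2)[of f] basis_chain_all cd, of xs] aug_map_cone[OF d, of f x] by (simp add: aug_basis(2))
    then show ?case using Cons by (simp add: aug_basis)
  qed
  show ?thesis
    by (rule lin_eqI[where h = "\<lambda>c. aug_map f (aug_bdry c)" and h' = "\<lambda>c. aug_bdry (aug_map f c)",
          OF lin_compose[OF aug_lin(1) aug_lin(2)] lin_compose[OF aug_lin(2) aug_lin(1)] basis assms])
qed

text \<open>
  In the inductive step the recursions give
    \<open>h\<partial>(x\<cdot>c) = h c - f x\<cdot>g x\<cdot>g \<partial>c + f x\<cdot>h \<partial>c\<close> and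
    \<open>\<partial>h(x\<cdot>c) = g x\<cdot>g c - f x\<cdot>g c + f x\<cdot>g x\<cdot>\<partial> g c - h c + f x\<cdot>\<partial>h c\<close>.
  As \<open>g\<close> commutes with \<open>\<partial>\<close>, the sum is \<open>g x\<cdot>g c - f x\<cdot>g c + f x\<cdot>(h\<partial> + \<partial>h) c\<close>, and by induction this is
  \<open>g x\<cdot>g c - f x\<cdot>f c\<close>.
\<close>
lemma aug_prism_homotopy:
  assumes "c \<in> formal_sums"
  shows "(\<lambda>ys. aug_prism f g (aug_bdry c) ys \<oplus> aug_bdry (aug_prism f g c) ys) =
    (\<lambda>ys. aug_map g c ys \<ominus> aug_map f c ys)"
proof -
  have basis: "(\<lambda>ys. aug_prism f g (aug_bdry (basis_chain R xs)) ys \<oplus>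
        aug_bdry (aug_prism f g (basis_chain R xs)) ys) =
      (\<lambda>ys. aug_map g (basis_chain R xs) ys \<ominus> aug_map f (basis_chain R xs) ys)" for xs :: "'c list"
  proof (induction xs)
    case Nil
    then show ?case
      by (simp add: aug_basis lin_zero[OF aug_lin(1)] lin_zero[OF aug_lin(3)] a_minus_def r_neg)
  next
    case (Cons x xs)
    let ?b = "basis_chain R xs"
    let ?d = "aug_bdry ?b" and ?h = "aug_prism f g ?b" and ?f = "aug_map f ?b" and ?g = "aug_map g ?b"
    have cl: "?d \<in> formal_sums" "?h \<in> formal_sums" "?g \<in> formal_sums"
        "?f \<in> formal_sums"
      by (simp_all add: lin_closed aug_lin)
    have cl2: "aug_map g ?d \<in> formal_sums" "aug_prism f g ?d \<in> formal_sums"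
        "aug_bdry ?h \<in> formal_sums" "aug_bdry ?g \<in> formal_sums"
      using cl by (simp_all add: lin_closed aug_lin)
    have cc: "cone a c \<in> formal_sums" if "c \<in> formal_sums" for a and c :: "'d list \<Rightarrow> 'a"
      by (rule lin_closed[OF cone_lin that])
    have cc': "cone a c \<in> formal_sums" if "c \<in> formal_sums" for a and c :: "'c list \<Rightarrow> 'a"
      by (rule lin_closed[OF cone_lin that])
    have b: "basis_chain R (x # xs) = cone x ?b" by (simp add: cone_basis)
    have hd: "aug_prism f g (aug_bdry (cone x ?b)) =
        (\<lambda>ys. ?h ys \<ominus> (cone (f x) (cone (g x) (aug_map g ?d)) ys \<ominus> cone (f x) (aug_prism f g ?d) ys))"
      using aug_bdry_cone[OF basis_chain_all, of x xs] lin_minus[OF aug_lin(3)[of f g] basis_chain_all cc'[OF cl(1)], of xs x]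
        aug_prism_cone[OF cl(1), of f g x] by simp
    have dcc: "aug_bdry (cone (f x) (cone (g x) ?g)) =
        (\<lambda>ys. cone (g x) ?g ys \<ominus> (cone (f x) ?g ys \<ominus> cone (f x) (cone (g x) (aug_bdry ?g)) ys))"
      using aug_bdry_cone[OF cc[OF cl(3)], of "f x" "g x"] aug_bdry_cone[OF cl(3), of "g x"]
        lin_minus[OF cone_lin[of "f x"] cl(3) cc[OF cl2(4)], of "g x"] by simp
    have dh: "aug_bdry (aug_prism f g (cone x ?b)) =
        (\<lambda>ys. (cone (g x) ?g ys \<ominus> (cone (f x) ?g ys \<ominus> cone (f x) (cone (g x) (aug_bdry ?g)) ys))
           \<ominus> (?h ys \<ominus> cone (f x) (aug_bdry ?h) ys))"
      using aug_prism_cone[OF basis_chain_all, of f g x xs]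
        lin_minus[OF aug_lin(1) cc[OF cc[OF cl(3)]] cc[OF cl(2)], of "f x" "g x" "f x"] dcc
        aug_bdry_cone[OF cl(2), of "f x"] by simp
    have gd: "aug_map g ?d = aug_bdry ?g" by (rule aug_map_bdry) simp
    have ih: "cone (f x) (\<lambda>ys. aug_prism f g ?d ys \<oplus> aug_bdry ?h ys) = cone (f x) (\<lambda>ys. ?g ys \<ominus> ?f ys)"
      using Cons by simp
    have ih': "cone (f x) (aug_prism f g ?d) ys \<oplus> cone (f x) (aug_bdry ?h) ys =
        cone (f x) ?g ys \<ominus> cone (f x) ?f ys" for ys
      using ih lin_add[OF cone_lin cl2(2,3)] lin_minus[OF cone_lin cl(3,4)] by (metis (mono_tags, lifting))
    show ?case
    proof
      fix ys
      have v: "?h ys \<in> carrier R" "cone (f x) (cone (g x) (aug_bdry ?g)) ys \<in> carrier R"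
        "cone (f x) (aug_prism f g ?d) ys \<in> carrier R" "cone (f x) (aug_bdry ?h) ys \<in> carrier R"
        "cone (g x) ?g ys \<in> carrier R" "cone (f x) ?g ys \<in> carrier R" "cone (f x) ?f ys \<in> carrier R"
        using cl cl2 by (meson cc free_module_val)+
      have alg: "(h \<ominus> (p \<ominus> q)) \<oplus> ((a \<ominus> (b \<ominus> p)) \<ominus> (h \<ominus> s)) = a \<ominus> b \<oplus> (q \<oplus> s)"
        if "h \<in> carrier R" "p \<in> carrier R" "q \<in> carrier R" "a \<in> carrier R" "b \<in> carrier R" "s \<in> carrier R"
        for h p q a b s
        using that by algebra
      have alg2: "a \<ominus> b \<oplus> (b \<ominus> e) = a \<ominus> e"
        if "e \<in> carrier R" "a \<in> carrier R" "b \<in> carrier R" for a b e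
        using that by algebra
      show "aug_prism f g (aug_bdry (basis_chain R (x # xs))) ys \<oplus>
          aug_bdry (aug_prism f g (basis_chain R (x # xs))) ys =
        aug_map g (basis_chain R (x # xs)) ys \<ominus> aug_map f (basis_chain R (x # xs)) ys"
        unfolding b hd dh aug_map_cone[OF basis_chain_all] gd alg[OF v(1,2,3,5,6,4)] ih'
        by (rule alg2[OF v(7,5,6)])
    qed
  qed
  show ?thesis
    by (rule lin_eqI[where h = "\<lambda>c ys. aug_prism f g (aug_bdry c) ys \<oplus> aug_bdry (aug_prism f g c) ys"
          and h' = "\<lambda>c ys. aug_map g c ys \<ominus> aug_map f c ys",
          OF lin_plus[OF lin_compose[OF aug_lin(1) aug_lin(3)] lin_compose[OF aug_lin(3) aug_lin(1)]]
            lin_diff[OF aug_lin(2) aug_lin(2)] basis assms])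
qed

end

section \<open>Tuples and their lengths\<close>

lemma tuple_length_simps [simp]:
  "tuple_length X [] = 0" "tuple_length X [x] = 0"
  "tuple_length X (x # y # zs) = Dist X x y + tuple_length X (y # zs)"
proof -
  have "tuple_length X (x # y # zs) = (\<Sum>i<Suc (length zs). Dist X ((x # y # zs) ! i) ((y # zs) ! i))"
    by (simp add: tuple_length_def)
  also have "\<dots> = Dist X x y + (\<Sum>i<length zs. Dist X ((y # zs) ! i) (zs ! i))"
    by (subst sum.lessThan_Suc_shift) simp
  finally show "tuple_length X (x # y # zs) = Dist X x y + tuple_length X (y # zs)"
    by (simp add: tuple_length_def)
qed (simp_all add: tuple_length_def)

lemma successively_finite_iff:
  "successively (\<lambda>x y. Dist X x y < \<infinity>) xs \<longleftrightarrow> tuple_length X xs < \<infinity>"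
  by (induction xs rule: induct_list012) (auto simp: top_unique less_top)

lemma reach_tuples_iff:
  "xs \<in> reach_tuples X n \<longleftrightarrow> xs \<noteq> [] \<and> int (length xs) = n + 1 \<and> set xs \<subseteq> Pts X \<and>
     distinct_adj xs \<and> tuple_length X xs < \<infinity>"
  unfolding reach_tuples_def successively_finite_iff by blast

definition level_tuples :: "'x qspace \<Rightarrow> real \<Rightarrow> int \<Rightarrow> 'x list set" where
  "level_tuples X s n = {xs \<in> reach_tuples X n. enn2ereal (tuple_length X xs) \<le> ereal s}"

lemma RC_simps [simp]:
  "chain (RC K X) n = free_module K (reach_tuples X n)"
  "bdry (RC K X) n = reach_bdry K"
  "filt (RC K X) s n = carrier (free_module K (level_tuples X s n))"
  by (simp_all add: RC_def level_tuples_def)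

lemma level_tuples_subset: "level_tuples X s n \<subseteq> reach_tuples X n"
  by (auto simp: level_tuples_def)

lemma tuple_length_tail: "tuple_length X zs \<le> tuple_length X (y # zs)"
  by (cases zs) (auto intro: add_increasing)

lemma short_mapsD:
  assumes "f \<in> short_maps X Y"
  shows "x \<in> Pts X \<Longrightarrow> f x \<in> Pts Y"
    and "x \<in> Pts X \<Longrightarrow> y \<in> Pts X \<Longrightarrow> Dist Y (f x) (f y) \<le> Dist X x y"
  using assms by (auto simp: short_maps_def)

lemma tuple_length_map:
  assumes "f \<in> short_maps X Y" "set xs \<subseteq> Pts X"
  shows "tuple_length Y (map f xs) \<le> tuple_length X xs"
  using assms(2)
  by (induction xs rule: induct_list012) (auto intro!: add_mono short_mapsD(2)[OF assms(1)])

context cring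
begin

lemma tuple_bdry_cases:
  assumes "tuple_bdry (y # zs) ys \<noteq> \<zero>"
  obtains "ys = zs" | ws where "ys = y # ws" "tuple_bdry zs ws \<noteq> \<zero>"
proof (cases "ys = zs")
  case False
  then have "cone y (tuple_bdry zs) ys \<noteq> \<zero>"
    using assms by (auto simp: basis_chain_def a_minus_def)
  then show ?thesis
    using that(2) by (cases ys) (auto split: if_splits)
qed

text \<open>
  Omitting an entry does not increase the length, by the triangle inequality. The last conjunct, with
  a further point in front, is what the induction needs: omitting a later entry of \<open>y # zs\<close> compares
  two tuples that both start with \<open>y\<close>.
\<close>
lemma tuple_bdry_support:
  assumes X: "quasimetric X"
  shows "set xs \<subseteq> Pts X \<Longrightarrow> tuple_bdry xs ys \<noteq> \<zero> \<Longrightarrow>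
     set ys \<subseteq> set xs \<and> length xs = Suc (length ys) \<and>
     tuple_length X ys \<le> tuple_length X xs \<and>
     (\<forall>x\<in>Pts X. tuple_length X (x # ys) \<le> tuple_length X (x # xs))"
proof (induction xs arbitrary: ys)
  case (Cons y zs)
  have tri: "Dist X a c \<le> Dist X a b + Dist X b c" if "a \<in> Pts X" "b \<in> Pts X" "c \<in> Pts X" for a b c
    using X that by (auto simp: quasimetric_def)
  from Cons.prems(2) show ?case
  proof (cases rule: tuple_bdry_cases)
    case 1
    have "tuple_length X (x # zs) \<le> tuple_length X (x # y # zs)" if "x \<in> Pts X" for x
    proof (cases zs)
      case (Cons z ws)
      then have "Dist X x z \<le> Dist X x y + Dist X y z"
        using tri that Cons.prems(1) by auto
      then show ?thesis using Cons by (auto simp: add.assoc[symmetric] intro: add_right_mono)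
    qed auto
    then show ?thesis using 1 tuple_length_tail by auto
  next
    case (2 ws)
    have "set zs \<subseteq> Pts X" and y: "y \<in> Pts X" using Cons.prems(1) by auto
    then have IH: "set ws \<subseteq> set zs" "length zs = Suc (length ws)"
        "\<forall>x\<in>Pts X. tuple_length X (x # ws) \<le> tuple_length X (x # zs)"
      using Cons.IH 2(2) by blast+
    then show ?thesis using 2(1) y by (auto intro: add_left_mono)
  qed
qed simp

text \<open>
  Besides the distances that \<open>f\<close> and \<open>g\<close> do not increase there is one step from \<open>f x_i\<close> to \<open>g x_i\<close>. The
  head of \<open>ys\<close> is recorded because the next step of the induction adds the distance to it.
\<close>
lemma tuple_prism_support:
  assumes f: "f \<in> short_maps X Y" and g: "g \<in> short_maps X Y"
    and r: "\<And>x. x \<in> Pts X \<Longrightarrow> Dist Y (f x) (g x) \<le> r"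
  shows "set xs \<subseteq> Pts X \<Longrightarrow> tuple_prism f g xs ys \<noteq> \<zero> \<Longrightarrow>
     set ys \<subseteq> Pts Y \<and> length ys = Suc (length xs) \<and> hd ys = f (hd xs) \<and>
     tuple_length Y ys \<le> tuple_length X xs + r"
proof (induction xs arbitrary: ys)
  case (Cons x xs)
  have x: "x \<in> Pts X" and xs: "set xs \<subseteq> Pts X" using Cons.prems(1) by auto
  show ?case
  proof (cases "ys = f x # map g (x # xs)")
    case True
    have "tuple_length Y ys = Dist Y (f x) (g x) + tuple_length Y (map g (x # xs))"
      using True by simp
    also have "\<dots> \<le> r + tuple_length X (x # xs)"
      by (intro add_mono r x tuple_length_map[OF g] Cons.prems(1))
    finally have "tuple_length Y ys \<le> tuple_length X (x # xs) + r" by (simp add: add.commute)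
    then show ?thesis
      using True short_mapsD(1)[OF f] short_mapsD(1)[OF g] Cons.prems(1) by (auto simp: subset_iff)
  next
    case False
    then have "cone (f x) (tuple_prism f g xs) ys \<noteq> \<zero>"
      using Cons.prems(2) by (auto simp: basis_chain_def a_minus_def)
    then obtain ws where ys: "ys = f x # ws" "tuple_prism f g xs ws \<noteq> \<zero>"
      by (cases ys) (auto split: if_splits)
    then have IH: "set ws \<subseteq> Pts Y" "length ws = Suc (length xs)" "hd ws = f (hd xs)"
        "tuple_length Y ws \<le> tuple_length X xs + r"
      using Cons.IH[OF xs] by blast+
    obtain y vs where xs': "xs = y # vs"
      using ys(2) by (cases xs) auto
    obtain us where ws: "ws = f y # us"
      using IH xs' by (cases ws) auto
    have "tuple_length Y ys = Dist Y (f x) (f y) + tuple_length Y ws"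
      using ys ws by simp
    also have "\<dots> \<le> Dist X x y + (tuple_length X xs + r)"
      by (intro add_mono short_mapsD(2)[OF f] x IH(4)) (use xs xs' in auto)
    also have "\<dots> = tuple_length X (x # xs) + r"
      using xs' by (simp add: add.assoc)
    finally show ?thesis
      using ys IH short_mapsD(1)[OF f x] by auto
  qed
qed simp

section \<open>Normalisation\<close>

definition normal_tuple :: "'x list \<Rightarrow> bool" where
  "normal_tuple xs \<longleftrightarrow> xs \<noteq> [] \<and> distinct_adj xs"

text \<open>
  The projection to chains of nonempty tuples without consecutive repetitions. The operators of the
  reachability complex arise by applying it after the augmented ones.
\<close>
definition normalised :: "('x list \<Rightarrow> 'a) \<Rightarrow> 'x list \<Rightarrow> 'a" where
  "normalised c = (\<lambda>xs. if normal_tuple xs then c xs else \<zero>)"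

lemma normalised_lin: "normalised \<in> lin R"
proof (rule linI)
  fix c :: "'c list \<Rightarrow> 'a" assume c: "c \<in> formal_sums"
  show "normalised c \<in> formal_sums"
    by (rule free_module_supportI[where A = "support R c"])
      (use c in \<open>auto simp: free_module_carrier_iff normalised_def support_def split: if_splits\<close>)
qed (auto simp: normalised_def)

lemma normalised_basis: "normalised (basis_chain R xs) = tuple_chain R xs"
  by (auto simp: normalised_def normal_tuple_def basis_chain_def tuple_chain_def fun_eq_iff)

lemma normalised_basis':
  "normalised (basis_chain R xs) = (if normal_tuple xs then basis_chain R xs else (\<lambda>ys. \<zero>))"
  by (auto simp: normalised_def basis_chain_def fun_eq_iff)

lemma normalised_reach:
  assumes "c \<in> carrier (free_module R (reach_tuples X n))"
  shows "normalised c = c"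
proof
  fix xs
  have "normal_tuple xs" if "c xs \<noteq> \<zero>"
    using assms that by (auto simp: free_module_carrier_iff reach_tuples_iff normal_tuple_def)
  then show "normalised c xs = c xs" by (cases "c xs = \<zero>") (auto simp: normalised_def)
qed

text \<open>
  An operator that sends the projected-away tuples to projected-away chains descends to the
  normalised chains, so intermediate projections may be dropped.
\<close>
lemma normalised_absorb:
  assumes h: "h \<in> lin R" and bad: "\<And>xs. \<not> normal_tuple xs \<Longrightarrow> normalised (h (basis_chain R xs)) = (\<lambda>ys. \<zero>)"
    and c: "c \<in> formal_sums"
  shows "normalised (h (normalised c)) = normalised (h c)"
  by (rule lin_eqI[where h = "\<lambda>c. normalised (h (normalised c))" and h' = "\<lambda>c. normalised (h c)",
        OF lin_compose[OF lin_compose[OF normalised_lin h] normalised_lin] lin_compose[OF h normalised_lin] _ c])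
    (simp add: normalised_basis' bad lin_zero[OF h] lin_zero[OF normalised_lin])

text \<open>
  If the repetition is at the start, the first two faces cancel and the others start with the
  repeated entry; otherwise it survives in the first face, and induction applies to the rest. The
  conclusion includes \<open>ys = []\<close>, which the induction needs, since putting \<open>x\<close> in front of the empty
  tuple gives a nondegenerate one.
\<close>
lemma tuple_bdry_degenerate:
  "\<not> distinct_adj xs \<Longrightarrow> distinct_adj ys \<Longrightarrow> tuple_bdry xs ys = \<zero>"
proof (induction xs arbitrary: ys)
  case (Cons x xs)
  obtain y zs where xs: "xs = y # zs" using Cons.prems(1) by (cases xs) auto
  show ?case
  proof (cases "x = y")
    case True
    show ?thesis
    proof (cases ys)
      case Nil
      then show ?thesis using xs by (simp add: basis_chain_def a_minus_def)
    next
      case (Cons w ws)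
      have "cone x (tuple_bdry zs) ws = \<zero>" if "w = x"
        using Cons.prems(2) that Cons by (cases ws) auto
      moreover have "basis_chain R (x # zs) (w # ws) = (if w = x then basis_chain R zs ws else \<zero>)"
        by (auto simp: basis_chain_def)
      ultimately show ?thesis
        using Cons xs True by (auto simp: a_minus_def r_neg)
    qed
  next
    case False
    then have deg: "\<not> distinct_adj xs" using Cons.prems(1) xs by auto
    then have "basis_chain R xs ys = \<zero>" using Cons.prems(2) by (auto simp: basis_chain_def)
    moreover have "cone x (tuple_bdry xs) ys = \<zero>"
      using Cons.IH[OF deg] Cons.prems(2) by (cases ys) (auto dest: distinct_adj_ConsD)
    ultimately show ?thesis by (simp add: a_minus_def)
  qed
qed simp

text \<open>
  For a repetition \<open>x, x\<close> at the start the summands contain \<open>g x, g x\<close> or \<open>f x, f x\<close>; a later repetition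
  is preserved by \<open>g\<close> in the first summand and treated by induction in the others.
\<close>
lemma tuple_prism_degenerate:
  "\<not> distinct_adj xs \<Longrightarrow> distinct_adj ys \<Longrightarrow> tuple_prism f g xs ys = \<zero>"
proof (induction xs arbitrary: ys)
  case (Cons x xs)
  obtain y zs where xs: "xs = y # zs" using Cons.prems(1) by (cases xs) auto
  have b: "basis_chain R (f x # map g (x # xs)) ys = \<zero>"
  proof -
    have "\<not> distinct_adj (f x # map g (x # xs))"
    proof
      assume "distinct_adj (f x # map g (x # xs))"
      then have "distinct_adj (map g (x # xs))" by (auto dest: distinct_adj_ConsD)
      then show False using Cons.prems(1) by (meson distinct_adj_mapD)
    qed
    then show ?thesis using Cons.prems(2) by (auto simp: basis_chain_def)
  qed
  have "cone (f x) (tuple_prism f g xs) ys = \<zero>"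
  proof (cases "x = y")
    case True
    show ?thesis
    proof (cases ys)
      case (Cons w ws)
      have "tuple_prism f g xs ws = \<zero>" if "w = f x"
      proof -
        have nd: "ws = [] \<or> hd ws \<noteq> f x" using Cons.prems(2) Cons that by (cases ws) auto
        then have "basis_chain R (f y # map g (y # zs)) ws = \<zero>"
          using True by (auto simp: basis_chain_def)
        moreover have "cone (f y) (tuple_prism f g zs) ws = \<zero>"
          using nd True by (cases ws) auto
        ultimately show ?thesis using xs by (simp add: a_minus_def)
      qed
      then show ?thesis using Cons by simp
    qed simp
  next
    case False
    then have deg: "\<not> distinct_adj xs" using Cons.prems(1) xs by auto
    then show ?thesis
      using Cons.IH[OF deg] Cons.prems(2) by (cases ys) (auto dest: distinct_adj_ConsD)
  qed
  then show ?case using b by (simp add: a_minus_def)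
qed simp

lemma normalised_absorb_aug:
  assumes "c \<in> formal_sums"
  shows "normalised (aug_bdry (normalised c)) = normalised (aug_bdry c)"
    and "normalised (aug_map f (normalised c)) = normalised (aug_map f c)"
    and "normalised (aug_prism f g (normalised c)) = normalised (aug_prism f g c)"
proof -
  show "normalised (aug_bdry (normalised c)) = normalised (aug_bdry c)"
    by (rule normalised_absorb[OF aug_lin(1) _ assms])
      (auto simp: aug_basis normal_tuple_def normalised_def fun_eq_iff tuple_bdry_degenerate)
  show "normalised (aug_map f (normalised c)) = normalised (aug_map f c)"
    by (rule normalised_absorb[OF aug_lin(2) _ assms])
      (auto simp: aug_basis normalised_basis' normal_tuple_def dest: distinct_adj_mapD)
  show "normalised (aug_prism f g (normalised c)) = normalised (aug_prism f g c)"
    by (rule normalised_absorb[OF aug_lin(3) _ assms])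
      (auto simp: aug_basis normal_tuple_def normalised_def fun_eq_iff tuple_prism_degenerate)
qed

lemma alternating_faces:
  "(\<Oplus>i\<in>{..<length xs}. ((\<ominus> \<one>) [^] i) \<otimes> basis_chain R (face i xs) ys) = tuple_bdry xs ys"
proof (induction xs arbitrary: ys)
  case (Cons x xs)
  let ?s = "\<lambda>i. (\<ominus> \<one>) [^] (i :: nat)"
  let ?t = "\<lambda>i. ?s i \<otimes> basis_chain R (face i (x # xs)) ys"
  have cl: "?s i \<in> carrier R" for i by simp
  have "(\<Oplus>i\<in>{..<length (x # xs)}. ?t i) = (\<Oplus>i\<in>insert 0 (Suc ` {..<length xs}). ?t i)"
    by (simp add: lessThan_Suc_eq_insert_0)
  also have "\<dots> = ?t 0 \<oplus> (\<Oplus>i\<in>Suc ` {..<length xs}. ?t i)"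
    by (rule finsum_insert) auto
  also have "(\<Oplus>i\<in>Suc ` {..<length xs}. ?t i) = (\<Oplus>i\<in>{..<length xs}. ?t (Suc i))"
    by (rule finsum_reindex) auto
  also have "\<dots> = (\<Oplus>i\<in>{..<length xs}. (\<ominus> \<one>) \<otimes> (?s i \<otimes> cone x (basis_chain R (face i xs)) ys))"
  proof (intro add.finprod_cong' refl Pi_I)
    fix i
    have "cone x (basis_chain R (face i xs)) ys \<in> carrier R" by (simp add: cone_basis)
    then show "(\<ominus> \<one>) \<otimes> (?s i \<otimes> cone x (basis_chain R (face i xs)) ys) \<in> carrier R" by simp
    have "face (Suc i) (x # xs) = x # face i xs" by (simp add: face_def)
    then show "?t (Suc i) = (\<ominus> \<one>) \<otimes> (?s i \<otimes> cone x (basis_chain R (face i xs)) ys)"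
      by (simp add: cone_basis m_ac)
  qed
  also have "\<dots> = (\<ominus> \<one>) \<otimes> (\<Oplus>i\<in>{..<length xs}. ?s i \<otimes> cone x (basis_chain R (face i xs)) ys)"
    by (rule finsum_rdistr[symmetric]) (auto simp: cone_basis)
  also have "(\<Oplus>i\<in>{..<length xs}. ?s i \<otimes> cone x (basis_chain R (face i xs)) ys) = cone x (tuple_bdry xs) ys"
  proof (cases ys)
    case Nil
    then show ?thesis by (simp add: finsum_zero)
  next
    case (Cons y zs)
    then show ?thesis using Cons.IH by (simp add: finsum_zero)
  qed
  also have "?t 0 \<oplus> (\<ominus> \<one>) \<otimes> cone x (tuple_bdry xs) ys = tuple_bdry (x # xs) ys"
    using free_module_val[OF lin_closed[OF cone_lin tuple_bdry_closed], of x xs ys]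
    by (simp add: face_def a_minus_def l_minus)
  finally show ?case .
qed simp

text \<open>
  The differential of the reachability complex sets degenerate faces and the empty tuple to zero,
  which is the projection of the alternating sum of all faces.
\<close>
lemma reach_bdry_eq:
  assumes "c \<in> formal_sums"
  shows "reach_bdry R c = normalised (aug_bdry c)"
proof -
  let ?T = "\<lambda>xs ys. \<Oplus>i\<in>{..<length xs}. ((\<ominus> \<one>) [^] i) \<otimes> tuple_chain R (face i xs) ys"
  have T: "?T xs = normalised (tuple_bdry xs)" for xs :: "'c list"
  proof
    fix ys
    have "?T xs ys = (if normal_tuple ys then (\<Oplus>i\<in>{..<length xs}. ((\<ominus> \<one>) [^] i) \<otimes> basis_chain R (face i xs) ys) else \<zero>)"
      unfolding normalised_basis[symmetric] by (simp add: normalised_def finsum_zero)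
    then show "?T xs ys = normalised (tuple_bdry xs) ys"
      by (simp add: alternating_faces normalised_def)
  qed
  have "linear_extension R ?T c = normalised (aug_bdry c)"
    unfolding T
  proof (rule lin_eqI[where h' = "\<lambda>c. normalised (aug_bdry c)",
        OF linear_extension_lin lin_compose[OF aug_lin(1) normalised_lin] _ assms])
    show cl: "normalised (tuple_bdry xs) \<in> formal_sums" for xs :: "'c list"
      by (rule lin_closed[OF normalised_lin tuple_bdry_closed])
    show "linear_extension R (\<lambda>xs. normalised (tuple_bdry xs)) (basis_chain R s) =
        normalised (aug_bdry (basis_chain R s))" for s :: "'c list"
      by (simp add: linear_extension_basis cl aug_basis)
  qed
  then show ?thesis by (simp add: reach_bdry_def)
qed

lemma reach_map_eq:
  assumes "c \<in> formal_sums"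
  shows "reach_map R f n c = normalised (aug_map f c)"
proof -
  have "linear_extension R (\<lambda>xs. tuple_chain R (map f xs)) c = normalised (aug_map f c)"
    unfolding normalised_basis[symmetric]
  proof (rule lin_eqI[where h' = "\<lambda>c. normalised (aug_map f c)",
        OF linear_extension_lin lin_compose[OF aug_lin(2) normalised_lin] _ assms])
    show cl: "normalised (basis_chain R (map f xs)) \<in> formal_sums" for xs
      by (rule lin_closed[OF normalised_lin basis_chain_all])
    show "linear_extension R (\<lambda>xs. normalised (basis_chain R (map f xs))) (basis_chain R s) =
        normalised (aug_map f (basis_chain R s))" for s
      by (simp add: linear_extension_basis cl aug_basis)
  qed
  then show ?thesis by (simp add: reach_map_def)
qed

section \<open>The reachability complex\<close>

lemma reach_tuples_face:
  assumes "quasimetric X" "xs \<in> reach_tuples X n" "normalised (tuple_bdry xs) ys \<noteq> \<zero>"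
  shows "ys \<in> reach_tuples X (n - 1)" "tuple_length X ys \<le> tuple_length X xs"
proof -
  have ys: "normal_tuple ys" "tuple_bdry xs ys \<noteq> \<zero>"
    using assms(3) by (auto simp: normalised_def split: if_splits)
  have "set xs \<subseteq> Pts X" using assms(2) by (simp add: reach_tuples_iff)
  from tuple_bdry_support[OF assms(1) this ys(2)]
  show "ys \<in> reach_tuples X (n - 1)" "tuple_length X ys \<le> tuple_length X xs"
    using assms(2) ys(1) by (auto simp: reach_tuples_iff normal_tuple_def)
qed

lemma level_tuples_le:
  assumes "xs \<in> level_tuples X s n" "tuple_length Y ys \<le> tuple_length X xs" "ys \<in> reach_tuples Y m"
  shows "ys \<in> level_tuples Y s m"
  using assms order_trans[of "enn2ereal (tuple_length Y ys)"]
  by (auto simp: level_tuples_def less_eq_ennreal.rep_eq)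

lemma reach_bdry_hom:
  assumes "\<And>xs ys. xs \<in> S \<Longrightarrow> normalised (tuple_bdry xs) ys \<noteq> \<zero> \<Longrightarrow> ys \<in> T"
  shows "reach_bdry R \<in> module_homs R (free_module R S) (free_module R T)"
  using lin_free_hom[OF lin_compose[OF aug_lin(1) normalised_lin], of S T] assms
    module_homs_cong[OF free_module_is_module, of S "reach_bdry R"] reach_bdry_eq free_module_all
  by (metis (no_types, lifting) aug_basis(1))

lemma reach_map_hom:
  assumes "\<And>xs. xs \<in> S \<Longrightarrow> normal_tuple (map f xs) \<Longrightarrow> map f xs \<in> T"
  shows "reach_map R f n \<in> module_homs R (free_module R S) (free_module R T)"
proof -
  have "(\<lambda>c. normalised (aug_map f c)) \<in> module_homs R (free_module R S) (free_module R T)"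
  proof (rule lin_free_hom[OF lin_compose[OF aug_lin(2) normalised_lin]])
    fix xs ys assume xs: "xs \<in> S" and nz: "normalised (aug_map f (basis_chain R xs)) ys \<noteq> \<zero>"
    have "ys = map f xs \<and> normal_tuple (map f xs)"
    proof (rule ccontr)
      assume "\<not> (ys = map f xs \<and> normal_tuple (map f xs))"
      then have "normalised (aug_map f (basis_chain R xs)) ys = \<zero>"
        unfolding aug_basis(2) normalised_basis' by (auto simp: basis_chain_def)
      then show False using nz by simp
    qed
    then show "ys \<in> T" using assms[OF xs] by simp
  qed
  then show ?thesis
    using module_homs_cong[OF free_module_is_module, of S "reach_map R f n"] reach_map_eq free_module_all
    by (metis (no_types, lifting))
qed

lemma RC_filtered:
  assumes X: "quasimetric X"
  shows "filtered_complex R (RC R X)"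
proof -
  have hom: "reach_bdry R \<in> module_homs R (free_module R (reach_tuples X n)) (free_module R (reach_tuples X (n - 1)))" for n
    by (rule reach_bdry_hom) (rule reach_tuples_face(1)[OF X])
  have hom': "reach_bdry R \<in> module_homs R (free_module R (level_tuples X s n)) (free_module R (level_tuples X s (n - 1)))" for s n
  proof (rule reach_bdry_hom)
    fix xs ys assume xs: "xs \<in> level_tuples X s n" and "normalised (tuple_bdry xs) ys \<noteq> \<zero>"
    then show "ys \<in> level_tuples X s (n - 1)"
      using reach_tuples_face[OF X _ \<open>normalised (tuple_bdry xs) ys \<noteq> \<zero>\<close>] level_tuples_le[OF xs]
        subsetD[OF level_tuples_subset xs] by blast
  qed
  have sq: "reach_bdry R (reach_bdry R c) = (\<lambda>s. \<zero>)" if c: "c \<in> carrier (free_module R (reach_tuples X n))" for c n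
  proof -
    have c': "c \<in> formal_sums" by (rule free_module_all[OF c])
    have d: "aug_bdry c \<in> formal_sums" by (rule lin_closed[OF aug_lin(1) c'])
    have "reach_bdry R (reach_bdry R c) = normalised (aug_bdry (aug_bdry c))"
      by (simp add: reach_bdry_eq[OF c'] reach_bdry_eq[OF lin_closed[OF normalised_lin d]]
          normalised_absorb_aug(1)[OF d])
    then show ?thesis using aug_bdry_bdry[OF c'] lin_zero[OF normalised_lin] by simp
  qed
  have "carrier (free_module R (level_tuples X s n)) \<subseteq> carrier (free_module R (level_tuples X t n))"
    if "s \<le> t" for s t n
    by (rule free_module_carrier_mono)
      (use that order_trans[of _ "ereal s" "ereal t"] in \<open>auto simp: level_tuples_def\<close>)
  then show ?thesis
    using hom sq free_module_is_module free_module_submodule[OF level_tuples_subset] module_homsD(1)[OF hom']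
    unfolding filtered_complex_def is_complex_def subcomplex_def by auto
qed

lemma reach_tuples_map:
  assumes f: "f \<in> short_maps X Y" and xs: "xs \<in> reach_tuples X n" "normal_tuple (map f xs)"
  shows "map f xs \<in> reach_tuples Y n" "tuple_length Y (map f xs) \<le> tuple_length X xs"
proof -
  have s: "set xs \<subseteq> Pts X" using xs(1) by (simp add: reach_tuples_iff)
  show le: "tuple_length Y (map f xs) \<le> tuple_length X xs" by (rule tuple_length_map[OF f s])
  have "set (map f xs) \<subseteq> Pts Y" using short_mapsD(1)[OF f] s by auto
  then show "map f xs \<in> reach_tuples Y n"
    using le xs by (auto simp: reach_tuples_iff normal_tuple_def)
qed

lemma reach_map_filtered:
  assumes f: "f \<in> short_maps X Y"
  shows "filtered_map R (RC R X) (RC R Y) (reach_map R f)"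
proof -
  have hom: "reach_map R f n \<in> module_homs R (free_module R (reach_tuples X n)) (free_module R (reach_tuples Y n))" for n
    by (rule reach_map_hom) (rule reach_tuples_map(1)[OF f])
  have hom': "reach_map R f n \<in> module_homs R (free_module R (level_tuples X s n)) (free_module R (level_tuples Y s n))" for s n
  proof (rule reach_map_hom)
    fix xs assume xs: "xs \<in> level_tuples X s n" and "normal_tuple (map f xs)"
    then show "map f xs \<in> level_tuples Y s n"
      using reach_tuples_map[OF f subsetD[OF level_tuples_subset xs]] level_tuples_le[OF xs] by blast
  qed
  have comm: "reach_map R f m (reach_bdry R c) = reach_bdry R (reach_map R f n c)"
    if c: "c \<in> carrier (free_module R (reach_tuples X n))" for c m n
  proof -
    have c': "c \<in> formal_sums" by (rule free_module_all[OF c])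
    have d: "aug_bdry c \<in> formal_sums" by (rule lin_closed[OF aug_lin(1) c'])
    have e: "aug_map f c \<in> formal_sums" by (rule lin_closed[OF aug_lin(2) c'])
    show ?thesis
      by (simp add: reach_bdry_eq[OF c'] reach_map_eq[OF c'] reach_map_eq[OF lin_closed[OF normalised_lin d]]
          reach_bdry_eq[OF lin_closed[OF normalised_lin e]]
          normalised_absorb_aug(2)[OF d] normalised_absorb_aug(1)[OF e] aug_map_bdry[OF c'])
  qed
  show ?thesis
    using hom module_homsD(1)[OF hom'] comm unfolding filtered_map_def chain_map_def by auto
qed

lemma reach_map_id:
  assumes c: "c \<in> carrier (free_module R (reach_tuples X n))"
  shows "reach_map R (\<lambda>x\<in>Pts X. x) m c = c"
proof -
  have id: "(\<lambda>c. c) \<in> lin R" by (auto simp: module_homs_def)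
  have "aug_map (\<lambda>x\<in>Pts X. x) c = c"
  proof (rule lin_eqI[where h' = "\<lambda>c. c", OF aug_lin(2) id _ c])
    fix xs assume "xs \<in> reach_tuples X n"
    then have "map (\<lambda>x\<in>Pts X. x) xs = xs" by (intro map_idI) (auto simp: reach_tuples_iff)
    then show "aug_map (\<lambda>x\<in>Pts X. x) (basis_chain R xs) = basis_chain R xs" by (simp add: aug_basis)
  qed
  then show ?thesis
    by (simp add: reach_map_eq[OF free_module_all[OF c]] normalised_reach[OF c])
qed

lemma reach_map_compose:
  assumes c: "c \<in> carrier (free_module R (reach_tuples X n))"
  shows "reach_map R (compose (Pts X) g f) m c = reach_map R g m (reach_map R f m c)"
proof -
  have c': "c \<in> formal_sums" by (rule free_module_all[OF c])
  have e: "aug_map f c \<in> formal_sums" by (rule lin_closed[OF aug_lin(2) c'])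
  have "aug_map (compose (Pts X) g f) c = aug_map g (aug_map f c)"
  proof (rule lin_eqI[where h' = "\<lambda>c. aug_map g (aug_map f c)", OF aug_lin(2) lin_compose[OF aug_lin(2) aug_lin(2)] _ c])
    fix xs assume "xs \<in> reach_tuples X n"
    then have "map (compose (Pts X) g f) xs = map g (map f xs)"
      by (auto simp: reach_tuples_iff compose_def subset_iff)
    then show "aug_map (compose (Pts X) g f) (basis_chain R xs) = aug_map g (aug_map f (basis_chain R xs))"
      by (simp only: aug_basis)
  qed
  then show ?thesis
    by (simp add: reach_map_eq[OF c'] reach_map_eq[OF lin_closed[OF normalised_lin e]] normalised_absorb_aug(2)[OF e])
qed

section \<open>Homotopy invariance\<close>

lemma spectral_map_short_dist:
  assumes X: "quasimetric X" and Y: "quasimetric Y"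
    and f: "f \<in> short_maps X Y" and g: "g \<in> short_maps X Y"
    and r: "0 \<le> r" "short_dist X Y f g \<le> ennreal r"
    and I: "I \<noteq> {}" and a: "a \<in> carrier (spectral_homology (RC R X) r n I)"
  shows "spectral_map (RC R Y) r n I (reach_map R f) a = spectral_map (RC R Y) r n I (reach_map R g) a"
proof -
  let ?h = "\<lambda>n :: int. \<lambda>c. normalised (aug_prism f g c)"
  have d: "Dist Y (f x) (g x) \<le> ennreal r" if "x \<in> Pts X" for x
    using r(2) SUP_upper[OF that, of "\<lambda>x. Dist Y (f x) (g x)"] unfolding short_dist_def by (rule order_trans[rotated])
  have lin: "(\<lambda>c. normalised (aug_prism f g c)) \<in> lin R"
    by (rule lin_compose[OF aug_lin(3) normalised_lin])
  have supp: "ys \<in> reach_tuples Y (n + 1) \<and> tuple_length Y ys \<le> tuple_length X xs + ennreal r"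
    if xs: "xs \<in> reach_tuples X n" and "normalised (tuple_prism f g xs) ys \<noteq> \<zero>" for xs ys n
  proof -
    have ys: "normal_tuple ys" "tuple_prism f g xs ys \<noteq> \<zero>"
      using that(2) by (auto simp: normalised_def split: if_splits)
    have "set xs \<subseteq> Pts X" using xs by (simp add: reach_tuples_iff)
    from tuple_prism_support[OF f g d this ys(2)]
    have *: "set ys \<subseteq> Pts Y" "length ys = Suc (length xs)" "tuple_length Y ys \<le> tuple_length X xs + ennreal r"
      by auto
    have "tuple_length X xs + ennreal r < \<infinity>" using xs by (simp add: reach_tuples_iff)
    then have "tuple_length Y ys < \<infinity>" using *(3) by (rule order_le_less_trans[rotated])
    then show ?thesis using * ys xs by (auto simp: reach_tuples_iff normal_tuple_def)
  qed
  have supp': "ys \<in> level_tuples Y (s + r) (n + 1)"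
    if xs: "xs \<in> level_tuples X s n" and nz: "normalised (tuple_prism f g xs) ys \<noteq> \<zero>" for xs ys n s
  proof -
    note su = supp[OF subsetD[OF level_tuples_subset xs] nz]
    have "enn2ereal (tuple_length Y ys) \<le> enn2ereal (tuple_length X xs + ennreal r)"
      using su by (simp add: less_eq_ennreal.rep_eq)
    also have "\<dots> = enn2ereal (tuple_length X xs) + ereal r"
      using r(1) by (simp add: plus_ennreal.rep_eq)
    also have "\<dots> \<le> ereal s + ereal r"
      using xs by (intro add_right_mono) (simp add: level_tuples_def)
    finally show ?thesis using su by (simp add: level_tuples_def)
  qed
  show ?thesis
  proof (rule spectral_map_homotopy[OF RC_filtered[OF X] RC_filtered[OF Y]
        reach_map_filtered[OF f] reach_map_filtered[OF g] I r(1), where h = ?h])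
    show "?h n \<in> module_homs R (chain (RC R X) n) (chain (RC R Y) (n + 1))" for n
      unfolding RC_simps by (rule lin_free_hom[OF lin]) (use supp in \<open>auto simp: aug_basis\<close>)
    show "?h n ` filt (RC R X) s n \<subseteq> filt (RC R Y) (s + r) (n + 1)" for s n
      unfolding RC_simps
      by (rule image_subsetI, rule lin_free_closed[OF lin, where S = "level_tuples X s n"])
        (use supp' in \<open>auto simp: aug_basis\<close>)
    show "a \<in> carrier (spectral_homology (RC R X) r n I)" by (rule a)
    fix n c assume "c \<in> carrier (chain (RC R X) n)"
    then have c: "c \<in> carrier (free_module R (reach_tuples X n))" by simp
    have c': "c \<in> formal_sums" by (rule free_module_all[OF c])
    note cl = lin_closed[OF aug_lin(1) c'] lin_closed[OF aug_lin(2)[of f] c'] lin_closed[OF aug_lin(2)[of g] c']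
      lin_closed[OF aug_lin(3)[of f g] c']
    have h1: "?h (n - 1) (reach_bdry R c) = normalised (aug_prism f g (aug_bdry c))"
      using reach_bdry_eq[OF c'] normalised_absorb_aug(3)[OF cl(1)] by simp
    have h2: "reach_bdry R (?h n c) = normalised (aug_bdry (aug_prism f g c))"
      using reach_bdry_eq[OF lin_closed[OF normalised_lin cl(4)]] normalised_absorb_aug(1)[OF cl(4)] by simp
    have "(\<lambda>ys. ?h (n - 1) (reach_bdry R c) ys \<oplus> reach_bdry R (?h n c) ys) =
        normalised (\<lambda>ys. aug_prism f g (aug_bdry c) ys \<oplus> aug_bdry (aug_prism f g c) ys)"
      unfolding h1 h2
      by (rule lin_add[OF normalised_lin lin_closed[OF aug_lin(3) cl(1)] lin_closed[OF aug_lin(1) cl(4)], symmetric])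
    also have "\<dots> = (\<lambda>ys. reach_map R g n c ys \<ominus> reach_map R f n c ys)"
      unfolding aug_prism_homotopy[OF c'] reach_map_eq[OF c'] by (rule lin_minus[OF normalised_lin cl(3,2)])
    also have "\<dots> = reach_map R g n c \<ominus>\<^bsub>free_module R (reach_tuples Y n)\<^esub> reach_map R f n c"
    proof (rule free_module_minus[symmetric])
      have "reach_map R h n c \<in> carrier (chain (RC R Y) n)" if "h \<in> short_maps X Y" for h
        using reach_map_filtered[OF that] c module_homsD(1)[OF chain_mapD(1)]
        unfolding filtered_map_def by (metis RC_simps(1))
      then show "reach_map R g n c \<in> carrier (free_module R (reach_tuples Y n))"
        "reach_map R f n c \<in> carrier (free_module R (reach_tuples Y n))"
        using f g by simp_all
    qed
    finally show "?h (n - 1) (bdry (RC R X) n c) \<oplus>\<^bsub>chain (RC R Y) n\<^esub> bdry (RC R Y) (n + 1) (?h n c) =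
        reach_map R g n c \<ominus>\<^bsub>chain (RC R Y) n\<^esub> reach_map R f n c"
      by simp
  qed
qed

text \<open>
  Inducing the same value at \<open>a\<close> is an equivalence relation on short maps that contains all pairs at
  distance at most \<open>r\<close>, so it contains the smallest such relation.
\<close>
lemma spectral_map_homotopic:
  assumes X: "quasimetric X" and Y: "quasimetric Y" and r: "0 \<le> r" and I: "I \<noteq> {}"
    and fg: "(f, g) \<in> homotopic r X Y" and a: "a \<in> carrier (spectral_homology (RC R X) r n I)"
  shows "spectral_map (RC R Y) r n I (reach_map R f) a = spectral_map (RC R Y) r n I (reach_map R g) a"
proof -
  let ?m = "\<lambda>f. spectral_map (RC R Y) r n I (reach_map R f) a"
  let ?E = "{(f, g). f \<in> short_maps X Y \<and> g \<in> short_maps X Y \<and> ?m f = ?m g}"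
  have "equiv (short_maps X Y) ?E"
    by (auto simp: equiv_def refl_on_def sym_def trans_def)
  moreover have "{(f, g). f \<in> short_maps X Y \<and> g \<in> short_maps X Y \<and> short_dist X Y f g \<le> ennreal r} \<subseteq> ?E"
    using spectral_map_short_dist[OF X Y _ _ r _ I a] by blast
  ultimately have "homotopic r X Y \<subseteq> ?E"
    unfolding homotopic_def by blast
  then show ?thesis using fg by blast
qed

end

section \<open>Homology of subcomplexes\<close>

definition sub_class where
  "sub_class C P n c = boundaries (sub_complex C P) n +>\<^bsub>chain C n\<^esub> c"

lemma sub_complex_boundaries: "boundaries (sub_complex C P) n = bdry C (n + 1) ` P (n + 1)"
  by (simp add: boundaries_def sub_complex_def)

lemma presents_homology_sub:
  assumes C: "is_complex K C" and P: "subcomplex K C P"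
  shows "presents K (chain C n) {c \<in> P n. bdry C n c = \<zero>\<^bsub>chain C (n - 1)\<^esub>} (bdry C (n + 1) ` P (n + 1))
           (homology (sub_complex C P) n) (sub_class C P n)"
proof -
  let ?Z = "{c \<in> P n. bdry C n c = \<zero>\<^bsub>chain C (n - 1)\<^esub>}"
  have cyc: "cycles (sub_complex C P) n = ?Z"
    by (auto simp: cycles_def a_kernel_def kernel_def sub_complex_def)
  have zero: "submodule {\<zero>\<^bsub>chain C (n - 1)\<^esub>} K (chain C (n - 1))"
    using presentsD(4)[OF presents_refl[OF is_complexD(1)[OF C]]] .
  have "submodule ?Z K (chain C n)"
    using submodule_kernel_part[OF is_complexD(1)[OF C] is_complexD(1)[OF C] is_complexD(2)[OF C]
      subcomplexD(1)[OF P] zero] by simp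
  moreover have "bdry C (n + 1) ` P (n + 1) \<subseteq> ?Z"
    using bdry_bdry[OF C subcomplexD(3)[OF P]] subcomplexD(2)[OF P, of _ "n + 1"] by auto
  ultimately have "presents K (chain C n) ?Z (bdry C (n + 1) ` P (n + 1))
      (quot_module (restrict_module (chain C n) ?Z) (bdry C (n + 1) ` P (n + 1)))
      (\<lambda>z. bdry C (n + 1) ` P (n + 1) +>\<^bsub>chain C n\<^esub> z)"
    by (rule presents_quot_module[OF is_complexD(1)[OF C] _ bdry_image_submodule[OF C P]])
  moreover have "homology (sub_complex C P) n =
      quot_module (restrict_module (chain C n) ?Z) (bdry C (n + 1) ` P (n + 1))"
    unfolding homology_def cyc sub_complex_boundaries by (simp add: sub_complex_def)
  moreover have "sub_class C P n = (\<lambda>z. bdry C (n + 1) ` P (n + 1) +>\<^bsub>chain C n\<^esub> z)"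
    by (simp add: sub_class_def fun_eq_iff sub_complex_boundaries)
  ultimately show ?thesis by simp
qed

lemma homology_map_sub_class:
  assumes C: "is_complex K C" and P: "subcomplex K C P" and D: "is_complex K D" and P': "subcomplex K D P'"
    and f: "chain_map K C D f" "\<And>n. f n ` P n \<subseteq> P' n" and c: "c \<in> P n"
  shows "homology_map (sub_complex D P') n f (sub_class C P n c) = sub_class D P' n (f n c)"
proof -
  have fB: "f n ` bdry C (n + 1) ` P (n + 1) \<subseteq> bdry D (n + 1) ` P' (n + 1)"
  proof -
    have "f n (bdry C (n + 1) b) = bdry D (n + 1) (f (n + 1) b)" if "b \<in> P (n + 1)" for b
      using chain_mapD(2)[OF f(1) subcomplexD(3)[OF P that]] by simp
    then show ?thesis using f(2)[of "n + 1"] by auto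
  qed
  have sub: "bdry C (n + 1) ` P (n + 1) \<subseteq> P n"
    using subcomplexD(2)[OF P, of _ "n + 1"] by auto
  have "quot_map (chain D n) (bdry D (n + 1) ` P' (n + 1)) (f n) (bdry C (n + 1) ` P (n + 1) +>\<^bsub>chain C n\<^esub> c) =
      bdry D (n + 1) ` P' (n + 1) +>\<^bsub>chain D n\<^esub> f n c"
    by (rule quot_map_coset[OF is_complexD(1)[OF C] is_complexD(1)[OF D] subcomplexD(1)[OF P]
          bdry_image_submodule[OF C P] sub bdry_image_submodule[OF D P'] chain_mapD(1)[OF f(1)] fB c])
  then show ?thesis
    by (simp add: homology_map_def sub_class_def sub_complex_boundaries) (simp add: sub_complex_def)
qed

lemma homology_as_sub:
  "homology C n = homology (sub_complex C (\<lambda>m. carrier (chain C m))) n"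
  "homology_map C n f = homology_map (sub_complex C (\<lambda>m. carrier (chain C m))) n f"
  by (simp_all add: homology_def homology_map_def sub_complex_def cycles_def boundaries_def)

lemma carrier_subcomplex:
  assumes C: "is_complex K C"
  shows "subcomplex K C (\<lambda>n. carrier (chain C n))"
  using module.carrier_is_submodule[OF is_complexD(1)[OF C]] module_homsD(1)[OF is_complexD(2)[OF C]]
  by (auto simp: subcomplex_def)

lemma zero_set_add:
  assumes "module K M" "A \<subseteq> carrier M"
  shows "{\<zero>\<^bsub>M\<^esub>} <+>\<^bsub>M\<^esub> A = A"
proof -
  interpret M: module K M by fact
  have "\<zero>\<^bsub>M\<^esub> \<oplus>\<^bsub>M\<^esub> a = a" if "a \<in> A" for a using that assms(2) by auto
  then show ?thesis by (auto simp: set_add_def')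
qed

section \<open>Representatives for particular intervals\<close>

lemma interval_parts [simp]:
  fixes a b :: real
  shows "right_part UNIV = UNIV" "left_part UNIV = {}"
    and "right_part {b} = {..b}" "left_part {b} = {..<b}"
    and "a \<le> b \<Longrightarrow> right_part {a..b} = {..b}" "a \<le> b \<Longrightarrow> left_part {a..b} = {..<a}"
proof -
  show "left_part UNIV = {}" by (auto simp: left_part_def intro: less_irrefl)
  show "a \<le> b \<Longrightarrow> right_part {a..b} = {..b}"
    by (auto simp: right_part_def intro: bexI[of _ b])
  show "a \<le> b \<Longrightarrow> left_part {a..b} = {..<a}"
    by (auto simp: left_part_def)
qed (auto simp: right_part_def left_part_def)

lemma shift_halflines [simp]:
  fixes a b :: real
  shows "(\<lambda>s. s - a) ` {..<b} = {..<b - a}" "(\<lambda>s. s + a) ` {..b} = {..b + a}"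
    "range (\<lambda>s. s + a) = UNIV"
proof -
  have "x \<in> (\<lambda>s. s - a) ` {..<b}" if "x < b - a" for x
    by (rule image_eqI[of _ _ "x + a"]) (use that in auto)
  then show "(\<lambda>s. s - a) ` {..<b} = {..<b - a}" by auto
  have "x \<in> (\<lambda>s. s + a) ` {..b}" if "x \<le> b + a" for x
    by (rule image_eqI[of _ _ "x - a"]) (use that in auto)
  then show "(\<lambda>s. s + a) ` {..b} = {..b + a}" by auto
  have "x \<in> range (\<lambda>s. s + a)" for x
    by (rule image_eqI[of _ _ "x - a"]) auto
  then show "range (\<lambda>s. s + a) = UNIV" by auto
qed

lemma filt_down_atMost:
  assumes "filtered_complex K C"
  shows "filt_down C {..l} = filt C l"
  using filtered_complexD(3)[OF assms] by (auto simp: filt_down_def fun_eq_iff)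

lemma reps_0:
  assumes C: "filtered_complex K C" and I: "I \<noteq> {}"
  shows "cycle_reps C 0 n I =
      rel_cycles C (right_level C I) (left_level C I) n"
    and "boundary_reps C 0 n I = rel_boundaries C (right_level C I) (left_level C I) n"
proof -
  show "cycle_reps C 0 n I =
      rel_cycles C (right_level C I) (left_level C I) n"
    by (simp add: cycle_reps_def)
  then show "boundary_reps C 0 n I = rel_boundaries C (right_level C I) (left_level C I) n"
    using presentsD(5)[OF presents_interval_homology[OF C I, of n]]
    by (auto simp: boundary_reps_def)
qed

lemma reps_subquotient:
  assumes C: "filtered_complex K C" and I: "I \<noteq> {}" and r: "0 \<le> r"
  shows "cycle_reps C r n I \<subseteq> cycle_reps C 0 n I"
    and "cycle_reps C r n I \<inter> boundary_reps C 0 n I \<subseteq> boundary_reps C r n I"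
proof -
  show "cycle_reps C r n I \<subseteq> cycle_reps C 0 n I"
    using cycle_reps_subset[OF C I r] reps_0(1)[OF C I] by simp
  show "cycle_reps C r n I \<inter> boundary_reps C 0 n I \<subseteq> boundary_reps C r n I"
    using filt_down_mono[OF C shift_parts(8)[OF I r], of "n + 1"]
    unfolding reps_0(2)[OF C I] unfolding boundary_reps_def set_add_def' by blast
qed

text \<open>
  If \<open>F_L\<close> is zero, then so is \<open>F_(L-r)\<close>, and the representatives are the cycles of \<open>F_R\<close>.
\<close>
lemma reps_bounded_below:
  assumes C: "filtered_complex K C" and I: "I \<noteq> {}" and r: "0 \<le> r"
    and zero: "\<And>m. left_level C I m = {\<zero>\<^bsub>chain C m\<^esub>}"
  shows "cycle_reps C r n I = {c \<in> right_level C I n. bdry C n c = \<zero>\<^bsub>chain C (n - 1)\<^esub>}"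
    and "boundary_reps C r n I = cycle_reps C r n I \<inter> bdry C (n + 1) ` filt_down C ((\<lambda>s. s + r) ` right_part I) (n + 1)"
proof -
  have "filt_down C ((\<lambda>s. s - r) ` left_part I) (n - 1) = {\<zero>\<^bsub>chain C (n - 1)\<^esub>}"
    using filt_down_mono[OF C shift_parts(7)[OF I r], of "n - 1"] zero
      submodule_closed(2)[OF subcomplexD(1)[OF subcomplex_filt_down[OF C]]] by blast
  then show "cycle_reps C r n I = {c \<in> right_level C I n. bdry C n c = \<zero>\<^bsub>chain C (n - 1)\<^esub>}"
    by (simp add: cycle_reps_def)
  have "{\<zero>\<^bsub>chain C n\<^esub>} <+>\<^bsub>chain C n\<^esub> bdry C (n + 1) ` filt_down C ((\<lambda>s. s + r) ` right_part I) (n + 1) =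
      bdry C (n + 1) ` filt_down C ((\<lambda>s. s + r) ` right_part I) (n + 1)"
    by (rule zero_set_add[OF is_complexD(1)[OF filtered_complexD(1)[OF C]]
          submodule_closed(1)[OF bdry_image_submodule[OF filtered_complexD(1)[OF C] subcomplex_filt_down[OF C]]]])
  then show "boundary_reps C r n I = cycle_reps C r n I \<inter>
      bdry C (n + 1) ` filt_down C ((\<lambda>s. s + r) ` right_part I) (n + 1)"
    by (simp add: boundary_reps_def zero)
qed

text \<open>
  If moreover \<open>R + r = R\<close>, the relations are the boundaries of \<open>F_R\<close>. This applies to \<open>I = \<real>\<close> with any
  \<open>r\<close>, and to intervals \<open>[0, l]\<close> with \<open>r = 0\<close>.
\<close>
lemma presents_sub_bounded_below:
  assumes C: "filtered_complex K C" and I: "I \<noteq> {}" and r: "0 \<le> r"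
    and zero: "\<And>m. left_level C I m = {\<zero>\<^bsub>chain C m\<^esub>}"
    and shift: "(\<lambda>s. s + r) ` right_part I = right_part I"
    and P: "right_level C I = P"
  shows "presents K (chain C n) (cycle_reps C r n I) (boundary_reps C r n I)
           (homology (sub_complex C P) n) (sub_class C P n)"
proof -
  have S: "subcomplex K C P" using subcomplex_filt_down[OF C] P by metis
  note pr = presents_homology_sub[OF filtered_complexD(1)[OF C] S, of n]
  have "cycle_reps C r n I = {c \<in> P n. bdry C n c = \<zero>\<^bsub>chain C (n - 1)\<^esub>}"
    using reps_bounded_below(1)[OF C I r zero] P by simp
  moreover from this have "boundary_reps C r n I = bdry C (n + 1) ` P (n + 1)"
    using reps_bounded_below(2)[OF C I r zero] P shift presentsD(5)[OF pr] by auto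
  ultimately show ?thesis using pr by simp
qed

context cring
begin

lemma filt_down_zero:
  assumes "\<And>s. s \<in> L \<Longrightarrow> level_tuples X s n = {}"
  shows "filt_down (RC R X) L n = {\<lambda>xs. \<zero>}"
proof -
  have "carrier (free_module R {}) = {\<lambda>xs :: 'c list. \<zero>}"
    using free_module_zero_closed[of "{}"] by (auto simp: free_module_carrier_iff)
  then have "filt (RC R X) s n = {\<lambda>xs. \<zero>}" if "s \<in> L" for s
    using assms[OF that] by simp
  then show ?thesis by (auto simp: filt_down_def)
qed

lemma filt_down_negative:
  assumes "L \<subseteq> {..<0}"
  shows "filt_down (RC R X) L n = {\<lambda>xs. \<zero>}"
proof (rule filt_down_zero)
  fix s assume "s \<in> L"
  then have "ereal s < 0" using assms by auto
  then have "\<not> enn2ereal (tuple_length X xs) \<le> ereal s" for xs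
    using enn2ereal_nonneg[of "tuple_length X xs"] by (meson leD order_less_le_trans)
  then show "level_tuples X s n = {}" by (simp add: level_tuples_def)
qed

text \<open>
  The finitely many tuples in a chain have bounded length.
\<close>
lemma filt_down_UNIV: "filt_down (RC R X) UNIV = (\<lambda>n. carrier (chain (RC R X) n))"
proof
  fix n
  have "\<exists>s. c \<in> carrier (free_module R (level_tuples X s n))"
    if c: "c \<in> carrier (free_module R (reach_tuples X n))" for c
  proof -
    have fin: "finite (support R c)" using c by (simp add: free_module_carrier_iff)
    \<comment> \<open>inserting \<open>0\<close> makes the maximum meaningful for the zero chain\<close>
    let ?M = "Max (insert 0 ((\<lambda>xs. enn2real (tuple_length X xs)) ` support R c))"
    have "xs \<in> level_tuples X ?M n" if xs: "c xs \<noteq> \<zero>" for xs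
    proof -
      have r: "xs \<in> reach_tuples X n" using c xs by (auto simp: free_module_carrier_iff)
      have "enn2real (tuple_length X xs) \<le> ?M"
        using fin xs by (intro Max_ge) (auto simp: support_def)
      moreover have "enn2ereal (tuple_length X xs) = ereal (enn2real (tuple_length X xs))"
        using r by (cases "tuple_length X xs") (auto simp: reach_tuples_iff enn2ereal_ennreal)
      ultimately show ?thesis using r by (simp add: level_tuples_def)
    qed
    then show ?thesis using c by (auto simp: free_module_carrier_iff)
  qed
  moreover have "carrier (free_module R (level_tuples X s n)) \<subseteq> carrier (free_module R (reach_tuples X n))" for s
    by (rule free_module_carrier_mono[OF level_tuples_subset])
  ultimately show "filt_down (RC R X) UNIV n = carrier (chain (RC R X) n)"
    by (auto simp: filt_down_def)
qed

section \<open>Homology theories as subquotients of the functor of chains\<close>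

text \<open>
  The ambient functor of which all the homology theories are subquotients.
\<close>
definition chain_functor where
  "chain_functor n = \<lparr>fobj = (\<lambda>X. chain (RC R X) n), farr = (\<lambda>X Y f. reach_map R f n)\<rparr>"

definition chain_functor_pers where
  "chain_functor_pers n =
     \<lparr>fobj = (\<lambda>(X, l). chain (RC R X) n), farr = (\<lambda>(X, l) (Y, l') (f, u). reach_map R f n)\<rparr>"

lemma qmet_simps [simp]:
  "X \<in> Ob qmet \<longleftrightarrow> quasimetric X" "Hom qmet = short_maps" "Ident qmet X = (\<lambda>x\<in>Pts X. x)"
  "Comp qmet X g f = compose (Pts X) g f"
  by (simp_all add: qmet_def)

lemma qmet_pers_simps [simp]:
  "(X, l) \<in> Ob qmet_pers \<longleftrightarrow> quasimetric X \<and> 0 \<le> l"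
  "(f, u) \<in> Hom qmet_pers (X, l) (Y, l') \<longleftrightarrow> f \<in> short_maps X Y \<and> l \<le> l'"
  "Ident qmet_pers (X, l) = (\<lambda>x\<in>Pts X. x, ())"
  "Comp qmet_pers (X, l) (g, v) (f, u) = (compose (Pts X) g f, ())"
  by (simp_all add: qmet_pers_def prod_cat_def halfline_def)

lemma short_maps_compose:
  assumes f: "f \<in> short_maps X Y" and g: "g \<in> short_maps Y Z"
  shows "compose (Pts X) g f \<in> short_maps X Z"
proof -
  have "Dist Z (g (f x)) (g (f y)) \<le> Dist X x y" if "x \<in> Pts X" "y \<in> Pts X" for x y
    using short_mapsD(2)[OF g short_mapsD(1)[OF f that(1)] short_mapsD(1)[OF f that(2)]]
      short_mapsD(2)[OF f that] by (rule order_trans)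
  then show ?thesis
    using short_mapsD(1)[OF f] short_mapsD(1)[OF g] by (auto simp: short_maps_def compose_def)
qed

lemma short_maps_id: "(\<lambda>x\<in>Pts X. x) \<in> short_maps X X"
  by (auto simp: short_maps_def)

lemma qmet_closed: "closed_category qmet" "closed_category qmet_pers"
  unfolding closed_category_def using short_maps_compose short_maps_id by auto

lemma reach_map_chain_hom:
  assumes "f \<in> short_maps X Y"
  shows "reach_map R f n \<in> module_homs R (free_module R (reach_tuples X n)) (free_module R (reach_tuples Y n))"
  using reach_map_filtered[OF assms] chain_mapD(1)[of R "RC R X" "RC R Y" "reach_map R f" n]
  by (simp add: filtered_map_def)

lemma chain_functor_is_functor: "is_functor R qmet (chain_functor n)"
  unfolding is_functor_def chain_functor_def
  by (auto simp: free_module_is_module reach_map_chain_hom reach_map_id reach_map_compose)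

lemma chain_functor_pers_is_functor: "is_functor R qmet_pers (chain_functor_pers n)"
  unfolding is_functor_def chain_functor_pers_def
  by (auto simp: free_module_is_module reach_map_chain_hom reach_map_id reach_map_compose)

lemma presents_functorI:
  assumes "\<And>X. quasimetric X \<Longrightarrow>
      presents R (chain (RC R X) n) (cycle_reps (RC R X) r n I) (boundary_reps (RC R X) r n I) (fobj F X) (p X)"
    and "\<And>X Y f z. quasimetric X \<Longrightarrow> quasimetric Y \<Longrightarrow> f \<in> short_maps X Y \<Longrightarrow>
      z \<in> cycle_reps (RC R X) r n I \<Longrightarrow> farr F X Y f (p X z) = p Y (reach_map R f n z)"
  shows "presents_functor R qmet (chain_functor n)
    (\<lambda>X. cycle_reps (RC R X) r n I) (\<lambda>X. boundary_reps (RC R X) r n I) F p"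
  unfolding presents_functor_def
proof (intro conjI ballI)
  fix X Y :: "'c qspace" and f assume XY: "X \<in> Ob qmet" "Y \<in> Ob qmet" and f: "f \<in> Hom qmet X Y"
  note * = filtered_map_reps[OF RC_filtered RC_filtered reach_map_filtered order_refl order_refl,
      of X Y f n r I]
  show "farr (chain_functor n) X Y f ` cycle_reps (RC R X) r n I \<subseteq> cycle_reps (RC R Y) r n I"
    "farr (chain_functor n) X Y f ` boundary_reps (RC R X) r n I \<subseteq> boundary_reps (RC R Y) r n I"
    using * XY f by (simp_all add: chain_functor_def)
qed (use assms qmet_closed chain_functor_is_functor in \<open>auto simp: chain_functor_def\<close>)

lemma presents_functor_persI:
  assumes "\<And>X l. quasimetric X \<Longrightarrow> 0 \<le> l \<Longrightarrow>
      presents R (chain (RC R X) n) (cycle_reps (RC R X) r n {0..l}) (boundary_reps (RC R X) r n {0..l})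
        (fobj F (X, l)) (p X l)"
    and "\<And>X Y f z l l'. quasimetric X \<Longrightarrow> quasimetric Y \<Longrightarrow> f \<in> short_maps X Y \<Longrightarrow> 0 \<le> l \<Longrightarrow> l \<le> l' \<Longrightarrow>
      z \<in> cycle_reps (RC R X) r n {0..l} \<Longrightarrow> farr F (X, l) (Y, l') (f, ()) (p X l z) = p Y l' (reach_map R f n z)"
  shows "presents_functor R qmet_pers (chain_functor_pers n)
    (\<lambda>(X, l). cycle_reps (RC R X) r n {0..l}) (\<lambda>(X, l). boundary_reps (RC R X) r n {0..l}) F (\<lambda>(X, l). p X l)"
  unfolding presents_functor_def
proof (intro conjI ballI)
  fix A B :: "'c qspace \<times> real" and h
  assume AB: "A \<in> Ob qmet_pers" "B \<in> Ob qmet_pers" and h: "h \<in> Hom qmet_pers A B"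
  obtain X l Y l' f where eq: "A = (X, l)" "B = (Y, l')" "h = (f, ())"
    by (metis surj_pair old.unit.exhaust)
  then have q: "quasimetric X" "quasimetric Y" "f \<in> short_maps X Y" "0 \<le> l" "l \<le> l'" "0 \<le> l'"
    using AB h by auto
  note * = filtered_map_reps[OF RC_filtered[OF q(1)] RC_filtered[OF q(2)]
      reach_map_filtered[OF q(3)], of "{0..l}" "{0..l'}" n r]
  show "farr (chain_functor_pers n) A B h ` (case A of (X, l) \<Rightarrow> cycle_reps (RC R X) r n {0..l})
      \<subseteq> (case B of (X, l) \<Rightarrow> cycle_reps (RC R X) r n {0..l})"
    "farr (chain_functor_pers n) A B h ` (case A of (X, l) \<Rightarrow> boundary_reps (RC R X) r n {0..l})
      \<subseteq> (case B of (X, l) \<Rightarrow> boundary_reps (RC R X) r n {0..l})"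
    using * q eq by (simp_all add: chain_functor_pers_def)
qed (use assms qmet_closed chain_functor_pers_is_functor in \<open>auto simp: chain_functor_pers_def\<close>)

lemma presents_SH:
  assumes I: "I \<noteq> {}" and r: "0 \<le> r"
  shows "presents_functor R qmet (chain_functor n)
    (\<lambda>X. cycle_reps (RC R X) r n I) (\<lambda>X. boundary_reps (RC R X) r n I)
    (SH R r n I) (\<lambda>X. spectral_class (RC R X) r n I)"
proof (rule presents_functorI)
  fix X :: "'c qspace" assume "quasimetric X"
  then show "presents R (chain (RC R X) n) (cycle_reps (RC R X) r n I) (boundary_reps (RC R X) r n I)
      (fobj (SH R r n I) X) (spectral_class (RC R X) r n I)"
    using presents_spectral_homology[OF RC_filtered I r] by (simp add: SH_def)
next
  fix X Y :: "'c qspace" and f z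
  assume "quasimetric X" "quasimetric Y" "f \<in> short_maps X Y" "z \<in> cycle_reps (RC R X) r n I"
  then show "farr (SH R r n I) X Y f (spectral_class (RC R X) r n I z) =
      spectral_class (RC R Y) r n I (reach_map R f n z)"
    using spectral_map_class[OF RC_filtered RC_filtered reach_map_filtered I I r order_refl order_refl]
    by (simp add: SH_def)
qed

lemma presents_PSH:
  assumes r: "0 \<le> r"
  shows "presents_functor R qmet_pers (chain_functor_pers n)
    (\<lambda>(X, l). cycle_reps (RC R X) r n {0..l}) (\<lambda>(X, l). boundary_reps (RC R X) r n {0..l})
    (PSH R r n) (\<lambda>(X, l). spectral_class (RC R X) r n {0..l})"
proof (rule presents_functor_persI)
  fix X :: "'c qspace" and l :: real assume "quasimetric X" "0 \<le> l"
  then show "presents R (chain (RC R X) n) (cycle_reps (RC R X) r n {0..l}) (boundary_reps (RC R X) r n {0..l})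
      (fobj (PSH R r n) (X, l)) (spectral_class (RC R X) r n {0..l})"
    using presents_spectral_homology[OF RC_filtered _ r, of X "{0..l}" n] by (simp add: PSH_def)
next
  fix X Y :: "'c qspace" and f z and l l' :: real
  assume q: "quasimetric X" "quasimetric Y" "f \<in> short_maps X Y" "0 \<le> l" "l \<le> l'"
    "z \<in> cycle_reps (RC R X) r n {0..l}"
  then show "farr (PSH R r n) (X, l) (Y, l') (f, ()) (spectral_class (RC R X) r n {0..l} z) =
      spectral_class (RC R Y) r n {0..l'} (reach_map R f n z)"
    using spectral_map_class[OF RC_filtered RC_filtered reach_map_filtered _ _ r,
        of X Y f "{0..l}" "{0..l'}" z n]
    by (simp add: PSH_def)
qed

lemma presents_MH:
  "presents_functor R qmet (chain_functor n)
    (\<lambda>X. cycle_reps (RC R X) 0 n {l}) (\<lambda>X. boundary_reps (RC R X) 0 n {l})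
    (MH R n l) (\<lambda>X. interval_class (RC R X) {l} n)"
proof (rule presents_functorI)
  have eq: "quot_complex (RC R X) (filt (RC R X) l) (filt_down (RC R X) {..<l}) = interval_complex (RC R X) {l}"
    if "quasimetric X" for X :: "'c qspace"
    using filt_down_atMost[OF RC_filtered[OF that]] by (simp add: interval_complex_def)
  fix X :: "'c qspace" assume X: "quasimetric X"
  have "fobj (MH R n l) X = homology (interval_complex (RC R X) {l}) n"
    using eq[OF X] by (simp add: MH_def Let_def)
  then show "presents R (chain (RC R X) n) (cycle_reps (RC R X) 0 n {l}) (boundary_reps (RC R X) 0 n {l})
      (fobj (MH R n l) X) (interval_class (RC R X) {l} n)"
    using presents_interval_homology[OF RC_filtered[OF X], of "{l}" n]
      reps_0[OF RC_filtered[OF X], of "{l}" n] by simp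
  fix Y :: "'c qspace" and f z
  assume Y: "quasimetric Y" and f: "f \<in> short_maps X Y" and z: "z \<in> cycle_reps (RC R X) 0 n {l}"
  have "farr (MH R n l) X Y f = interval_map (RC R Y) n {l} (reach_map R f)"
    using eq[OF Y] by (simp add: MH_def Let_def interval_map_def)
  then show "farr (MH R n l) X Y f (interval_class (RC R X) {l} n z) =
      interval_class (RC R Y) {l} n (reach_map R f n z)"
    using interval_map_class[OF RC_filtered[OF X] RC_filtered[OF Y] reach_map_filtered[OF f],
        of "{l}" "{l}" z n] z reps_0(1)[OF RC_filtered[OF X], of "{l}" n] by simp
qed

lemma presents_BMH:
  "presents_functor R qmet_pers (chain_functor_pers n)
    (\<lambda>(X, l). cycle_reps (RC R X) 0 n {0..l}) (\<lambda>(X, l). boundary_reps (RC R X) 0 n {0..l})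
    (BMH R n) (\<lambda>(X, l). sub_class (RC R X) (filt (RC R X) l) n)"
proof (rule presents_functor_persI)
  fix X :: "'c qspace" and l :: real assume q: "quasimetric X" "0 \<le> l"
  show "presents R (chain (RC R X) n) (cycle_reps (RC R X) 0 n {0..l}) (boundary_reps (RC R X) 0 n {0..l})
      (fobj (BMH R n) (X, l)) (sub_class (RC R X) (filt (RC R X) l) n)"
    using presents_sub_bounded_below[OF RC_filtered[OF q(1)], of "{0..l}" 0 "filt (RC R X) l" n]
      filt_down_negative[of "{..<0}" X] filt_down_atMost[OF RC_filtered[OF q(1)], of l] q
    by (simp add: BMH_def Let_def)
next
  fix X Y :: "'c qspace" and f z and l l' :: real
  assume q: "quasimetric X" "quasimetric Y" "f \<in> short_maps X Y" "0 \<le> l" "l \<le> l'"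
    and z: "z \<in> cycle_reps (RC R X) 0 n {0..l}"
  note CX = RC_filtered[OF q(1)] and CY = RC_filtered[OF q(2)]
  have f: "filtered_map R (RC R X) (RC R Y) (reach_map R f)" by (rule reach_map_filtered[OF q(3)])
  have "reach_map R f n ` filt (RC R X) l n \<subseteq> filt (RC R Y) l' n" for n
    using f filtered_complexD(3)[OF CY q(5)] unfolding filtered_map_def by blast
  moreover have "z \<in> filt (RC R X) l n"
    using z q filt_down_atMost[OF CX, of l] by (simp add: cycle_reps_def)
  ultimately have "homology_map (sub_complex (RC R Y) (filt (RC R Y) l')) n (reach_map R f)
      (sub_class (RC R X) (filt (RC R X) l) n z) = sub_class (RC R Y) (filt (RC R Y) l') n (reach_map R f n z)"
    using f by (intro homology_map_sub_class[OF filtered_complexD(1)[OF CX] filtered_complexD(2)[OF CX]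
        filtered_complexD(1)[OF CY] filtered_complexD(2)[OF CY]]) (auto simp: filtered_map_def)
  then show "farr (BMH R n) (X, l) (Y, l') (f, ()) (sub_class (RC R X) (filt (RC R X) l) n z) =
      sub_class (RC R Y) (filt (RC R Y) l') n (reach_map R f n z)"
    by (simp add: BMH_def Let_def)
qed

lemma presents_RH:
  assumes r: "0 \<le> r"
  shows "presents_functor R qmet (chain_functor n)
    (\<lambda>X. cycle_reps (RC R X) r n UNIV) (\<lambda>X. boundary_reps (RC R X) r n UNIV)
    (RH R n) (\<lambda>X. sub_class (RC R X) (\<lambda>m. carrier (chain (RC R X) m)) n)"
proof (rule presents_functorI)
  fix X :: "'c qspace" assume X: "quasimetric X"
  note CX = RC_filtered[OF X]
  show "presents R (chain (RC R X) n) (cycle_reps (RC R X) r n UNIV) (boundary_reps (RC R X) r n UNIV)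
      (fobj (RH R n) X) (sub_class (RC R X) (\<lambda>m. carrier (chain (RC R X) m)) n)"
    using presents_sub_bounded_below[OF CX UNIV_not_empty r, of "\<lambda>m. carrier (chain (RC R X) m)" n]
      filt_down_UNIV[of X]
      filt_down_zero[of "{}" X]
    by (simp add: RH_def homology_as_sub(1)[of "RC R X"])
  fix Y :: "'c qspace" and f z
  assume Y: "quasimetric Y" and f: "f \<in> short_maps X Y" and z: "z \<in> cycle_reps (RC R X) r n UNIV"
  note CY = RC_filtered[OF Y]
  have cm: "chain_map R (RC R X) (RC R Y) (reach_map R f)"
    using reach_map_filtered[OF f] by (simp add: filtered_map_def)
  have "z \<in> carrier (chain (RC R X) n)"
    using z filt_down_UNIV[of X] by (simp add: cycle_reps_def)
  then have "homology_map (sub_complex (RC R Y) (\<lambda>m. carrier (chain (RC R Y) m))) n (reach_map R f)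
      (sub_class (RC R X) (\<lambda>m. carrier (chain (RC R X) m)) n z) =
      sub_class (RC R Y) (\<lambda>m. carrier (chain (RC R Y) m)) n (reach_map R f n z)"
    using module_homsD(1)[OF chain_mapD(1)[OF cm]]
    by (intro homology_map_sub_class[OF filtered_complexD(1)[OF CX] carrier_subcomplex
        filtered_complexD(1)[OF CY] carrier_subcomplex cm])
      (auto intro: filtered_complexD(1)[OF CX] filtered_complexD(1)[OF CY])
  then show "farr (RH R n) X Y f (sub_class (RC R X) (\<lambda>m. carrier (chain (RC R X) m)) n z) =
      sub_class (RC R Y) (\<lambda>m. carrier (chain (RC R Y) m)) n (reach_map R f n z)"
    by (simp add: RH_def homology_as_sub(2)[of "RC R Y"])
qed

lemma SH_homotopy_invariant:
  assumes "I \<noteq> {}" "0 \<le> r"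
  shows "homotopy_invariant r (SH R r n I)"
  unfolding homotopy_invariant_def SH_def
  by (clarsimp; rule spectral_map_homotopic[OF _ _ assms(2,1)]; assumption)

lemma PSH_homotopy_invariant:
  assumes "0 \<le> r"
  shows "homotopy_invariant_pers r (PSH R r n)"
  unfolding homotopy_invariant_pers_def PSH_def
  by (clarsimp, rule spectral_map_homotopic[OF _ _ assms]) auto

end

section \<open>The spectral sequence of an integrally filtered complex\<close>

lemma bdry_add_boundary:
  assumes C: "is_complex K C" and a: "a \<in> carrier (chain C n)" and b: "b \<in> carrier (chain C (n + 1))"
  shows "bdry C n (a \<oplus>\<^bsub>chain C n\<^esub> bdry C (n + 1) b) = bdry C n a"
proof -
  interpret N: module K "chain C (n - 1)" by (rule is_complexD(1)[OF C])
  have "bdry C (n + 1) b \<in> carrier (chain C n)"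
    using module_homsD(1)[OF is_complexD(2)[OF C] b] by simp
  then have "bdry C n (a \<oplus>\<^bsub>chain C n\<^esub> bdry C (n + 1) b) =
      bdry C n a \<oplus>\<^bsub>chain C (n - 1)\<^esub> bdry C n (bdry C (n + 1) b)"
    by (rule module_homsD(2)[OF is_complexD(2)[OF C] a])
  then show ?thesis
    using bdry_bdry[OF C b] module_homsD(1)[OF is_complexD(2)[OF C] a] by simp
qed

text \<open>
  With \<open>L = (-\<infinity>, l)\<close> and shift \<open>r - 1\<close> the level \<open>F_(L-(r-1))\<close> is \<open>F_(l-r)\<close>, so the representatives are
  \<open>Z^r_l\<close>. In a relation \<open>c = a + \<partial>b\<close> with \<open>a \<in> F_(l-1)\<close> and \<open>b \<in> F_(l+r-1)\<close> one has \<open>\<partial>a = \<partial>c \<in> F_(l-r)\<close> and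
  \<open>\<partial>b = c - a \<in> F_l\<close>, that is, \<open>a \<in> Z^(r-1)_(l-1)\<close> and \<open>b \<in> Z^(r-1)_(l+r-1)\<close>.
\<close>
lemma presents_spectral_page:
  fixes r l n :: int
  assumes C: "filtered_complex K C"
    and integral: "\<And>p :: int. filt_down C {..<real_of_int p} = filt C (real_of_int (p - 1))"
    and r: "1 \<le> r"
  shows "\<exists>p. presents K (chain C n) (cycle_reps C (real_of_int (r - 1)) n {real_of_int l})
           (boundary_reps C (real_of_int (r - 1)) n {real_of_int l})
           (spectral_page C (\<lambda>p. filt C (real_of_int p)) r l (n - l)) p"
proof -
  let ?F = "\<lambda>p. filt C (real_of_int p)"
  let ?Z = "cycle_reps C (real_of_int (r - 1)) n {real_of_int l}"
  let ?B = "boundary_reps C (real_of_int (r - 1)) n {real_of_int l}"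
  note CC = filtered_complexD(1)[OF C] and S = filtered_complexD(2)[OF C]
  have img: "(\<lambda>s. s - real_of_int (r - 1)) ` {..<real_of_int l} = {..<real_of_int (l - r + 1)}"
    by (subst shift_halflines(1)) simp
  have low: "filt_down C ((\<lambda>s. s - real_of_int (r - 1)) ` {..<real_of_int l}) = ?F (l - r)"
    unfolding img using integral[of "l - r + 1"] by simp
  have img': "(\<lambda>s. s + real_of_int (r - 1)) ` {..real_of_int l} = {..real_of_int (l + r - 1)}"
    by (subst shift_halflines(2)) (simp add: algebra_simps)
  have high: "filt_down C ((\<lambda>s. s + real_of_int (r - 1)) ` {..real_of_int l}) = ?F (l + r - 1)"
    unfolding img' by (rule filt_down_atMost[OF C])
  have Z: "?Z = approx_cycles C ?F r l n"
    using low filt_down_atMost[OF C] by (simp add: cycle_reps_def approx_cycles_def)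
  have B: "?B = ?Z \<inter> (rel_boundaries C (?F (l + r - 1)) (?F (l - 1)) n)"
    using high integral by (simp add: boundary_reps_def)
  have "?B = approx_cycles C ?F (r - 1) (l - 1) n <+>\<^bsub>chain C n\<^esub>
      bdry C (n + 1) ` approx_cycles C ?F (r - 1) (l + r - 1) (n + 1)" (is "_ = ?S")
  proof
    show "?B \<subseteq> ?S"
    proof
      fix c assume c: "c \<in> ?B"
      then obtain a b where ab: "a \<in> ?F (l - 1) n" "b \<in> ?F (l + r - 1) (n + 1)"
          "c = a \<oplus>\<^bsub>chain C n\<^esub> bdry C (n + 1) b"
        unfolding B by (auto simp: set_add_def')
      have cZ: "c \<in> ?F l n" "bdry C n c \<in> ?F (l - r) (n - 1)"
        using c unfolding B Z by (auto simp: approx_cycles_def)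
      have cl: "a \<in> carrier (chain C n)" "b \<in> carrier (chain C (n + 1))"
        using ab subcomplexD(3)[OF S] by blast+
      have "bdry C (n + 1) b \<in> filt_down C {..real_of_int l} n"
      proof (rule filt_down_add_cancel[OF C])
        show "a \<in> filt_down C {..real_of_int l} n"
          using ab(1) filtered_complexD(3)[OF C, of "real_of_int (l - 1)" "real_of_int l"]
          by (auto simp: filt_down_atMost[OF C])
        show "bdry C (n + 1) b \<in> carrier (chain C n)"
          using module_homsD(1)[OF is_complexD(2)[OF CC] cl(2)] by simp
        show "a \<oplus>\<^bsub>chain C n\<^esub> bdry C (n + 1) b \<in> filt_down C {..real_of_int l} n"
          using cZ(1) ab(3) by (simp add: filt_down_atMost[OF C])
      qed
      then have "b \<in> approx_cycles C ?F (r - 1) (l + r - 1) (n + 1)"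
        using ab(2) by (simp add: approx_cycles_def filt_down_atMost[OF C])
      moreover have "a \<in> approx_cycles C ?F (r - 1) (l - 1) n"
        using ab cZ(2) bdry_add_boundary[OF CC cl] by (simp add: approx_cycles_def)
      ultimately show "c \<in> ?S" unfolding ab(3) by (intro set_addI imageI)
    qed
    show "?S \<subseteq> ?B"
    proof
      fix c assume "c \<in> ?S"
      then obtain a b where ab: "a \<in> approx_cycles C ?F (r - 1) (l - 1) n"
          "b \<in> approx_cycles C ?F (r - 1) (l + r - 1) (n + 1)" "c = a \<oplus>\<^bsub>chain C n\<^esub> bdry C (n + 1) b"
        by (auto simp: set_add_def')
      have a: "a \<in> ?F (l - 1) n" "bdry C n a \<in> ?F (l - r) (n - 1)"
        and b: "b \<in> ?F (l + r - 1) (n + 1)" "bdry C (n + 1) b \<in> ?F l n"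
        using ab by (simp_all add: approx_cycles_def)
      have cl: "a \<in> carrier (chain C n)" "b \<in> carrier (chain C (n + 1))"
        using a b subcomplexD(3)[OF S] by blast+
      have "a \<in> ?F l n"
        using a(1) filtered_complexD(3)[OF C, of "real_of_int (l - 1)" "real_of_int l"] by auto
      then have "c \<in> ?F l n"
        using b(2) ab(3) submodule_closed(3)[OF subcomplexD(1)[OF S]] by simp
      moreover have "bdry C n c \<in> ?F (l - r) (n - 1)"
        using ab(3) bdry_add_boundary[OF CC cl] a(2) by simp
      ultimately have "c \<in> ?Z" unfolding Z by (simp add: approx_cycles_def)
      moreover have "c \<in> rel_boundaries C (?F (l + r - 1)) (?F (l - 1)) n"
        unfolding ab(3) by (rule set_addI[OF a(1) imageI[OF b(1)]])
      ultimately show "c \<in> ?B" unfolding B by blast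
    qed
  qed
  then have page: "spectral_page C ?F r l (n - l) = quot_module (restrict_module (chain C n) ?Z) ?B"
    unfolding Z by (simp add: spectral_page_def Let_def)
  have "?B \<subseteq> ?Z" by (simp add: boundary_reps_def)
  from presents_quot_module[OF is_complexD(1)[OF CC] boundary_reps_submodule(1)[OF C] boundary_reps_submodule(2)[OF C] this]
  show ?thesis unfolding page by blast
qed

section \<open>Digraphs\<close>

lemma digraph_dist_cases:
  obtains "Dist (digraph_space G) g h = \<infinity>" "\<And>k. (g, h) \<notin> arrows G ^^ k"
  | k where "Dist (digraph_space G) g h = of_nat k" "(g, h) \<in> arrows G ^^ k"
      "\<And>j. (g, h) \<in> arrows G ^^ j \<Longrightarrow> k \<le> j"
proof (cases "\<exists>k. (g, h) \<in> arrows G ^^ k")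
  case True
  let ?k = "LEAST k. (g, h) \<in> arrows G ^^ k"
  have k: "(g, h) \<in> arrows G ^^ ?k" using True by (rule LeastI_ex)
  have le: "?k \<le> j" if "(g, h) \<in> arrows G ^^ j" for j using that by (rule Least_le)
  have "(INF k\<in>{k. (g, h) \<in> arrows G ^^ k}. of_nat k) = (of_nat ?k :: ennreal)"
    by (rule antisym) (use k le in \<open>auto intro!: INF_lower INF_greatest\<close>)
  then show ?thesis using that(2)[OF _ k le] by (simp add: digraph_space_def)
next
  case False
  then have "{k. (g, h) \<in> arrows G ^^ k} = {}" by auto
  then show ?thesis using that(1) False by (simp add: digraph_space_def)
qed

lemma digraph_dist_le:
  assumes "(g, h) \<in> arrows G ^^ k"
  shows "Dist (digraph_space G) g h \<le> of_nat k"
  using assms by (auto simp: digraph_space_def intro: INF_lower)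

lemma digraph_dist_zero_iff: "Dist (digraph_space G) g h = 0 \<longleftrightarrow> g = h"
proof
  assume d: "Dist (digraph_space G) g h = 0"
  show "g = h"
  proof (cases rule: digraph_dist_cases[of G g h])
    case (2 k)
    then have "k = 0" using d by simp
    then show ?thesis using 2 by simp
  qed (use d in simp)
next
  assume "g = h"
  then show "Dist (digraph_space G) g h = 0" using digraph_dist_le[of g h 0 G] by simp
qed

lemma digraph_space_quasimetric: "quasimetric (digraph_space G)"
proof -
  have "Dist (digraph_space G) x z \<le> Dist (digraph_space G) x y + Dist (digraph_space G) y z" for x y z
  proof (cases rule: digraph_dist_cases[of G x y])
    case (2 j)
    note j = this
    show ?thesis
    proof (cases rule: digraph_dist_cases[of G y z])
      case (2 k)
      have "(x, z) \<in> arrows G ^^ (j + k)" using j 2 by (auto simp: relpow_add)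
      then show ?thesis using digraph_dist_le[of x z "j + k" G] j 2 by simp
    qed simp
  qed simp
  then show ?thesis by (simp add: quasimetric_def digraph_dist_zero_iff)
qed

lemma digraph_tuple_length_cases:
  obtains "tuple_length (digraph_space G) gs = \<infinity>" | k where "tuple_length (digraph_space G) gs = of_nat k"
proof -
  have "tuple_length (digraph_space G) gs = \<infinity> \<or> (\<exists>k. tuple_length (digraph_space G) gs = of_nat k)"
  proof (induction gs rule: induct_list012)
    case (3 x y zs)
    show ?case
    proof (cases rule: digraph_dist_cases[of G x y])
      case (2 k)
      then show ?thesis using 3(2) by (auto simp: of_nat_add[symmetric] simp del: of_nat_add)
    qed simp
  qed (auto intro: exI[of _ 0])
  then show ?thesis using that by blast
qed

text \<open>
  Distinct vertices have distance at least \<open>1\<close>, with equality iff there is an arrow.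
\<close>
lemma digraph_tuple_length_lower:
  assumes "distinct_adj gs" "tuple_length (digraph_space G) gs = of_nat k"
  shows "length gs - 1 \<le> k \<and> (k \<le> length gs - 1 \<longrightarrow> successively (\<lambda>g h. (g, h) \<in> arrows G) gs)"
  using assms
proof (induction gs arbitrary: k rule: induct_list012)
  case (3 x y zs)
  obtain a where a: "Dist (digraph_space G) x y = of_nat a" "(x, y) \<in> arrows G ^^ a"
    using 3(4) by (cases rule: digraph_dist_cases[of G x y]) auto
  obtain b where b: "tuple_length (digraph_space G) (y # zs) = of_nat b"
    using 3(4) by (cases rule: digraph_tuple_length_cases[of G "y # zs"]) auto
  have "(of_nat k :: ennreal) = of_nat (a + b)" using 3(4) a b by simp
  then have k: "k = a + b" by (simp only: of_nat_eq_iff)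
  have "a \<noteq> 0" using a(2) 3(3) by (cases a) auto
  moreover have "length zs \<le> b" "b \<le> length zs \<longrightarrow> successively (\<lambda>g h. (g, h) \<in> arrows G) (y # zs)"
    using 3(2)[OF _ b] 3(3) by auto
  moreover have "(x, y) \<in> arrows G" if "a = 1" using a(2) that by simp
  ultimately show ?case using k by (auto simp: not_less_eq_eq)
qed auto

lemma digraph_tuple_length_path:
  "successively (\<lambda>g h. (g, h) \<in> arrows G) gs \<Longrightarrow> tuple_length (digraph_space G) gs \<le> of_nat (length gs - 1)"
proof (induction gs rule: induct_list012)
  case (3 x y zs)
  then have "Dist (digraph_space G) x y \<le> of_nat 1"
    by (intro digraph_dist_le) simp
  then have "tuple_length (digraph_space G) (x # y # zs) \<le> of_nat 1 + of_nat (length (y # zs) - 1)"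
    using 3 by (simp add: add_mono)
  then show ?case by simp
qed auto

lemma enn2ereal_of_nat_le: "enn2ereal (of_nat k) \<le> ereal s \<longleftrightarrow> real k \<le> s"
  by (simp add: ennreal_of_nat_eq_real_of_nat)

lemma digraph_level_empty:
  assumes "s < real_of_int n"
  shows "level_tuples (digraph_space G) s n = {}"
proof (rule ccontr)
  assume "level_tuples (digraph_space G) s n \<noteq> {}"
  then obtain gs where gs: "gs \<in> reach_tuples (digraph_space G) n"
      "enn2ereal (tuple_length (digraph_space G) gs) \<le> ereal s"
    by (auto simp: level_tuples_def)
  then obtain k where k: "tuple_length (digraph_space G) gs = of_nat k"
    by (cases rule: digraph_tuple_length_cases[of G gs]) (auto simp: reach_tuples_iff)
  have "length gs - 1 \<le> k" "int (length gs) = n + 1" "gs \<noteq> []"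
    using digraph_tuple_length_lower[OF _ k] gs by (auto simp: reach_tuples_iff)
  then have "n \<le> int k" by (cases gs) auto
  moreover have "real k \<le> s" using gs(2) k enn2ereal_of_nat_le by simp
  ultimately show False using assms by linarith
qed

lemma digraph_level_paths:
  "level_tuples (digraph_space G) (real_of_int n) n =
     {gs \<in> reach_tuples (digraph_space G) n. successively (\<lambda>g h. (g, h) \<in> arrows G) gs}"
proof -
  have "enn2ereal (tuple_length (digraph_space G) gs) \<le> ereal (real_of_int n) \<longleftrightarrow>
      successively (\<lambda>g h. (g, h) \<in> arrows G) gs" if gs: "gs \<in> reach_tuples (digraph_space G) n" for gs
  proof -
    obtain k where k: "tuple_length (digraph_space G) gs = of_nat k"
      using gs by (cases rule: digraph_tuple_length_cases[of G gs]) (auto simp: reach_tuples_iff)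
    have n: "n = int (length gs - 1)"
      using gs by (cases gs) (auto simp: reach_tuples_iff)
    have "k \<le> length gs - 1 \<longleftrightarrow> successively (\<lambda>g h. (g, h) \<in> arrows G) gs"
      using digraph_tuple_length_lower[OF _ k] digraph_tuple_length_path[of G gs] gs
      unfolding k by (auto simp: reach_tuples_iff)
    then show ?thesis unfolding k enn2ereal_of_nat_le n by simp
  qed
  then show ?thesis by (auto simp: level_tuples_def)
qed

lemma digraph_level_integral:
  assumes "s < real_of_int p"
  shows "level_tuples (digraph_space G) s n \<subseteq> level_tuples (digraph_space G) (real_of_int (p - 1)) n"
proof
  fix gs assume gs: "gs \<in> level_tuples (digraph_space G) s n"
  then obtain k where k: "tuple_length (digraph_space G) gs = of_nat k"
    by (cases rule: digraph_tuple_length_cases[of G gs]) (auto simp: level_tuples_def)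
  have "real k \<le> s" using gs k enn2ereal_of_nat_le by (simp add: level_tuples_def)
  then have "real_of_int (int k) < real_of_int p" using assms by simp
  then have "int k \<le> p - 1" unfolding of_int_less_iff by simp
  then have "real k \<le> real_of_int (p - 1)" by linarith
  then show "gs \<in> level_tuples (digraph_space G) (real_of_int (p - 1)) n"
    using gs k unfolding level_tuples_def by (simp only: mem_Collect_eq enn2ereal_of_nat_le)
qed

context cring
begin

lemma digraph_filt_down:
  "filt_down (RC R (digraph_space G)) {..<real_of_int p} = filt (RC R (digraph_space G)) (real_of_int (p - 1))"
proof
  fix n
  have "filt (RC R (digraph_space G)) s n \<subseteq> filt (RC R (digraph_space G)) (real_of_int (p - 1)) n"
    if "s < real_of_int p" for s
    unfolding RC_simps by (rule free_module_carrier_mono[OF digraph_level_integral[OF that]])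
  moreover have "real_of_int (p - 1) \<in> {..<real_of_int p}" by simp
  ultimately show "filt_down (RC R (digraph_space G)) {..<real_of_int p} n =
      filt (RC R (digraph_space G)) (real_of_int (p - 1)) n"
    unfolding filt_down_def by (simp del: RC_simps of_int_diff, intro antisym UN_least UN_upper) auto
qed

lemma MPSS_isomorphic:
  fixes r l n :: int
  assumes "1 \<le> r"
  shows "modules_isomorphic R (MPSS R G r l (n - l)) (fobj (SH R (real_of_int (r - 1)) n {real_of_int l}) (digraph_space G))"
proof -
  note C = RC_filtered[OF digraph_space_quasimetric[of G]]
  obtain p where "presents R (chain (RC R (digraph_space G)) n)
      (cycle_reps (RC R (digraph_space G)) (real_of_int (r - 1)) n {real_of_int l})
      (boundary_reps (RC R (digraph_space G)) (real_of_int (r - 1)) n {real_of_int l})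
      (MPSS R G r l (n - l)) p"
    using presents_spectral_page[OF C digraph_filt_down assms] unfolding MPSS_def by blast
  moreover have "presents R (chain (RC R (digraph_space G)) n)
      (cycle_reps (RC R (digraph_space G)) (real_of_int (r - 1)) n {real_of_int l})
      (boundary_reps (RC R (digraph_space G)) (real_of_int (r - 1)) n {real_of_int l})
      (fobj (SH R (real_of_int (r - 1)) n {real_of_int l}) (digraph_space G))
      (spectral_class (RC R (digraph_space G)) (real_of_int (r - 1)) n {real_of_int l})"
    using presents_spectral_homology[OF C, of "{real_of_int l}" "real_of_int (r - 1)" n] assms
    by (simp add: SH_def)
  ultimately show ?thesis by (rule presents_modules_isomorphic)
qed

text \<open>
  In degree \<open>n\<close> the level \<open>F_n\<close> consists of the path chains and all lower levels are zero. So a chain of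
  \<open>F_n\<close> with boundary below level \<open>n - 1\<close> is a cycle, and a relation is the boundary of a path chain
  that is itself made of paths, that is, the boundary of an element of \<open>\<Omega>\<close>.
\<close>
lemma PH_isomorphic:
  fixes n :: int
  shows "modules_isomorphic R (PH R G n) (fobj (SH R 1 n {real_of_int n}) (digraph_space G))"
proof -
  let ?C = "RC R (digraph_space G)" and ?A = "path_chains R G" and ?O = "omega_chains R G"
  note C = RC_filtered[OF digraph_space_quasimetric[of G]]
  note CC = filtered_complexD(1)[OF C]
  have A: "?A m = filt ?C (real_of_int m) m" for m
    by (simp add: path_chains_def digraph_level_paths)
  have sA: "submodule (?A m) R (chain ?C m)" for m
    unfolding A by (rule subcomplexD(1)[OF filtered_complexD(2)[OF C]])
  have O: "?O m = {v \<in> ?A m. bdry ?C m v \<in> ?A (m - 1)}" for m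
    by (simp add: omega_chains_def)
  have Ac: "v \<in> carrier (chain ?C m)" if "v \<in> ?A m" for v m
    using that submodule_closed(1)[OF sA] by blast
  have dd: "bdry ?C (m - 1) (bdry ?C m v) \<in> ?A (m - 1 - 1)" if "v \<in> ?A m" for v m
    using is_complexD(3)[OF CC Ac[OF that]] submodule_closed(2)[OF sA] by metis
  have S: "subcomplex R ?C ?O"
    unfolding subcomplex_def
  proof (intro allI conjI)
    fix m
    show "submodule (?O m) R (chain ?C m)"
      unfolding O by (rule submodule_kernel_part[OF is_complexD(1)[OF CC] is_complexD(1)[OF CC] is_complexD(2)[OF CC] sA sA])
    show "bdry ?C m ` ?O m \<subseteq> ?O (m - 1)" unfolding O using dd by auto
  qed
  have img: "(\<lambda>s. s - real_of_int (r - 1)) ` {..<real_of_int l} = {..<real_of_int (l - r + 1)}"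
    by (subst shift_halflines(1)) simp
  have low: "filt_down ?C L m = {\<zero>\<^bsub>chain ?C m\<^esub>}" if "L \<subseteq> {..<real_of_int m}" for L m
    using filt_down_zero[of L "digraph_space G" m] digraph_level_empty that by auto
  have Z: "cycle_reps ?C 1 n {real_of_int n} = {c \<in> ?O n. bdry ?C n c = \<zero>\<^bsub>chain ?C (n - 1)\<^esub>}"
    unfolding cycle_reps_def O
    using low[of "{..<real_of_int n - 1}" "n - 1"] submodule_closed(2)[OF sA, of "n - 1"]
    by (auto simp: filt_down_atMost[OF C] A)
  have "boundary_reps ?C 1 n {real_of_int n} = cycle_reps ?C 1 n {real_of_int n} \<inter>
      ({\<zero>\<^bsub>chain ?C n\<^esub>} <+>\<^bsub>chain ?C n\<^esub> bdry ?C (n + 1) ` ?A (n + 1))"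
    using low[of "{..<real_of_int n}" n] by (simp add: boundary_reps_def filt_down_atMost[OF C] A)
  also have "{\<zero>\<^bsub>chain ?C n\<^esub>} <+>\<^bsub>chain ?C n\<^esub> bdry ?C (n + 1) ` ?A (n + 1) = bdry ?C (n + 1) ` ?A (n + 1)"
  proof (rule zero_set_add[OF is_complexD(1)[OF CC]])
    show "bdry ?C (n + 1) ` ?A (n + 1) \<subseteq> carrier (chain ?C n)"
      using module_homsD(1)[OF is_complexD(2)[OF CC, of "n + 1"]] Ac[of _ "n + 1"] by auto
  qed
  also have "cycle_reps ?C 1 n {real_of_int n} \<inter> bdry ?C (n + 1) ` ?A (n + 1) = bdry ?C (n + 1) ` ?O (n + 1)"
  proof -
    have "bdry ?C n (bdry ?C (n + 1) b) = \<zero>\<^bsub>chain ?C (n - 1)\<^esub>" if "b \<in> ?A (n + 1)" for b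
      by (rule bdry_bdry[OF CC Ac[OF that]])
    moreover have "bdry ?C (n + 1) b \<in> ?O n" if "b \<in> ?O (n + 1)" for b
      using subcomplexD(2)[OF S that] by simp
    ultimately show ?thesis
      unfolding Z by (auto simp: O)
  qed
  finally have B: "boundary_reps ?C 1 n {real_of_int n} = bdry ?C (n + 1) ` ?O (n + 1)" .
  have "presents R (chain ?C n) (cycle_reps ?C 1 n {real_of_int n}) (boundary_reps ?C 1 n {real_of_int n})
      (PH R G n) (sub_class ?C ?O n)"
    unfolding Z B PH_def by (rule presents_homology_sub[OF CC S])
  moreover have "presents R (chain ?C n) (cycle_reps ?C 1 n {real_of_int n}) (boundary_reps ?C 1 n {real_of_int n})
      (fobj (SH R 1 n {real_of_int n}) (digraph_space G)) (spectral_class ?C 1 n {real_of_int n})"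
    using presents_spectral_homology[OF C, of "{real_of_int n}" 1 n] by (simp add: SH_def)
  ultimately show ?thesis by (rule presents_modules_isomorphic)
qed

section \<open>Comparison of the homology theories\<close>

lemma MH_isomorphic_SH: "naturally_isomorphic R qmet (MH R n l) (SH R 0 n {l})"
  by (rule presents_functor_isomorphic[OF presents_MH presents_SH]) auto

lemma SH_subquotient_MH:
  assumes r: "0 \<le> r"
  shows "subquotient_functor R qmet (SH R r n {l}) (MH R n l)"
proof (rule presents_functor_subquotient[OF presents_MH presents_SH[OF _ r]])
  fix X :: "'c qspace" assume "X \<in> Ob qmet"
  then have "quasimetric X" by simp
  from reps_subquotient[OF RC_filtered[OF this] _ r]
  show "cycle_reps (RC R X) r n {l} \<subseteq> cycle_reps (RC R X) 0 n {l}"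
    "cycle_reps (RC R X) r n {l} \<inter> boundary_reps (RC R X) 0 n {l} \<subseteq> boundary_reps (RC R X) r n {l}"
    by simp_all
qed simp

lemma BMH_isomorphic_PSH: "naturally_isomorphic R qmet_pers (BMH R n) (PSH R 0 n)"
  by (rule presents_functor_isomorphic[OF presents_BMH presents_PSH]) auto

lemma PSH_subquotient_BMH:
  assumes r: "0 \<le> r"
  shows "subquotient_functor R qmet_pers (PSH R r n) (BMH R n)"
proof (rule presents_functor_subquotient[OF presents_BMH presents_PSH[OF r]])
  fix A :: "'c qspace \<times> real" assume "A \<in> Ob qmet_pers"
  moreover obtain X l where "A = (X, l)" by (cases A)
  ultimately have A: "A = (X, l)" "quasimetric X" "{0..l} \<noteq> {}" by auto
  show "(case A of (X, l) \<Rightarrow> cycle_reps (RC R X) r n {0..l}) \<subseteq>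
      (case A of (X, l) \<Rightarrow> cycle_reps (RC R X) 0 n {0..l})"
    "(case A of (X, l) \<Rightarrow> cycle_reps (RC R X) r n {0..l}) \<inter>
      (case A of (X, l) \<Rightarrow> boundary_reps (RC R X) 0 n {0..l}) \<subseteq>
      (case A of (X, l) \<Rightarrow> boundary_reps (RC R X) r n {0..l})"
    using reps_subquotient[OF RC_filtered[OF A(2)] A(3) r] by (simp_all add: A(1))
qed

lemma RH_isomorphic_SH:
  assumes "0 \<le> r"
  shows "naturally_isomorphic R qmet (RH R n) (SH R r n UNIV)"
  by (rule presents_functor_isomorphic[OF presents_RH presents_SH]) (use assms in auto)

end

theorem theorem4p11:
  fixes K :: "('k, 'z) ring_scheme" and G :: "'g digraph" and n :: nat
  assumes "cring K" and "is_digraph G"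
  shows
    "(\<forall>l::real.
        naturally_isomorphic K (qmet :: ('x qspace, 'x \<Rightarrow> 'x) cat)
          (MH K (int n) l) (SH K 0 (int n) {l}) \<and>
        (\<forall>r\<ge>0.
           homotopy_invariant r
             (SH K r (int n) {l} :: ('x qspace, 'x \<Rightarrow> 'x, 'k, ('x list \<Rightarrow> 'k) set set set) mod_functor) \<and>
           subquotient_functor K (qmet :: ('x qspace, 'x \<Rightarrow> 'x) cat)
             (SH K r (int n) {l}) (MH K (int n) l))) \<and>
     (naturally_isomorphic K (qmet_pers :: ('x qspace \<times> real, ('x \<Rightarrow> 'x) \<times> unit) cat)
        (BMH K (int n)) (PSH K 0 (int n)) \<and>
      (\<forall>r\<ge>0.
         homotopy_invariant_pers r
           (PSH K r (int n) :: ('x qspace \<times> real, ('x \<Rightarrow> 'x) \<times> unit, 'k, ('x list \<Rightarrow> 'k) set set set) mod_functor) \<and>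
         subquotient_functor K (qmet_pers :: ('x qspace \<times> real, ('x \<Rightarrow> 'x) \<times> unit) cat)
           (PSH K r (int n)) (BMH K (int n)))) \<and>
     (\<forall>r\<ge>0. naturally_isomorphic K (qmet :: ('x qspace, 'x \<Rightarrow> 'x) cat)
        (RH K (int n)) (SH K r (int n) UNIV)) \<and>
     (\<forall>r l::int. r \<ge> 1 \<longrightarrow>
        modules_isomorphic K (MPSS K G r l (int n - l))
          (fobj (SH K (real_of_int (r - 1)) (int n) {real_of_int l}) (digraph_space G))) \<and>
     modules_isomorphic K (PH K G (int n))
       (fobj (SH K 1 (int n) {real n}) (digraph_space G))"
proof -
  interpret K: cring K by fact
  show ?thesis
    using K.PH_isomorphic[of G "int n"]
    by (intro conjI allI impI K.MH_isomorphic_SH K.SH_homotopy_invariant K.SH_subquotient_MH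
        K.BMH_isomorphic_PSH K.PSH_homotopy_invariant K.PSH_subquotient_BMH K.RH_isomorphic_SH
        K.MPSS_isomorphic) simp_all
qed

end
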